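(* Let $(e_i)$ be a subsymmetric basis of a Banach space which is not equivalent to the unit vector basis of $\ell_p$ (for any $1\le p<\infty$) or $c_0$, and let $(e_i^* )$ be its sequence of biorthogonal functionals. Then either $(e_i)$ or $(e_i^* )$ admits a continuum of (pairwise) non-equivalent subsymmetric block bases.
   Context: Basic sequences $(x_j)$ and $(y_j)$ are equivalent if, for all scalars $(a_j)$, $\sum_j a_jx_j$ converges if and only if $\sum_j a_jy_j$ converges. A basic sequence is subsymmetric if it is unconditional and equivalent to each of its subsequences. A block basis with respect to a basic sequence $(x_n)$ is a sequence $(y_n)$ of non-zero vectors $y_n=\sum_{k=p_n+1}^{p_{n+1}}a_kx_k$ with $p_1<p_2<\cdots$ natural numbers. "A continuum" means a family of cardinality $2^{\aleph_0}$. *)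

theory Defs
  imports "HOL-Analysis.Analysis" "HOL-Library.Equipollence"
begin

(* All sequences are indexed from 0. *)

definition schauder_basis_of :: "'a::real_normed_vector set \<Rightarrow> (nat \<Rightarrow> 'a) \<Rightarrow> bool" where
  "schauder_basis_of S x \<longleftrightarrow>
     range x \<subseteq> S \<and> (\<forall>v\<in>S. \<exists>!a :: nat \<Rightarrow> real. (\<lambda>n. a n *\<^sub>R x n) sums v)"

definition basic_sequence :: "(nat \<Rightarrow> 'a::real_normed_vector) \<Rightarrow> bool" where
  "basic_sequence x \<longleftrightarrow> schauder_basis_of (closure (span (range x))) x"

definition unconditional :: "(nat \<Rightarrow> 'a::real_normed_vector) \<Rightarrow> bool" where
  "unconditional x \<longleftrightarrow>
     (\<forall>a :: nat \<Rightarrow> real. summable (\<lambda>n. a n *\<^sub>R x n) \<longrightarrow>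
        (\<forall>\<pi>. bij \<pi> \<longrightarrow> summable (\<lambda>n. a (\<pi> n) *\<^sub>R x (\<pi> n))))"

definition equivalent_seq ::
    "(nat \<Rightarrow> 'a::real_normed_vector) \<Rightarrow> (nat \<Rightarrow> 'b::real_normed_vector) \<Rightarrow> bool" where
  "equivalent_seq x y \<longleftrightarrow>
     (\<forall>a :: nat \<Rightarrow> real. summable (\<lambda>j. a j *\<^sub>R x j) \<longleftrightarrow> summable (\<lambda>j. a j *\<^sub>R y j))"

definition subsymmetric :: "(nat \<Rightarrow> 'a::real_normed_vector) \<Rightarrow> bool" where
  "subsymmetric x \<longleftrightarrow>
     basic_sequence x \<and> unconditional x \<and>
     (\<forall>r. strict_mono r \<longrightarrow> equivalent_seq x (x \<circ> r))"

(* With indexing from 0, the usual block {p_n + 1, ..., p_(n+1)} becomes {p n..<p (Suc n)}. *)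
definition block_basis :: "(nat \<Rightarrow> 'a::real_normed_vector) \<Rightarrow> (nat \<Rightarrow> 'a) \<Rightarrow> bool" where
  "block_basis x y \<longleftrightarrow>
     (\<exists>(p :: nat \<Rightarrow> nat) (a :: nat \<Rightarrow> real). strict_mono p \<and>
        (\<forall>n. y n \<noteq> 0 \<and> y n = (\<Sum>k\<in>{p n..<p (Suc n)}. a k *\<^sub>R x k)))"

definition biorthogonal ::
    "(nat \<Rightarrow> 'a::real_normed_vector) \<Rightarrow> (nat \<Rightarrow> 'a \<Rightarrow>\<^sub>L real) \<Rightarrow> bool" where
  "biorthogonal x f \<longleftrightarrow> (\<forall>i j. blinfun_apply (f i) (x j) = (if i = j then 1 else 0))"

(* The exponent p of l_p is a real number, so l_p and c_0 are given as carrier sets of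
   real sequences together with their norms, rather than as types. *)

definition lp_space :: "real \<Rightarrow> (nat \<Rightarrow> real) set" where
  "lp_space p = {s. summable (\<lambda>i. \<bar>s i\<bar> powr p)}"

definition lp_norm :: "real \<Rightarrow> (nat \<Rightarrow> real) \<Rightarrow> real" where
  "lp_norm p s = (\<Sum>i. \<bar>s i\<bar> powr p) powr (1 / p)"

definition c0_space :: "(nat \<Rightarrow> real) set" where
  "c0_space = {s. s \<longlonglongrightarrow> 0}"

definition c0_norm :: "(nat \<Rightarrow> real) \<Rightarrow> real" where
  "c0_norm s = (SUP i. \<bar>s i\<bar>)"

definition unit_seq :: "nat \<Rightarrow> nat \<Rightarrow> real" where
  "unit_seq j = (\<lambda>i. if i = j then 1 else 0)"

(* The counterpart of summable for series of elements of the space with carrier S and norm N. *)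
definition summable_in ::
    "(nat \<Rightarrow> real) set \<Rightarrow> ((nat \<Rightarrow> real) \<Rightarrow> real) \<Rightarrow> (nat \<Rightarrow> nat \<Rightarrow> real) \<Rightarrow> bool" where
  "summable_in S N w \<longleftrightarrow>
     (\<exists>s\<in>S. (\<lambda>n. N (\<lambda>i. (\<Sum>j<n. w j i) - s i)) \<longlonglongrightarrow> 0)"

definition equivalent_to_unit_basis ::
    "(nat \<Rightarrow> real) set \<Rightarrow> ((nat \<Rightarrow> real) \<Rightarrow> real) \<Rightarrow> (nat \<Rightarrow> 'a::real_normed_vector) \<Rightarrow> bool" where
  "equivalent_to_unit_basis S N x \<longleftrightarrow>
     (\<forall>a :: nat \<Rightarrow> real.
        summable (\<lambda>j. a j *\<^sub>R x j) \<longleftrightarrow> summable_in S N (\<lambda>j i. a j * unit_seq j i))"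

definition admits_continuum_of_subsymmetric_blocks ::
    "(nat \<Rightarrow> 'a::real_normed_vector) \<Rightarrow> bool" where
  "admits_continuum_of_subsymmetric_blocks x \<longleftrightarrow>
     (\<exists>F :: (nat \<Rightarrow> 'a) set. F \<approx> (UNIV :: nat set set) \<and>
        (\<forall>y\<in>F. block_basis x y \<and> subsymmetric y) \<and>
        (\<forall>y\<in>F. \<forall>z\<in>F. y \<noteq> z \<longrightarrow> \<not> equivalent_seq y z))"

end

theory Submission
  imports Defs
begin

text \<open>
Call a sequence tensor bounded if the norm of $b\<otimes>a$, the combination of consecutive copies of
the finite vector $a$ with coefficients $b$, is at most a constant times the product of the norms of
$a$ and $b$.

If a subsymmetric sequence is not tensor bounded, it has a continuum of non-equivalent
subsymmetric block bases (\<open>not_tensor_bounded_imp_continuum\<close>). Choose normalized finite vectors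
$\<alpha>_l,\<beta>_l$ with $\<beta>_l\<otimes>\<alpha>_l$ very large and weights $c_l$ tending to zero very fast, and
for a set $A$ of natural numbers let $y^A$ be the block basis of longer and longer pieces of the
vector $x_0+\<Sum>_{l\<in>A}c_l\<alpha>_l$. The vector $\<beta>_l$ distinguishes $y^A$ from $y^B$ when
$l\<in>A-B$; if infinitely many $l$ do so, $y^A$ and $y^B$ are not equivalent. There are continuum
many sets which pairwise differ by infinite sets.

So suppose that the basis $(e_i)$ and $(e_i^*)$ are both tensor bounded. Applying a
product of norming functionals to $b\<otimes>a$ turns tensor boundedness of $(e_i^*)$ into a lower
estimate for $(e_i)$ (\<open>dual_tensor_bounded_imp_tensor_ge\<close>), so that the norm of $b\<otimes>a$ is
equivalent to the product of the norms. Then $\<lambda>(n)=\<parallel>e_0+\<dots>+e_{n-1}\<parallel>$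
satisfies $\<lambda>(mn)\<sim>\<lambda>(m)\<lambda>(n)$, hence $\<lambda>(n)\<sim>n^s$ with $0\<le>s\<le>1$
(\<open>fundamental_power_like\<close>). If $s=0$, the basis is equivalent to the one of $c_0$. Otherwise let
$p=1/s$. The $k$-th tensor power of a vector with $n$ coordinates has at most $(k+1)^n$ distinct
coefficients; grouping equal ones and using $\<lambda>(n)\<sim>n^{1/p}$ compares its norm with its
$\<ell>_p$ norm up to a factor polynomial in $k$, and taking $k$-th roots shows that the norm of
the vector itself is equivalent to its $\<ell>_p$ norm (\<open>multiplicative_norm_imp_lp_norm\<close>).

All estimates need uniform constants, whereas the definition of subsymmetry speaks about
convergence only. The bridge is \<open>subsymmetric_basis_imp_unif_subsym\<close>, proved with the Baire category
theorem and a gliding hump; \<open>biorthogonal_unif_subsym\<close> transfers the uniform condition to the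
functionals.
\<close>

section \<open>Uniform subsymmetry\<close>

text \<open>Unconditionality and invariance under spreading, each with a uniform constant, are packed into one
inequality, because one application of it both shrinks the coefficients and moves the index set.
For a subsymmetric basis of a Banach space some such constant exists; conversely the inequality
implies subsymmetry and is stable under passing to the biorthogonal functionals and to the
block bases used below.\<close>

definition uniformly_subsymmetric :: "real \<Rightarrow> (nat \<Rightarrow> 'a::real_normed_vector) \<Rightarrow> bool" where
  "uniformly_subsymmetric C x \<longleftrightarrow> 1 \<le> C \<and> x 0 \<noteq> 0 \<and>
     (\<forall>F (a :: nat \<Rightarrow> real) b (r :: nat \<Rightarrow> nat) s.
        finite F \<longrightarrow> strict_mono_on F r \<longrightarrow> strict_mono_on F s \<longrightarrow> (\<forall>i\<in>F. \<bar>a i\<bar> \<le> \<bar>b i\<bar>) \<longrightarrow>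
        norm (\<Sum>i\<in>F. a i *\<^sub>R x (r i)) \<le> C * norm (\<Sum>i\<in>F. b i *\<^sub>R x (s i)))"

lemma unif_subsym_ge_1: "uniformly_subsymmetric C x \<Longrightarrow> 1 \<le> C"
  by (simp add: uniformly_subsymmetric_def)

text \<open>The form used throughout: the index set of the sums is arbitrary, so that double sums can be
compared directly, and only the relative order of the positions matters.\<close>

lemma unif_subsym_dominated:
  fixes g h :: "'i \<Rightarrow> nat" and a b :: "'i \<Rightarrow> real"
  assumes U: "uniformly_subsymmetric C x"
    and F: "finite F" and h: "inj_on h F"
    and order: "\<And>s t. s \<in> F \<Longrightarrow> t \<in> F \<Longrightarrow> h s < h t \<Longrightarrow> g s < g t"
    and ab: "\<And>t. t \<in> F \<Longrightarrow> \<bar>a t\<bar> \<le> \<bar>b t\<bar>"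
  shows "norm (\<Sum>t\<in>F. a t *\<^sub>R x (g t)) \<le> C * norm (\<Sum>t\<in>F. b t *\<^sub>R x (h t))"
proof -
  define k where "k = the_inv_into F h"
  have k: "k (h t) = t" if "t \<in> F" for t
    using h that by (simp add: k_def the_inv_into_f_f)
  have "norm (\<Sum>i\<in>h ` F. a (k i) *\<^sub>R x (g (k i))) \<le> C * norm (\<Sum>i\<in>h ` F. b (k i) *\<^sub>R x i)"
    using U unfolding uniformly_subsymmetric_def
  proof (elim conjE allE impE)
    show "finite (h ` F)" using F by simp
    show "strict_mono_on (h ` F) (\<lambda>i. g (k i))"
      by (auto simp: strict_mono_on_def k order)
    show "strict_mono_on (h ` F) (\<lambda>i. i)" by (auto simp: strict_mono_on_def)
    show "\<forall>i\<in>h ` F. \<bar>a (k i)\<bar> \<le> \<bar>b (k i)\<bar>" by (auto simp: k ab)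
  qed auto
  moreover have "(\<Sum>i\<in>h ` F. a (k i) *\<^sub>R x (g (k i))) = (\<Sum>t\<in>F. a t *\<^sub>R x (g t))"
    by (subst sum.reindex[OF h]) (auto intro!: sum.cong simp: k)
  moreover have "(\<Sum>i\<in>h ` F. b (k i) *\<^sub>R x i) = (\<Sum>t\<in>F. b t *\<^sub>R x (h t))"
    by (subst sum.reindex[OF h]) (auto intro!: sum.cong simp: k)
  ultimately show ?thesis by simp
qed

lemma unif_subsym_restrict:
  fixes h :: "'i \<Rightarrow> nat" and a b :: "'i \<Rightarrow> real"
  assumes U: "uniformly_subsymmetric C x"
    and G: "finite G" and FG: "F \<subseteq> G" and h: "inj_on h G"
    and ab: "\<And>t. t \<in> F \<Longrightarrow> \<bar>a t\<bar> \<le> \<bar>b t\<bar>"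
  shows "norm (\<Sum>t\<in>F. a t *\<^sub>R x (h t)) \<le> C * norm (\<Sum>t\<in>G. b t *\<^sub>R x (h t))"
proof -
  have "(\<Sum>t\<in>F. a t *\<^sub>R x (h t)) = (\<Sum>t\<in>G. (if t \<in> F then a t else 0) *\<^sub>R x (h t))"
    using G FG by (intro sum.mono_neutral_cong_left) auto
  also have "norm \<dots> \<le> C * norm (\<Sum>t\<in>G. b t *\<^sub>R x (h t))"
    using U G h by (intro unif_subsym_dominated) (auto simp: ab)
  finally show ?thesis .
qed

lemma unif_subsym_dominated_restrict:
  fixes g h :: "'i \<Rightarrow> nat" and a b :: "'i \<Rightarrow> real"
  assumes U: "uniformly_subsymmetric C x"
    and G: "finite G" and FG: "F \<subseteq> G" and h: "inj_on h G"
    and order: "\<And>s t. s \<in> F \<Longrightarrow> t \<in> F \<Longrightarrow> h s < h t \<Longrightarrow> g s < g t"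
    and ab: "\<And>t. t \<in> F \<Longrightarrow> \<bar>a t\<bar> \<le> \<bar>b t\<bar>"
  shows "norm (\<Sum>t\<in>F. a t *\<^sub>R x (g t)) \<le> C\<^sup>2 * norm (\<Sum>t\<in>G. b t *\<^sub>R x (h t))"
proof -
  have "norm (\<Sum>t\<in>F. a t *\<^sub>R x (g t)) \<le> C * norm (\<Sum>t\<in>F. b t *\<^sub>R x (h t))"
    using finite_subset[OF FG G] inj_on_subset[OF h FG] order ab by (intro unif_subsym_dominated[OF U])
  also have "\<dots> \<le> C * (C * norm (\<Sum>t\<in>G. b t *\<^sub>R x (h t)))"
    using unif_subsym_ge_1[OF U] by (intro mult_left_mono unif_subsym_restrict[OF U G FG h]) auto
  finally show ?thesis by (simp add: power2_eq_square mult_ac)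
qed

lemma unif_subsym_norm_le: "uniformly_subsymmetric C x \<Longrightarrow> norm (x i) \<le> C * norm (x j)"
  using unif_subsym_dominated[of C x "{()}" "\<lambda>_. j" "\<lambda>_. i" "\<lambda>_. 1" "\<lambda>_. 1"] by simp

lemma unif_subsym_nonzero: "uniformly_subsymmetric C x \<Longrightarrow> x i \<noteq> 0"
  using unif_subsym_norm_le[of C x 0 i] by (auto simp: uniformly_subsymmetric_def)

lemma unif_subsym_coeff_le:
  fixes h :: "'i \<Rightarrow> nat" and b :: "'i \<Rightarrow> real"
  assumes U: "uniformly_subsymmetric C x" and G: "finite G" and h: "inj_on h G" and t: "t \<in> G"
  shows "\<bar>b t\<bar> * norm (x 0) \<le> C\<^sup>2 * norm (\<Sum>t\<in>G. b t *\<^sub>R x (h t))"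
  using unif_subsym_dominated_restrict[OF U G _ h, of "{t}" "\<lambda>_. 0" b b] t by simp

text \<open>The bound says that the partial sum projections are uniformly bounded on the span. The vectors
with an expansion therefore form a closed subspace: along a convergent sequence of such vectors
the coefficients converge, and they expand the limit.\<close>

lemma basic_sequenceI:
  fixes x :: "nat \<Rightarrow> 'a::real_normed_vector"
  assumes nz: "\<And>n. x n \<noteq> 0"
    and M: "\<And>n m (a :: nat \<Rightarrow> real). n \<le> m \<Longrightarrow>
              norm (\<Sum>i<n. a i *\<^sub>R x i) \<le> M * norm (\<Sum>i<m. a i *\<^sub>R x i)"
  shows "basic_sequence x"
proof -
  have partial: "norm (\<Sum>i<n. a i *\<^sub>R x i) \<le> M * norm v" if "(\<lambda>i. a i *\<^sub>R x i) sums v" for a n v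
  proof (rule tendsto_lowerbound)
    show "(\<lambda>m. M * norm (\<Sum>i<m. a i *\<^sub>R x i)) \<longlonglongrightarrow> M * norm v"
      using that unfolding sums_def by (intro tendsto_intros)
    show "\<forall>\<^sub>F m in sequentially. norm (\<Sum>i<n. a i *\<^sub>R x i) \<le> M * norm (\<Sum>i<m. a i *\<^sub>R x i)"
      using eventually_ge_at_top[of n] by eventually_elim (rule M)
  qed auto
  have M0: "0 \<le> M"
  proof -
    have "0 < norm (\<Sum>i<1. (1::real) *\<^sub>R x i)" using nz by simp
    also have "\<dots> \<le> M * norm (\<Sum>i<1. (1::real) *\<^sub>R x i)" by (rule M) simp
    finally show ?thesis by (simp add: zero_less_mult_iff)
  qed
  have coeff: "\<bar>a i\<bar> * norm (x i) \<le> 2 * M * norm v" if "(\<lambda>i. a i *\<^sub>R x i) sums v" for a i v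
  proof -
    have "a i *\<^sub>R x i = (\<Sum>j<Suc i. a j *\<^sub>R x j) - (\<Sum>j<i. a j *\<^sub>R x j)" by simp
    then have "norm (a i *\<^sub>R x i) \<le> norm (\<Sum>j<Suc i. a j *\<^sub>R x j) + norm (\<Sum>j<i. a j *\<^sub>R x j)"
      by (metis norm_triangle_ineq4)
    also have "\<dots> \<le> M * norm v + M * norm v" by (intro add_mono partial that)
    finally show ?thesis by simp
  qed
  define S where "S = {v. \<exists>a :: nat \<Rightarrow> real. (\<lambda>i. a i *\<^sub>R x i) sums v}"
  have SI: "v \<in> S" if "(\<lambda>i. a i *\<^sub>R x i) sums v" for a v
    using that by (auto simp: S_def)
  have "subspace S"
  proof (rule subspaceI)
    show "0 \<in> S" by (rule SI[of "\<lambda>_. 0"]) simp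
  next
    fix u v assume "u \<in> S" "v \<in> S"
    then obtain a b where "(\<lambda>i. a i *\<^sub>R x i) sums u" "(\<lambda>i. b i *\<^sub>R x i) sums v"
      by (auto simp: S_def)
    then have "(\<lambda>i. (a i + b i) *\<^sub>R x i) sums (u + v)"
      by (simp add: sums_add scaleR_add_left)
    then show "u + v \<in> S" by (rule SI)
  next
    fix c :: real and v assume "v \<in> S"
    then obtain a where "(\<lambda>i. a i *\<^sub>R x i) sums v" by (auto simp: S_def)
    then have "(\<lambda>i. (c * a i) *\<^sub>R x i) sums (c *\<^sub>R v)"
      using sums_scaleR_right[of "\<lambda>i. a i *\<^sub>R x i" v c] by simp
    then show "c *\<^sub>R v \<in> S" by (rule SI)
  qed
  moreover have "range x \<subseteq> S"
  proof
    fix v assume "v \<in> range x"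
    then obtain k where "v = x k" by auto
    have "(\<lambda>i. (if i = k then x i else 0)) sums x k" by (rule sums_single)
    also have "(\<lambda>i. (if i = k then x i else 0)) = (\<lambda>i. (if i = k then 1 else 0) *\<^sub>R x i)" by auto
    finally show "v \<in> S" unfolding \<open>v = x k\<close> by (rule SI)
  qed
  ultimately have "span (range x) \<subseteq> S" by (simp add: span_minimal)
  moreover have "closed S"
    unfolding closed_sequential_limits
  proof (intro allI impI, elim conjE)
    fix v l assume vS: "\<forall>n. v n \<in> S" and vl: "v \<longlonglongrightarrow> l"
    from vS have "\<exists>A. \<forall>k. (\<lambda>i. A k i *\<^sub>R x i) sums v k" unfolding S_def mem_Collect_eq by metis
    then obtain A :: "nat \<Rightarrow> nat \<Rightarrow> real" where A: "\<And>k. (\<lambda>i. A k i *\<^sub>R x i) sums v k" by blast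
    have diff: "(\<lambda>i. (A k i - A j i) *\<^sub>R x i) sums (v k - v j)" for k j
      using sums_diff[OF A[of k] A[of j]] by (simp add: scaleR_diff_left)
    have "Cauchy v" using vl by (rule LIMSEQ_imp_Cauchy)
    have "convergent (\<lambda>k. A k i)" for i
    proof (rule real_Cauchy_convergent, rule CauchyI)
      fix e :: real assume "0 < e"
      then have "0 < e * norm (x i) / (2 * M + 1)" using nz M0 by simp
      from CauchyD[OF \<open>Cauchy v\<close> this] obtain N where
        N: "\<And>k j. k \<ge> N \<Longrightarrow> j \<ge> N \<Longrightarrow> norm (v k - v j) < e * norm (x i) / (2 * M + 1)" by blast
      have "norm (A k i - A j i) < e" if kj: "k \<ge> N" "j \<ge> N" for k j
      proof -
        have "\<bar>A k i - A j i\<bar> * norm (x i) \<le> 2 * M * norm (v k - v j)" by (rule coeff[OF diff])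
        also have "\<dots> \<le> (2 * M + 1) * norm (v k - v j)" by (intro mult_right_mono) auto
        also have "\<dots> < (2 * M + 1) * (e * norm (x i) / (2 * M + 1))"
          using N[OF kj] M0 by (intro mult_strict_left_mono) auto
        also have "\<dots> = e * norm (x i)" using M0 by simp
        finally show ?thesis using nz by simp
      qed
      then show "\<exists>N. \<forall>k\<ge>N. \<forall>j\<ge>N. norm (A k i - A j i) < e" by blast
    qed
    then obtain a where a: "\<And>i. (\<lambda>k. A k i) \<longlonglongrightarrow> a i" unfolding convergent_def by metis
    have close: "norm (\<Sum>i<n. (A k i - a i) *\<^sub>R x i) \<le> M * norm (v k - l)" for k n
    proof (rule tendsto_le)
      show "(\<lambda>j. norm (\<Sum>i<n. (A k i - A j i) *\<^sub>R x i)) \<longlonglongrightarrow> norm (\<Sum>i<n. (A k i - a i) *\<^sub>R x i)"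
        by (intro tendsto_intros a)
      show "(\<lambda>j. M * norm (v k - v j)) \<longlonglongrightarrow> M * norm (v k - l)"
        by (intro tendsto_intros vl)
      show "\<forall>\<^sub>F j in sequentially. norm (\<Sum>i<n. (A k i - A j i) *\<^sub>R x i) \<le> M * norm (v k - v j)"
        using partial[OF diff] by (auto intro!: always_eventually)
    qed auto
    have "(\<lambda>i. a i *\<^sub>R x i) sums l"
      unfolding sums_def
    proof (rule LIMSEQ_I)
      fix e :: real assume e: "0 < e"
      have "0 < e / (2 * (M + 1))" using e M0 by simp
      with vl obtain k where k: "norm (v k - l) < e / (2 * (M + 1))" by (meson LIMSEQ_D order_refl)
      have "0 < e / 2" using e by simp
      with A[of k] obtain N where N: "\<And>n. n \<ge> N \<Longrightarrow> norm ((\<Sum>i<n. A k i *\<^sub>R x i) - v k) < e / 2"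
        unfolding sums_def by (meson LIMSEQ_D)
      have "norm ((\<Sum>i<n. a i *\<^sub>R x i) - l) < e" if "n \<ge> N" for n
      proof -
        have eq: "(\<Sum>i<n. a i *\<^sub>R x i) - l =
            ((\<Sum>i<n. A k i *\<^sub>R x i) - v k) - (\<Sum>i<n. (A k i - a i) *\<^sub>R x i) + (v k - l)"
          by (simp add: scaleR_diff_left sum_subtractf)
        have "norm ((\<Sum>i<n. a i *\<^sub>R x i) - l) \<le>
            norm ((\<Sum>i<n. A k i *\<^sub>R x i) - v k) + norm (\<Sum>i<n. (A k i - a i) *\<^sub>R x i) + norm (v k - l)"
          unfolding eq by (rule order_trans[OF norm_triangle_ineq add_right_mono[OF norm_triangle_ineq4]])
        also have "\<dots> \<le> norm ((\<Sum>i<n. A k i *\<^sub>R x i) - v k) + (M + 1) * norm (v k - l)"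
          using close[of k n] by (simp add: distrib_right)
        also have "\<dots> < e / 2 + (M + 1) * (e / (2 * (M + 1)))"
          using N[OF that] k M0 by (intro add_strict_mono mult_strict_left_mono) auto
        also have "\<dots> = e" using M0 by (simp add: field_simps)
        finally show ?thesis .
      qed
      then show "\<exists>N. \<forall>n\<ge>N. norm ((\<Sum>i<n. a i *\<^sub>R x i) - l) < e" by blast
    qed
    then show "l \<in> S" by (rule SI)
  qed
  ultimately have "closure (span (range x)) \<subseteq> S" by (rule closure_minimal)
  moreover have "a = b" if "(\<lambda>i. a i *\<^sub>R x i) sums v" "(\<lambda>i. b i *\<^sub>R x i) sums v" for a b v
  proof
    fix i
    have "(\<lambda>i. (a i - b i) *\<^sub>R x i) sums 0"
      using sums_diff[OF that] by (simp add: scaleR_diff_left)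
    from coeff[OF this, of i] show "a i = b i" using nz by (simp add: mult_le_0_iff)
  qed
  moreover have "range x \<subseteq> closure (span (range x))"
    using span_superset closure_subset by (rule subset_trans)
  ultimately show ?thesis
    unfolding basic_sequence_def schauder_basis_of_def S_def
    by (intro conjI ballI ex_ex1I) auto
qed

lemma unif_subsym_partial:
  assumes U: "uniformly_subsymmetric C x" and "n \<le> (m::nat)"
  shows "norm (\<Sum>i<n. a i *\<^sub>R x i) \<le> C * norm (\<Sum>i<m. a i *\<^sub>R x i)"
  by (rule unif_subsym_restrict[OF U]) (use assms in auto)

lemma unif_subsym_dominated_summable:
  fixes x :: "nat \<Rightarrow> 'a::banach"
  assumes U: "uniformly_subsymmetric C x" and r: "strict_mono r" and s: "strict_mono s"
    and ab: "\<And>i. \<bar>a i\<bar> \<le> \<bar>b i\<bar>"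
    and b: "summable (\<lambda>i. b i *\<^sub>R x (s i))"
  shows "summable (\<lambda>i. a i *\<^sub>R x (r i))"
  unfolding summable_Cauchy
proof (intro allI impI)
  fix e :: real assume "0 < e"
  then have "0 < e / C" using unif_subsym_ge_1[OF U] by simp
  with b obtain N where N: "\<And>m n. m \<ge> N \<Longrightarrow> norm (\<Sum>i=m..<n. b i *\<^sub>R x (s i)) < e / C"
    unfolding summable_Cauchy by meson
  have "norm (\<Sum>i=m..<n. a i *\<^sub>R x (r i)) < e" if "m \<ge> N" for m n
  proof -
    have "norm (\<Sum>i=m..<n. a i *\<^sub>R x (r i)) \<le> C * norm (\<Sum>i=m..<n. b i *\<^sub>R x (s i))"
      using r s ab by (intro unif_subsym_dominated[OF U])
        (auto simp: strict_mono_less intro: inj_on_subset[OF strict_mono_imp_inj_on])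
    also have "\<dots> < C * (e / C)" using N[OF that] unif_subsym_ge_1[OF U] by (intro mult_strict_left_mono) auto
    finally show ?thesis using unif_subsym_ge_1[OF U] by simp
  qed
  then show "\<exists>N. \<forall>m\<ge>N. \<forall>n. norm (\<Sum>i=m..<n. a i *\<^sub>R x (r i)) < e" by blast
qed

text \<open>All three properties are Cauchy criteria. For unconditionality, the image under a permutation of
a far out interval of indices lies far out again, and its sum is dominated by an interval sum.\<close>

lemma unif_subsym_imp_subsymmetric:
  fixes x :: "nat \<Rightarrow> 'a::banach"
  assumes U: "uniformly_subsymmetric C x"
  shows "subsymmetric x"
  unfolding subsymmetric_def
proof (intro conjI allI impI)
  show "basic_sequence x"
    using unif_subsym_nonzero[OF U] unif_subsym_partial[OF U] by (rule basic_sequenceI)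
  show "unconditional x"
    unfolding unconditional_def
  proof (intro allI impI)
    fix a :: "nat \<Rightarrow> real" and \<pi> :: "nat \<Rightarrow> nat"
    assume sm: "summable (\<lambda>n. a n *\<^sub>R x n)" and \<pi>: "bij \<pi>"
    show "summable (\<lambda>n. a (\<pi> n) *\<^sub>R x (\<pi> n))"
      unfolding summable_Cauchy
    proof (intro allI impI)
      fix e :: real assume "0 < e"
      then have "0 < e / C" using unif_subsym_ge_1[OF U] by simp
      with sm obtain N where N: "\<And>m n. m \<ge> N \<Longrightarrow> norm (\<Sum>i=m..<n. a i *\<^sub>R x i) < e / C"
        unfolding summable_Cauchy by meson
      have inj: "inj \<pi>" using \<pi> by (simp add: bij_def)
      then have "finite (\<pi> -` {..<N})" by (simp add: finite_vimageI)
      then obtain K where K: "\<And>k. \<pi> k < N \<Longrightarrow> k < K"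
        by (metis finite_nat_set_iff_bounded lessThan_iff vimage_eq)
      have "norm (\<Sum>i=m..<n. a (\<pi> i) *\<^sub>R x (\<pi> i)) < e" if "m \<ge> K" for m n
      proof -
        define G where "G = \<pi> ` {m..<n}"
        obtain L where L: "G \<subseteq> {..<L}" unfolding G_def
          by (metis finite_atLeastLessThan finite_imageI finite_nat_bounded)
        have GN: "G \<subseteq> {N..<L}" 
        proof
          fix g assume g: "g \<in> G"
          then obtain i where i: "g = \<pi> i" "m \<le> i" by (auto simp: G_def)
          with K[of i] that have "\<not> \<pi> i < N" by linarith
          with g i L show "g \<in> {N..<L}" by auto
        qed
        have "(\<Sum>i=m..<n. a (\<pi> i) *\<^sub>R x (\<pi> i)) = (\<Sum>i\<in>G. a i *\<^sub>R x i)"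
          unfolding G_def using inj by (subst sum.reindex) (auto intro: inj_on_subset)
        also have "norm \<dots> \<le> C * norm (\<Sum>i=N..<L. a i *\<^sub>R x i)"
          by (rule unif_subsym_restrict[OF U]) (use GN in auto)
        also have "\<dots> < C * (e / C)" using N[of N L] unif_subsym_ge_1[OF U] by (intro mult_strict_left_mono) auto
        finally show ?thesis using unif_subsym_ge_1[OF U] by simp
      qed
      then show "\<exists>N. \<forall>m\<ge>N. \<forall>n. norm (\<Sum>i=m..<n. a (\<pi> i) *\<^sub>R x (\<pi> i)) < e" by blast
    qed
  qed
next
  fix r :: "nat \<Rightarrow> nat" assume r: "strict_mono r"
  show "equivalent_seq x (x \<circ> r)"
    unfolding equivalent_seq_def o_def
    using unif_subsym_dominated_summable[OF U r strict_mono_id order_refl]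
      unif_subsym_dominated_summable[OF U strict_mono_id r order_refl]
    by auto
qed

section \<open>The basis constant\<close>

lemma schauder_basis_coeff_unique:
  assumes "schauder_basis_of S x" "v \<in> S" "(\<lambda>n. a n *\<^sub>R x n) sums v" "(\<lambda>n. b n *\<^sub>R x n) sums v"
  shows "a = b"
proof -
  define P where "P a \<longleftrightarrow> (\<lambda>n. a n *\<^sub>R x n) sums v" for a
  have "\<exists>!a. P a" using assms(1,2) by (simp add: schauder_basis_of_def P_def)
  moreover have "P a" "P b" using assms(3,4) by (simp_all add: P_def)
  ultimately show ?thesis by blast
qed

lemma schauder_basis_imp_nonzero:
  assumes "schauder_basis_of UNIV x"
  shows "x n \<noteq> 0"
proof
  assume "x n = 0"
  have "(\<lambda>i. 0 *\<^sub>R x i) sums 0" by simp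
  moreover have "(\<lambda>i. (if i = n then 1 else 0) *\<^sub>R x i) sums 0"
  proof -
    have "(\<lambda>i. (if i = n then 1 else 0) *\<^sub>R x i) = (\<lambda>i. 0)" using \<open>x n = 0\<close> by auto
    then show ?thesis by simp
  qed
  ultimately have "(\<lambda>i. 0 :: real) = (\<lambda>i. if i = n then 1 else 0)"
    using assms by (intro schauder_basis_coeff_unique[of UNIV x 0]) auto
  from fun_cong[OF this, of n] show False by simp
qed

text \<open>The Baire category theorem applied to the sets of vectors whose partial sums are bounded by $k$
gives vectors with controlled partial sums close to any prescribed vector. Iterating the
approximation writes $v$ as a series of such vectors $w_j$ with geometrically decreasing control;
adding up their coefficients gives an expansion of $v$, which by uniqueness is the expansion.\<close>

lemma basis_constant_exists:
  fixes x :: "nat \<Rightarrow> 'a::banach"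
  assumes basis: "schauder_basis_of UNIV x"
  obtains M where "\<And>(n::nat) m (a :: nat \<Rightarrow> real). n \<le> m \<Longrightarrow>
      norm (\<Sum>i<n. a i *\<^sub>R x i) \<le> M * norm (\<Sum>i<m. a i *\<^sub>R x i)"
proof -
  have nz: "x n \<noteq> 0" for n by (rule schauder_basis_imp_nonzero[OF basis])
  have "\<forall>v. \<exists>a :: nat \<Rightarrow> real. (\<lambda>i. a i *\<^sub>R x i) sums v"
    using basis unfolding schauder_basis_of_def by (meson UNIV_I ex1_implies_ex)
  then obtain c :: "'a \<Rightarrow> nat \<Rightarrow> real" where c: "\<And>v. (\<lambda>i. c v i *\<^sub>R x i) sums v"
    unfolding choice_iff by blast
  have uniq: "a = c v" if "(\<lambda>i. a i *\<^sub>R x i) sums v" for a v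
    using schauder_basis_coeff_unique[OF basis UNIV_I that c] .
  have c_diff: "c (u - v) = (\<lambda>i. c u i - c v i)" for u v
    using sums_diff[OF c[of u] c[of v]] by (intro uniq[symmetric]) (simp add: scaleR_diff_left)
  have c_scale: "c (t *\<^sub>R v) = (\<lambda>i. t * c v i)" for t v
    using sums_scaleR_right[OF c[of v], of t] by (intro uniq[symmetric]) simp
  define P where "P n v = (\<Sum>i<n. c v i *\<^sub>R x i)" for n v
  have P_diff: "P n (u - v) = P n u - P n v" for n u v
    by (simp add: P_def c_diff scaleR_diff_left sum_subtractf)
  have P_scale: "P n (t *\<^sub>R v) = t *\<^sub>R P n v" for n t v
    by (simp add: P_def c_scale scaleR_sum_right)
  have P_lim: "(\<lambda>n. P n v) \<longlonglongrightarrow> v" for v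
    using c[of v] by (simp add: P_def sums_def)
  \<comment> \<open>The whole space is the union of these closed sets, so one of them has an interior point.\<close>
  define A where "A k = closure {v. \<forall>n. norm (P n v) \<le> real k}" for k :: nat
  have "\<exists>k. v \<in> A k" for v
  proof -
    have "Bseq (\<lambda>n. P n v)" using P_lim by (intro convergent_imp_Bseq) (auto simp: convergent_def)
    then obtain B where "\<And>n. norm (P n v) \<le> B" by (auto simp: Bseq_def)
    moreover obtain k where "B \<le> real k" using real_arch_simple by blast
    ultimately have "\<forall>n. norm (P n v) \<le> real k" by (meson order_trans)
    then have "v \<in> A k" unfolding A_def by (intro subsetD[OF closure_subset]) simp
    then show ?thesis by blast
  qed
  then have "\<Union> (range A) = UNIV" by blast
  have "\<exists>k. interior (A k) \<noteq> {}"
  proof (rule ccontr)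
    assume "\<not> ?thesis"
    then have "Met_TC.mtopology interior_of \<Union> (range A) = {}"
      using complete_UNIV by (intro Met_TC.metric_Baire_category_alt) (auto simp: A_def)
    with \<open>\<Union> (range A) = UNIV\<close> show False by simp
  qed
  then obtain k v0 where "v0 \<in> interior (A k)" by blast
  then obtain \<delta> where \<delta>: "0 < \<delta>" "ball v0 \<delta> \<subseteq> A k"
    by (meson mem_interior)
  define K where "K = 4 * real k / \<delta>"
  have K0: "0 \<le> K" using \<delta> by (simp add: K_def)
  \<comment> \<open>Differences of elements near the interior point approximate every small vector.\<close>
  have approx: "\<exists>w. (\<forall>n. norm (P n w) \<le> K * norm u) \<and> norm (u - w) < \<epsilon>" if "0 < \<epsilon>" for u \<epsilon>
  proof (cases "u = 0")
    case True
    have "P n 0 = 0" for n using P_scale[of n 0 0] by simp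
    with True that show ?thesis by (intro exI[of _ 0]) simp
  next
    case False
    define t where "t = 2 * norm u / \<delta>"
    have t: "0 < t" using False \<delta> by (simp add: t_def)
    define \<eta> where "\<eta> = \<epsilon> / (2 * t)"
    have \<eta>: "0 < \<eta>" using t that by (simp add: \<eta>_def)
    have "v0 + (1 / t) *\<^sub>R u \<in> A k"
      using \<delta> False by (intro subsetD[OF \<delta>(2)]) (auto simp: dist_norm t_def)
    then obtain p where p: "\<forall>n. norm (P n p) \<le> real k" "dist p (v0 + (1 / t) *\<^sub>R u) < \<eta>"
      using \<eta> unfolding A_def closure_approachable by blast
    have "v0 \<in> A k" using \<delta> by (intro subsetD[OF \<delta>(2)]) auto
    then obtain q where q: "\<forall>n. norm (P n q) \<le> real k" "dist q v0 < \<eta>"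
      using \<eta> unfolding A_def closure_approachable by blast
    define w where "w = t *\<^sub>R (p - q)"
    have "norm (P n w) \<le> K * norm u" for n
    proof -
      have "norm (P n w) = t * norm (P n p - P n q)" using t by (simp add: w_def P_scale P_diff)
      also have "\<dots> \<le> t * (real k + real k)"
        using t p(1) q(1) by (intro mult_left_mono order_trans[OF norm_triangle_ineq4] add_mono) auto
      also have "\<dots> = K * norm u" by (simp add: K_def t_def)
      finally show ?thesis .
    qed
    moreover have "norm (u - w) < \<epsilon>"
    proof -
      have "u - w = t *\<^sub>R ((q - v0) - (p - (v0 + (1 / t) *\<^sub>R u)))"
        using t by (simp add: w_def algebra_simps)
      also have "norm \<dots> = t * norm ((q - v0) - (p - (v0 + (1 / t) *\<^sub>R u)))" using t by simp
      also have "\<dots> \<le> t * (norm (q - v0) + norm (p - (v0 + (1 / t) *\<^sub>R u)))"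
        using t by (intro mult_left_mono norm_triangle_ineq4) auto
      also have "\<dots> < t * (\<eta> + \<eta>)"
        using t p(2) q(2) by (intro mult_strict_left_mono add_strict_mono) (auto simp: dist_norm)
      also have "\<dots> = \<epsilon>" using t by (simp add: \<eta>_def)
      finally show ?thesis .
    qed
    ultimately show ?thesis by blast
  qed
  have bound: "norm (P n v) \<le> 2 * K * norm v" for n v
  proof (cases "v = 0")
    case True
    then show ?thesis using P_scale[of n 0 0] by simp
  next
    case False
    define R where "R = norm v"
    have R: "0 < R" using False by (simp add: R_def)
    define W where
      "W u \<epsilon> = (SOME w. (\<forall>n. norm (P n w) \<le> K * norm u) \<and> norm (u - w) < \<epsilon>)" for u \<epsilon>
    have W: "\<And>u \<epsilon> n. 0 < \<epsilon> \<Longrightarrow> norm (P n (W u \<epsilon>)) \<le> K * norm u"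
      "\<And>u \<epsilon>. 0 < \<epsilon> \<Longrightarrow> norm (u - W u \<epsilon>) < \<epsilon>"
      using someI_ex[OF approx] unfolding W_def by auto
    define r where "r = rec_nat v (\<lambda>j u. u - W u (R / 2 ^ Suc j))"
    define w where "w j = W (r j) (R / 2 ^ Suc j)" for j
    have r_0: "r 0 = v" and r_Suc: "r (Suc j) = r j - w j" for j
      by (simp_all add: r_def w_def)
    have r_le: "norm (r j) \<le> R / 2 ^ j" for j
    proof (cases j)
      case (Suc i)
      have "0 < R / 2 ^ Suc i" using R by simp
      from W(2)[OF this, of "r i"] show ?thesis unfolding Suc r_Suc w_def by simp
    qed (simp add: r_0 R_def)
    have w_le: "norm (P m (w j)) \<le> K * R * (1/2) ^ j" for m j
    proof -
      have "norm (P m (w j)) \<le> K * norm (r j)" unfolding w_def using R by (intro W(1)) simp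
      also have "\<dots> \<le> K * (R / 2 ^ j)" using K0 r_le by (intro mult_left_mono)
      finally show ?thesis by (simp add: power_one_over)
    qed
    have r_eq: "r J = v - (\<Sum>j<J. w j)" for J
      by (induction J) (simp_all add: r_0 r_Suc)
    have geo: "summable (\<lambda>j. K * R * (1/2) ^ j)" by (intro summable_mult summable_geometric) simp
    have sumP: "summable (\<lambda>j. P m (w j))" for m
      by (rule summable_comparison_test'[OF geo]) (rule w_le)
    have geo_tail: "(\<lambda>j. K * R * (1/2) ^ (j + J)) sums (2 * K * R * (1/2) ^ J)" for J
    proof -
      have "(\<lambda>j. (1/2::real) ^ j) sums 2" using geometric_sums[of "1/2::real"] by simp
      from sums_mult[OF this, of "K * R * (1/2) ^ J"] show ?thesis by (simp add: power_add mult_ac)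
    qed
    have tail: "norm (\<Sum>j. P m (w (j + J))) \<le> 2 * K * R * (1/2) ^ J" for m J
    proof -
      have s: "summable (\<lambda>j. norm (P m (w (j + J))))"
        by (rule summable_comparison_test'[OF sums_summable[OF geo_tail[of J]]]) (simp add: w_le)
      then have "norm (\<Sum>j. P m (w (j + J))) \<le> (\<Sum>j. norm (P m (w (j + J))))" by (rule summable_norm)
      also have "\<dots> \<le> (\<Sum>j. K * R * (1/2) ^ (j + J))"
        by (intro suminf_le w_le s sums_summable[OF geo_tail])
      also have "\<dots> = 2 * K * R * (1/2) ^ J" using geo_tail by (rule sums_unique[symmetric])
      finally show ?thesis .
    qed
    have summand: "P (Suc i) (w j) - P i (w j) = c (w j) i *\<^sub>R x i" for i j
      by (simp add: P_def)
    have sum_c: "summable (\<lambda>j. c (w j) i)" for i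
    proof (rule summable_comparison_test'[OF summable_mult[OF geo, of "2 / norm (x i)"]])
      fix j
      have "norm (c (w j) i) * norm (x i) = norm (P (Suc i) (w j) - P i (w j))" by (simp add: summand)
      also have "\<dots> \<le> K * R * (1/2) ^ j + K * R * (1/2) ^ j"
        by (intro order_trans[OF norm_triangle_ineq4] add_mono w_le)
      finally show "norm (c (w j) i) \<le> 2 / norm (x i) * (K * R * (1/2) ^ j)"
        using nz by (simp add: field_simps)
    qed
    \<comment> \<open>The coefficients of the sum of the approximants, to be identified with those of \<open>v\<close>.\<close>
    define d where "d i = (\<Sum>j. c (w j) i)" for i
    have d_eq: "(\<Sum>i<m. d i *\<^sub>R x i) = (\<Sum>j. P m (w j))" for m
    proof -
      have "(\<lambda>j. \<Sum>i<m. c (w j) i *\<^sub>R x i) sums (\<Sum>i<m. d i *\<^sub>R x i)"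
        unfolding d_def by (intro sums_sum sums_scaleR_left summable_sums sum_c)
      then show ?thesis unfolding P_def by (simp add: sums_unique)
    qed
    have "(\<lambda>i. d i *\<^sub>R x i) sums v"
      unfolding sums_def
    proof (rule LIMSEQ_I)
      fix e :: real assume e: "0 < e"
      have "(\<lambda>J. (2 * K * R + R) * (1/2) ^ J) \<longlonglongrightarrow> (2 * K * R + R) * 0"
        by (intro tendsto_intros LIMSEQ_abs_realpow_zero2) simp
      then have "\<forall>\<^sub>F J in sequentially. (2 * K * R + R) * (1/2) ^ J < e / 2"
        using e by (intro order_tendstoD(2)[of _ "(2 * K * R + R) * 0"]) auto
      then obtain J where J: "(2 * K * R + R) * (1/2) ^ J < e / 2"
        by (auto simp: eventually_sequentially)
      have "(\<lambda>m. \<Sum>j<J. P m (w j) - w j) \<longlonglongrightarrow> (\<Sum>j<J. w j - w j)"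
        by (intro tendsto_intros P_lim)
      then have "\<forall>\<^sub>F m in sequentially. norm (\<Sum>j<J. P m (w j) - w j) < e / 2"
        using e by (intro order_tendstoD(2)[of _ 0] tendsto_norm_zero) auto
      then obtain N where N: "\<And>m. m \<ge> N \<Longrightarrow> norm (\<Sum>j<J. P m (w j) - w j) < e / 2"
        by (auto simp: eventually_sequentially)
      have r_J: "norm (r J) \<le> R * (1/2) ^ J" using r_le[of J] by (simp add: power_one_over)
      have "norm ((\<Sum>i<m. d i *\<^sub>R x i) - v) < e" if "m \<ge> N" for m
      proof -
        have "(\<Sum>i<m. d i *\<^sub>R x i) - v =
            (\<Sum>j<J. P m (w j) - w j) + (\<Sum>j. P m (w (j + J))) - r J"
          unfolding d_eq suminf_split_initial_segment[OF sumP, of m J] r_eq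
          by (simp add: sum_subtractf)
        also have "norm \<dots> \<le> norm (\<Sum>j<J. P m (w j) - w j) + norm (\<Sum>j. P m (w (j + J))) + norm (r J)"
          by (rule order_trans[OF norm_triangle_ineq4 add_right_mono[OF norm_triangle_ineq]])
        also have "\<dots> < e / 2 + e / 2"
          using N[OF that] tail[of m J] r_J J unfolding distrib_right by linarith
        finally show ?thesis by simp
      qed
      then show "\<exists>N. \<forall>m\<ge>N. norm ((\<Sum>i<m. d i *\<^sub>R x i) - v) < e" by blast
    qed
    from uniq[OF this] have "P n v = (\<Sum>i<n. d i *\<^sub>R x i)" by (simp add: P_def)
    also have "norm \<dots> \<le> 2 * K * norm v" unfolding d_eq using tail[of n 0] by (simp add: R_def)
    finally show ?thesis .
  qed
  show ?thesis
  proof (rule that)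
    fix n m :: nat and a :: "nat \<Rightarrow> real" assume "n \<le> m"
    define a' where "a' i = (if i < m then a i else 0)" for i :: nat
    have "(\<lambda>i. a' i *\<^sub>R x i) sums (\<Sum>i<m. a' i *\<^sub>R x i)"
      by (rule sums_finite) (auto simp: a'_def)
    from uniq[OF this, symmetric] have "P n (\<Sum>i<m. a' i *\<^sub>R x i) = (\<Sum>i<n. a' i *\<^sub>R x i)" by (simp add: P_def)
    moreover have "(\<Sum>i<n. a' i *\<^sub>R x i) = (\<Sum>i<n. a i *\<^sub>R x i)"
      using \<open>n \<le> m\<close> by (intro sum.cong) (simp_all add: a'_def)
    moreover have "(\<Sum>i<m. a' i *\<^sub>R x i) = (\<Sum>i<m. a i *\<^sub>R x i)"
      by (intro sum.cong) (simp_all add: a'_def)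
    ultimately show "norm (\<Sum>i<n. a i *\<^sub>R x i) \<le> 2 * K * norm (\<Sum>i<m. a i *\<^sub>R x i)"
      using bound[of n "\<Sum>i<m. a' i *\<^sub>R x i"] by simp
  qed
qed


section \<open>Gluing sequences along consecutive blocks of indices\<close>

lemma strict_mono_block_unique:
  fixes N :: "nat \<Rightarrow> nat"
  assumes "strict_mono N" "N k \<le> p" "p < N (Suc k)" "N l \<le> p" "p < N (Suc l)"
  shows "k = l"
proof (rule ccontr)
  assume "k \<noteq> l"
  then consider "Suc k \<le> l" | "Suc l \<le> k" by linarith
  then show False
    using assms strict_mono_less_eq[OF assms(1)] by cases (meson le_less_trans not_le order_trans)+
qed

lemma strict_mono_block_exists:
  fixes N :: "nat \<Rightarrow> nat"
  assumes "strict_mono N" "N 0 = 0"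
  obtains k where "N k \<le> p" "p < N (Suc k)"
proof -
  have "p < N (Suc p)" using strict_mono_imp_increasing[OF assms(1), of "Suc p"] by simp
  then have ex: "\<exists>k. p < N (Suc k)" by blast
  define k where "k = (LEAST k. p < N (Suc k))"
  have "p < N (Suc k)" unfolding k_def using ex by (rule LeastI_ex)
  moreover have "N k \<le> p"
  proof (cases k)
    case (Suc j)
    then show ?thesis using not_less_Least[of j "\<lambda>k. p < N (Suc k)"] by (simp add: k_def not_less)
  qed (simp add: assms)
  ultimately show ?thesis using that by blast
qed

lemma glue_blocks:
  fixes N :: "nat \<Rightarrow> nat"
  assumes "strict_mono N"
  obtains d where "\<And>k p. N k \<le> p \<Longrightarrow> p < N (Suc k) \<Longrightarrow> d p = f k p"
proof
  fix k p assume "N k \<le> p" "p < N (Suc k)"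
  moreover from this have "(THE k. N k \<le> p \<and> p < N (Suc k)) = k"
    using strict_mono_block_unique[OF assms] by (intro the_equality) auto
  ultimately show "(\<lambda>p. f (THE k. N k \<le> p \<and> p < N (Suc k)) p) p = f k p" by simp
qed

lemma norm_sum_blocks_le:
  fixes v :: "nat \<Rightarrow> 'a::real_normed_vector"
  assumes N: "strict_mono N"
    and part: "\<And>k j. N k \<le> j \<Longrightarrow> j \<le> N (Suc k) \<Longrightarrow> norm (\<Sum>i=N k..<j. v i) \<le> u k"
    and j: "j \<le> N (k + d)"
  shows "norm (\<Sum>i=N k..<j. v i) \<le> (\<Sum>l=k..<k + d. u l)"
  using j
proof (induction d arbitrary: j)
  case (Suc d)
  have u0: "0 \<le> u l" for l using part[of l "N l"] strict_mono_less_eq[OF N] by simp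
  show ?case
  proof (cases "j \<le> N (k + d)")
    case True
    with Suc.IH[of j] u0[of "k + d"] show ?thesis by simp
  next
    case False
    have le: "N k \<le> N (k + d)" using strict_mono_less_eq[OF N] by simp
    have "(\<Sum>i=N k..<j. v i) = (\<Sum>i=N k..<N (k + d). v i) + (\<Sum>i=N (k + d)..<j. v i)"
      using le False by (intro sum.atLeastLessThan_concat[symmetric]) auto
    also have "norm \<dots> \<le> (\<Sum>l=k..<k + d. u l) + u (k + d)"
      using False Suc.prems by (intro norm_triangle_mono Suc.IH part) auto
    finally show ?thesis by simp
  qed
qed simp

text \<open>If the partial sums inside the blocks are dominated by a summable sequence, then no
oscillation inside a block can spoil convergence. This is the convergence half of every gliding
hump argument below.\<close>

lemma summable_blocks:
  fixes v :: "nat \<Rightarrow> 'a::banach"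
  assumes N: "strict_mono N"
    and part: "\<And>k j. N k \<le> j \<Longrightarrow> j \<le> N (Suc k) \<Longrightarrow> norm (\<Sum>i=N k..<j. v i) \<le> u k"
    and u: "summable u"
  shows "summable v"
  unfolding summable_Cauchy
proof (intro allI impI)
  fix e :: real assume "0 < e"
  then obtain k where k: "\<And>n. norm (sum u {k..<n}) < e / 2"
    using u unfolding summable_Cauchy by (meson half_gt_zero order_refl)
  have le: "norm (\<Sum>i=N k..<j. v i) < e / 2" for j
  proof -
    have "j \<le> N (k + j)" using strict_mono_imp_increasing[OF N, of "k + j"] by simp
    from norm_sum_blocks_le[OF N part this] k[of "k + j"] show ?thesis by auto
  qed
  have "norm (sum v {m..<n}) < e" if "N k \<le> m" for m n
  proof (cases "m \<le> n")
    case True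
    have "sum v {m..<n} = sum v {N k..<n} - sum v {N k..<m}"
      using sum.atLeastLessThan_concat[OF that True, of v] by (simp add: algebra_simps)
    also have "norm \<dots> < e / 2 + e / 2"
      by (intro le_less_trans[OF norm_triangle_ineq4] add_strict_mono le)
    finally show ?thesis by simp
  qed (use \<open>0 < e\<close> in simp)
  then show "\<exists>M. \<forall>m\<ge>M. \<forall>n. norm (sum v {m..<n}) < e" by blast
qed

section \<open>Subsymmetric bases are uniformly subsymmetric\<close>

lemma subsequence_choice:
  assumes "\<And>n N. \<exists>i::nat. i \<ge> N \<and> Q n i"
  obtains r :: "nat \<Rightarrow> nat" where "strict_mono r" "\<And>n. Q n (r n)"
proof -
  have "\<exists>r. \<forall>n. Q n (r n) \<and> r n < r (Suc n)"
  proof (rule dependent_nat_choice)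
    show "\<exists>i. Q 0 i" using assms by blast
    show "\<exists>j. Q (Suc n) j \<and> i < j" for i n using assms[of "Suc i" "Suc n"] by (auto simp: Suc_le_eq)
  qed
  then obtain r where "\<forall>n. Q n (r n) \<and> r n < r (Suc n)" by blast
  with that[of r] show ?thesis by (auto simp: strict_mono_Suc_iff)
qed

text \<open>If the norms were unbounded, coefficients that make the series converge absolutely on the sequence
would give terms of norm at least one on a fast growing subsequence; if the norms had no
positive lower bound, a subsequence with fast decreasing norms exchanges the roles.\<close>

lemma subsequence_equivalent_imp_norms_comparable:
  fixes x :: "nat \<Rightarrow> 'a::banach"
  assumes nz: "\<And>n. x n \<noteq> 0"
    and eq: "\<And>r. strict_mono r \<Longrightarrow> equivalent_seq x (x \<circ> r)"
  obtains R where "0 \<le> R" "\<And>i j. norm (x i) \<le> R * norm (x j)"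
proof -
  have half: "summable (\<lambda>n. (1/2::real) ^ n)" by (intro summable_geometric) simp
  have "\<exists>U. \<forall>i. norm (x i) \<le> U"
  proof (rule ccontr)
    assume unbounded: "\<not> ?thesis"
    have "\<exists>i\<ge>N. norm (x i) \<ge> 2 ^ n * (1 + norm (x n))" for n N
    proof (rule ccontr)
      assume *: "\<not> ?thesis"
      have "norm (x i) \<le> (\<Sum>j<N. norm (x j)) + 2 ^ n * (1 + norm (x n))" for i
      proof (cases "i < N")
        case True
        then have "norm (x i) \<le> (\<Sum>j<N. norm (x j))" by (intro member_le_sum) auto
        then show ?thesis by (rule order_trans) simp
      next
        case False
        have "0 \<le> (\<Sum>j<N. norm (x j))" by (intro sum_nonneg) simp
        moreover have "norm (x i) < 2 ^ n * (1 + norm (x n))"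
          using False * by (meson not_less)
        ultimately show ?thesis by linarith
      qed
      with unbounded show False by blast
    qed
    then obtain r where r: "strict_mono r" "\<And>n. norm (x (r n)) \<ge> 2 ^ n * (1 + norm (x n))"
      using subsequence_choice[of "\<lambda>n i. norm (x i) \<ge> 2 ^ n * (1 + norm (x n))"] by blast
    define a where "a i = (1/2) ^ i / (1 + norm (x i))" for i
    have pos: "0 < 1 + norm (x i)" for i using norm_ge_zero[of "x i"] by linarith
    have "summable (\<lambda>i. a i *\<^sub>R x i)"
    proof (rule summable_comparison_test'[OF half])
      show "norm (a i *\<^sub>R x i) \<le> (1/2) ^ i" for i
        using pos[of i] by (simp add: a_def divide_le_eq mult_left_le)
    qed
    then have "summable (\<lambda>i. a i *\<^sub>R x (r i))"
      using eq[OF r(1)] by (simp add: equivalent_seq_def o_def)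
    then have "(\<lambda>i. a i *\<^sub>R x (r i)) \<longlonglongrightarrow> 0" by (rule summable_LIMSEQ_zero)
    then obtain i where i: "norm (a i *\<^sub>R x (r i)) < 1" using LIMSEQ_D[of _ 0 1] by force
    have "(1/2::real) ^ i * 2 ^ i = 1" by (simp flip: power_mult_distrib)
    then have "1 = (1/2) ^ i / (1 + norm (x i)) * (2 ^ i * (1 + norm (x i)))"
      using pos[of i] by (metis less_irrefl nonzero_eq_divide_eq mult.assoc mult.commute)
    also have "\<dots> \<le> (1/2) ^ i / (1 + norm (x i)) * norm (x (r i))"
      using r(2)[of i] pos[of i] by (intro mult_left_mono) auto
    also have "\<dots> = norm (a i *\<^sub>R x (r i))" using pos[of i] by (simp add: a_def)
    finally show False using i by simp
  qed
  then obtain U where U: "\<And>i. norm (x i) \<le> U" by blast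
  have "\<exists>l>0. \<forall>i. norm (x i) \<ge> l"
  proof (rule ccontr)
    assume small: "\<not> ?thesis"
    have "\<exists>i\<ge>N. norm (x i) \<le> (1/2) ^ n * norm (x n)" for n N
    proof (rule ccontr)
      assume *: "\<not> ?thesis"
      define l where "l = Min (insert ((1/2) ^ n * norm (x n)) ((\<lambda>i. norm (x i)) ` {..<N}))"
      have "0 < l" using nz by (auto simp: l_def)
      moreover have "norm (x i) \<ge> l" for i
      proof (cases "i < N")
        case True
        then show ?thesis unfolding l_def by (intro Min_le) auto
      next
        case False
        have "l \<le> (1/2) ^ n * norm (x n)" unfolding l_def by (intro Min_le) auto
        also have "\<dots> \<le> norm (x i)" using False * by (meson linear not_less)
        finally show ?thesis .
      qed
      ultimately show False using small by blast
    qed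
    then obtain r where r: "strict_mono r" "\<And>n. norm (x (r n)) \<le> (1/2) ^ n * norm (x n)"
      using subsequence_choice[of "\<lambda>n i. norm (x i) \<le> (1/2) ^ n * norm (x n)"] by blast
    have "summable (\<lambda>i. (1 / norm (x i)) *\<^sub>R x (r i))"
    proof (rule summable_comparison_test'[OF half])
      show "norm ((1 / norm (x i)) *\<^sub>R x (r i)) \<le> (1/2) ^ i" for i
        using r(2)[of i] nz[of i] by (simp add: divide_le_eq)
    qed
    then have "summable (\<lambda>i. (1 / norm (x i)) *\<^sub>R x i)"
      using eq[OF r(1)] by (simp add: equivalent_seq_def o_def)
    then have "(\<lambda>i. (1 / norm (x i)) *\<^sub>R x i) \<longlonglongrightarrow> 0" by (rule summable_LIMSEQ_zero)
    then obtain i where "norm ((1 / norm (x i)) *\<^sub>R x i) < 1" using LIMSEQ_D[of _ 0 1] by force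
    then show False using nz[of i] by simp
  qed
  then obtain l where l: "0 < l" "\<And>i. norm (x i) \<ge> l" by blast
  show ?thesis
  proof (rule that)
    have "0 \<le> U" using U[of 0] norm_ge_zero[of "x 0"] by linarith
    then show "0 \<le> U / l" using l by simp
    show "norm (x i) \<le> U / l * norm (x j)" for i j
    proof -
      have "norm (x i) \<le> U / l * l" using U[of i] l by simp
      also have "\<dots> \<le> U / l * norm (x j)" using l \<open>0 \<le> U / l\<close> by (intro mult_left_mono) auto
      finally show ?thesis .
    qed
  qed
qed

text \<open>Otherwise there are finite sets of indices, lying in consecutive intervals, whose sums stay away
from zero. A permutation that moves each of them to the front of its interval produces a divergent
rearrangement.\<close>

lemma rearrangements_summable_imp_small_tail_sums:
  fixes v :: "nat \<Rightarrow> 'a::banach"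
  assumes conv: "\<And>\<pi>. bij \<pi> \<Longrightarrow> summable (\<lambda>n. v (\<pi> n))" and e: "0 < e"
  shows "\<exists>m. \<forall>F. finite F \<longrightarrow> F \<subseteq> {m..} \<longrightarrow> norm (sum v F) < e"
proof (rule ccontr)
  assume "\<not> ?thesis"
  then have big: "\<exists>F. finite F \<and> F \<subseteq> {m..} \<and> norm (sum v F) \<ge> e" for m by (meson not_le)
  define Q where "Q n w \<longleftrightarrow> finite (snd w) \<and> snd w \<subseteq> {fst w..} \<and> norm (sum v (snd w)) \<ge> e \<and> (n = 0 \<longrightarrow> fst w = 0)"
    for n :: nat and w :: "nat \<times> nat set"
  have "\<exists>w. \<forall>n. Q n (w n) \<and> (fst (w n) < fst (w (Suc n)) \<and> snd (w n) \<subseteq> {..<fst (w (Suc n))})"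
  proof (rule dependent_nat_choice)
    show "\<exists>w. Q 0 w" using big[of 0] by (auto simp: Q_def)
    fix w n assume "Q n w"
    then obtain m where m: "snd w \<subseteq> {..<m}" unfolding Q_def by (meson finite_nat_bounded)
    obtain F where "finite F \<and> F \<subseteq> {max m (Suc (fst w))..} \<and> norm (sum v F) \<ge> e" using big by blast
    then show "\<exists>w'. Q (Suc n) w' \<and> fst w < fst w' \<and> snd w \<subseteq> {..<fst w'}"
      using m by (intro exI[of _ "(max m (Suc (fst w)), F)"]) (auto simp: Q_def)
  qed
  then obtain w where w: "\<And>n. Q n (w n)" "\<And>n. fst (w n) < fst (w (Suc n))"
      "\<And>n. snd (w n) \<subseteq> {..<fst (w (Suc n))}" by blast
  define N where "N n = fst (w n)" for n
  define F where "F n = snd (w n)" for n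
  have N: "strict_mono N" using w(2) by (simp add: strict_mono_Suc_iff N_def)
  have N0: "N 0 = 0" using w(1)[of 0] by (simp add: Q_def N_def)
  have F: "F n \<subseteq> {N n..<N (Suc n)}" "finite (F n)" "norm (sum v (F n)) \<ge> e" for n
    using w(1)[of n] w(3)[of n] by (force simp: Q_def N_def F_def)+
  have "\<exists>h. bij_betw h {N n..<N (Suc n)} {N n..<N (Suc n)} \<and> h ` {N n..<N n + card (F n)} = F n" for n
  proof -
    let ?I = "{N n..<N (Suc n)}" and ?G = "{N n..<N n + card (F n)}"
    have card_le: "card (F n) \<le> card ?I" using F by (intro card_mono) auto
    have G: "?G \<subseteq> ?I"
      using card_le N by (auto simp: strict_mono_less_eq)
    obtain g where g: "bij_betw g ?G (F n)"
      using F(2)[of n] by (metis bij_betw_iff_card card_atLeastLessThan diff_add_inverse finite_atLeastLessThan)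
    have "card (?I - ?G) = card (?I - F n)"
      using F(1,2)[of n] G by (simp add: card_Diff_subset)
    then obtain h where h: "bij_betw h (?I - ?G) (?I - F n)"
      by (metis bij_betw_iff_card finite_Diff finite_atLeastLessThan)
    define k where "k i = (if i \<in> ?G then g i else h i)" for i
    have "bij_betw k ?G (F n)" using g by (rule bij_betw_cong[THEN iffD1, rotated]) (simp add: k_def)
    moreover have "bij_betw k (?I - ?G) (?I - F n)"
      using h by (rule bij_betw_cong[THEN iffD1, rotated]) (simp add: k_def)
    ultimately have "bij_betw k (?G \<union> (?I - ?G)) (F n \<union> (?I - F n))"
      by (intro bij_betw_combine) auto
    moreover have "?G \<union> (?I - ?G) = ?I" "F n \<union> (?I - F n) = ?I" using G F(1)[of n] by auto
    ultimately show ?thesis using \<open>bij_betw k ?G (F n)\<close> by (auto simp: bij_betw_def)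
  qed
  then obtain h where h: "\<And>n. bij_betw (h n) {N n..<N (Suc n)} {N n..<N (Suc n)}"
      "\<And>n. h n ` {N n..<N n + card (F n)} = F n" by metis
  obtain \<pi> where \<pi>: "\<And>k p. N k \<le> p \<Longrightarrow> p < N (Suc k) \<Longrightarrow> \<pi> p = h k p"
    using glue_blocks[OF N] by blast
  have cover: "(\<Union>n. {N n..<N (Suc n)}) = UNIV"
  proof (intro equalityI subsetI UNIV_I)
    fix p :: nat
    obtain k where "N k \<le> p" "p < N (Suc k)" using strict_mono_block_exists[OF N N0] .
    then show "p \<in> (\<Union>n. {N n..<N (Suc n)})" by auto
  qed
  have "bij_betw \<pi> (\<Union>n. {N n..<N (Suc n)}) (\<Union>n. {N n..<N (Suc n)})"
  proof (rule bij_betw_UNION_disjoint)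
    show "disjoint_family (\<lambda>n. {N n..<N (Suc n)})"
      unfolding disjoint_family_on_def disjoint_iff atLeastLessThan_iff
      using strict_mono_block_unique[OF N] by blast
    show "bij_betw \<pi> {N n..<N (Suc n)} {N n..<N (Suc n)}" for n
      using h(1)[of n] by (rule bij_betw_cong[THEN iffD1, rotated]) (simp add: \<pi>[of n])
  qed
  then have "summable (\<lambda>n. v (\<pi> n))" unfolding cover by (rule conv)
  then obtain m where m: "\<And>k n. k \<ge> m \<Longrightarrow> norm (\<Sum>i=k..<n. v (\<pi> i)) < e"
    using e unfolding summable_Cauchy by meson
  have "card (F m) \<le> card {N m..<N (Suc m)}" using F by (intro card_mono) auto
  then have le: "N m + card (F m) \<le> N (Suc m)"
    using N strict_mono_less_eq[OF N, of m "Suc m"] by simp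
  have "(\<Sum>i=N m..<N m + card (F m). v (\<pi> i)) = (\<Sum>i=N m..<N m + card (F m). v (h m i))"
    using le by (intro sum.cong) (auto simp: \<pi>[of m])
  also have "\<dots> = sum v (h m ` {N m..<N m + card (F m)})"
    using h(1)[of m] le by (subst sum.reindex) (auto simp: bij_betw_def intro: inj_on_subset)
  also have "\<dots> = sum v (F m)" by (simp add: h)
  finally show False
    using m[of "N m" "N m + card (F m)"] F(3)[of m] strict_mono_imp_increasing[OF N, of m] by simp
qed

text \<open>A point of a cube is a convex combination of the vertices, one coordinate at a time; the offset
$u$ carries the coordinates that are already fixed.\<close>

lemma norm_sum_unit_multipliers_le:
  fixes v :: "'i \<Rightarrow> 'a::real_normed_vector"
  assumes "finite F" "\<And>i. i \<in> F \<Longrightarrow> 0 \<le> t i \<and> t i \<le> 1"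
    and "\<And>G. G \<subseteq> F \<Longrightarrow> norm (u + sum v G) \<le> s"
  shows "norm (u + (\<Sum>i\<in>F. t i *\<^sub>R v i)) \<le> s"
  using assms
proof (induction F arbitrary: u rule: finite_induct)
  case empty
  then show ?case using empty(2)[of "{}"] by simp
next
  case (insert j F)
  define w where "w = u + (\<Sum>i\<in>F. t i *\<^sub>R v i)"
  have "norm w \<le> s" unfolding w_def using insert.prems by (intro insert.IH) auto
  moreover have "norm (w + v j) \<le> s"
  proof -
    have "norm ((u + v j) + (\<Sum>i\<in>F. t i *\<^sub>R v i)) \<le> s"
    proof (rule insert.IH)
      fix G assume "G \<subseteq> F"
      then have "finite G" "j \<notin> G" using insert.hyps finite_subset by auto
      then show "norm (u + v j + sum v G) \<le> s"
        using insert.prems(2)[of "insert j G"] \<open>G \<subseteq> F\<close> by (auto simp: add.assoc)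
    qed (use insert.prems in auto)
    then show ?thesis by (simp add: w_def algebra_simps)
  qed
  moreover have t: "0 \<le> t j" "t j \<le> 1" using insert.prems(1)[of j] by auto
  ultimately have "norm ((1 - t j) *\<^sub>R w + t j *\<^sub>R (w + v j)) \<le> (1 - t j) * s + t j * s"
    by (intro order_trans[OF norm_triangle_ineq] add_mono) (auto intro: mult_left_mono)
  also have "(1 - t j) *\<^sub>R w + t j *\<^sub>R (w + v j) = u + (\<Sum>i\<in>insert j F. t i *\<^sub>R v i)"
    using insert.hyps by (simp add: w_def algebra_simps)
  finally show ?case by (simp add: algebra_simps)
qed

text \<open>The quotients of the coefficients are multipliers in $[-1,1]$; positive and negative parts
are multipliers in $[0,1]$, for which subset sums are the worst case.\<close>

lemma unconditional_dominated_summable: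
  fixes x :: "nat \<Rightarrow> 'a::banach"
  assumes unc: "unconditional x" and b: "summable (\<lambda>n. b n *\<^sub>R x n)"
    and ab: "\<And>n. \<bar>a n\<bar> \<le> \<bar>b n\<bar>"
  shows "summable (\<lambda>n. a n *\<^sub>R x n)"
  unfolding summable_Cauchy
proof (intro allI impI)
  fix e :: real assume e: "0 < e"
  define v where "v n = b n *\<^sub>R x n" for n
  have conv: "summable (\<lambda>n. v (\<pi> n))" if "bij \<pi>" for \<pi>
    using unc b that unfolding unconditional_def v_def by blast
  obtain m where m: "\<And>F. finite F \<Longrightarrow> F \<subseteq> {m..} \<Longrightarrow> norm (sum v F) < e / 3"
    using rearrangements_summable_imp_small_tail_sums[OF conv, of "\<lambda>\<pi>. \<pi>" "e / 3"] e by auto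
  define t where "t n = (if b n = 0 then 0 else a n / b n)" for n
  have t: "\<bar>t n\<bar> \<le> 1" "a n *\<^sub>R x n = t n *\<^sub>R v n" for n
    using ab[of n] by (auto simp: t_def v_def divide_le_eq_1)
  have "norm (\<Sum>i=k..<n. a i *\<^sub>R x i) < e" if "k \<ge> m" for k n
  proof -
    have le: "norm (\<Sum>i=k..<n. s i *\<^sub>R v i) \<le> e / 3" if "\<And>i. 0 \<le> s i \<and> s i \<le> 1" for s
    proof -
      have "norm (0 + (\<Sum>i=k..<n. s i *\<^sub>R v i)) \<le> e / 3"
      proof (rule norm_sum_unit_multipliers_le)
        fix G assume "G \<subseteq> {k..<n}"
        then have "finite G" "G \<subseteq> {m..}" using \<open>k \<ge> m\<close> finite_subset by auto
        from m[OF this] show "norm (0 + sum v G) \<le> e / 3" by simp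
      qed (use that in auto)
      then show ?thesis by simp
    qed
    have "a i *\<^sub>R x i = max (t i) 0 *\<^sub>R v i - max (- t i) 0 *\<^sub>R v i" for i
      unfolding t scaleR_diff_left[symmetric] by (simp add: max_def)
    then have "norm (\<Sum>i=k..<n. a i *\<^sub>R x i) =
        norm ((\<Sum>i=k..<n. max (t i) 0 *\<^sub>R v i) - (\<Sum>i=k..<n. max (- t i) 0 *\<^sub>R v i))"
      by (simp add: sum_subtractf)
    also have "\<dots> \<le> e / 3 + e / 3"
      by (intro order_trans[OF norm_triangle_ineq4] add_mono le) (use t(1) in \<open>auto simp: abs_le_iff\<close>)
    also have "\<dots> < e" using e by simp
    finally show ?thesis .
  qed
  then show "\<exists>N. \<forall>m\<ge>N. \<forall>n. norm (\<Sum>i=m..<n. a i *\<^sub>R x i) < e" by blast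
qed


lemma glue_strict_mono:
  fixes N T d :: "nat \<Rightarrow> nat"
  assumes N: "strict_mono N" "N 0 = 0"
    and d: "\<And>k p. N k \<le> p \<Longrightarrow> p < N (Suc k) \<Longrightarrow> d p = g k (p - N k)"
    and g: "\<And>k. strict_mono_on {..<N (Suc k) - N k} (g k)"
    and sep: "\<And>k i. i < N (Suc k) - N k \<Longrightarrow> T k \<le> g k i \<and> g k i < T (Suc k)"
  shows "strict_mono d"
  unfolding strict_mono_Suc_iff
proof
  fix p
  obtain k where k: "N k \<le> p" "p < N (Suc k)" using strict_mono_block_exists[OF N] .
  show "d p < d (Suc p)"
  proof (cases "Suc p < N (Suc k)")
    case True
    with k show ?thesis
      by (auto simp: d[of k] intro!: strict_mono_onD[OF g[of k]])
  next
    case False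
    with k have p: "Suc p = N (Suc k)" by simp
    have lt: "N (Suc k) < N (Suc (Suc k))" using N(1) by (simp add: strict_mono_less)
    have "d p < T (Suc k)" using sep[of "p - N k" k] k d by auto
    also have "T (Suc k) \<le> d (Suc p)" using sep[of 0 "Suc k"] lt p d[of "Suc k" "Suc p"] by simp
    finally show ?thesis .
  qed
qed

lemma basis_constant_subsequence:
  fixes x :: "nat \<Rightarrow> 'a::real_normed_vector" and b :: "nat \<Rightarrow> real"
  assumes M: "\<And>(n::nat) m (a :: nat \<Rightarrow> real). n \<le> m \<Longrightarrow>
      norm (\<Sum>i<n. a i *\<^sub>R x i) \<le> M * norm (\<Sum>i<m. a i *\<^sub>R x i)"
    and s: "strict_mono_on {..<n} s" and j: "j \<le> n"
  shows "norm (\<Sum>i<j. b i *\<^sub>R x (s i)) \<le> M * norm (\<Sum>i<n. b i *\<^sub>R x (s i))"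
proof -
  obtain m where m: "s ` {..<n} \<subseteq> {..<m}" by (meson finite_imageI finite_lessThan finite_nat_bounded)
  define q where "q = (if j < n then s j else m)"
  have inj: "inj_on s {..<n}" using s by (rule strict_mono_on_imp_inj_on)
  define k where "k = the_inv_into {..<n} s"
  have k: "k (s i) = i" if "i < n" for i
    using inj that by (simp add: k_def the_inv_into_f_f)
  define b' where "b' p = (if p \<in> s ` {..<n} then b (k p) else 0)" for p
  have eq: "(\<Sum>p<l. b' p *\<^sub>R x p) = (\<Sum>i<i0. b i *\<^sub>R x (s i))"
    if "i0 \<le> n" "s ` {..<i0} \<subseteq> {..<l}" "\<And>i. i0 \<le> i \<Longrightarrow> i < n \<Longrightarrow> l \<le> s i" for i0 l
  proof -
    have "(\<Sum>p<l. b' p *\<^sub>R x p) = (\<Sum>p\<in>s ` {..<i0}. b' p *\<^sub>R x p)"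
    proof (rule sum.mono_neutral_right)
      show "\<forall>p\<in>{..<l} - s ` {..<i0}. b' p *\<^sub>R x p = 0"
      proof
        fix p assume p: "p \<in> {..<l} - s ` {..<i0}"
        have "p \<notin> s ` {..<n}"
        proof
          assume "p \<in> s ` {..<n}"
          then obtain i where "p = s i" "i < n" by auto
          with p that(3)[of i] show False by (cases "i < i0") auto
        qed
        then show "b' p *\<^sub>R x p = 0" by (simp add: b'_def)
      qed
    qed (use that in auto)
    also have "\<dots> = (\<Sum>i<i0. b' (s i) *\<^sub>R x (s i))"
      using inj_on_subset[OF inj, of "{..<i0}"] that(1) by (subst sum.reindex) auto
    also have "\<dots> = (\<Sum>i<i0. b i *\<^sub>R x (s i))"
      using that(1) by (intro sum.cong) (auto simp: b'_def k)
    finally show ?thesis .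
  qed
  have q: "s ` {..<j} \<subseteq> {..<q}" "\<And>i. j \<le> i \<Longrightarrow> i < n \<Longrightarrow> q \<le> s i" "q \<le> m"
  proof -
    show "s ` {..<j} \<subseteq> {..<q}"
      using m j strict_mono_onD[OF s] by (auto simp: q_def)
    show "q \<le> s i" if "j \<le> i" "i < n" for i
      using that strict_mono_onD[OF s, of j i] by (cases "i = j") (auto simp: q_def)
    show "q \<le> m" using m by (auto simp: q_def)
  qed
  have "norm (\<Sum>p<q. b' p *\<^sub>R x p) \<le> M * norm (\<Sum>p<m. b' p *\<^sub>R x p)" by (rule M[OF q(3)])
  then show ?thesis using eq[of j q] eq[of n m] q m j by simp
qed


text \<open>A gliding hump. If no constant works, then failures exist arbitrarily far out, since the first few
terms of a failure are controlled by the basis constant and by the comparability of the norms.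
Consecutive failures, with constants growing geometrically, are glued into two coefficient
sequences and two subsequences: one glued series converges and the other diverges, although
subsymmetry and unconditionality transfer convergence from the first to the second.\<close>

lemma subsymmetric_basis_imp_unif_subsym:
  fixes x :: "nat \<Rightarrow> 'a::banach"
  assumes basis: "schauder_basis_of UNIV x" and sub: "subsymmetric x"
  obtains C where "uniformly_subsymmetric C x"
proof -
  have nz: "x n \<noteq> 0" for n by (rule schauder_basis_imp_nonzero[OF basis])
  have unc: "unconditional x" and eqv: "\<And>r. strict_mono r \<Longrightarrow> equivalent_seq x (x \<circ> r)"
    using sub by (simp_all add: subsymmetric_def)
  obtain M where M: "\<And>(n::nat) m (a :: nat \<Rightarrow> real). n \<le> m \<Longrightarrow>
      norm (\<Sum>i<n. a i *\<^sub>R x i) \<le> M * norm (\<Sum>i<m. a i *\<^sub>R x i)"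
    using basis_constant_exists[OF basis] by blast
  have "0 < norm (x 0)" using nz by simp
  also have "norm (x 0) \<le> M * norm (x 0)" using M[of 1 1 "\<lambda>_. 1"] by simp
  finally have M0: "0 < M" by (simp add: zero_less_mult_iff)
  note partial = basis_constant_subsequence[of x, OF M]
  obtain R where R: "0 \<le> R" "\<And>i j. norm (x i) \<le> R * norm (x j)"
    using subsequence_equivalent_imp_norms_comparable[OF nz eqv] by blast
  show ?thesis
  proof (rule ccontr)
    assume "\<not> thesis"
    then have not_unif_subsym: "\<not> uniformly_subsymmetric C x" for C using that by blast
    have bad: "\<exists>n (a :: nat \<Rightarrow> real) b r s. strict_mono_on {..<n} r \<and> strict_mono_on {..<n} s \<and>
        (\<forall>i<n. \<bar>a i\<bar> \<le> \<bar>b i\<bar>) \<and>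
        C * norm (\<Sum>i<n. b i *\<^sub>R x (s i)) < norm (\<Sum>i<n. a i *\<^sub>R x (r i))" if C: "1 \<le> C" for C
    proof -
      obtain F and a b :: "nat \<Rightarrow> real" and r s :: "nat \<Rightarrow> nat" where F: "finite F"
        "strict_mono_on F r" "strict_mono_on F s" "\<forall>i\<in>F. \<bar>a i\<bar> \<le> \<bar>b i\<bar>"
        "C * norm (\<Sum>i\<in>F. b i *\<^sub>R x (s i)) < norm (\<Sum>i\<in>F. a i *\<^sub>R x (r i))"
        using not_unif_subsym[of C] C nz[of 0] unfolding uniformly_subsymmetric_def by (meson not_le)
      obtain h where h: "bij_betw h {..<card F} F" "strict_mono_on {..<card F} h"
        using ex_bij_betw_strict_mono_card[OF F(1)] by blast
      have hF: "h i \<in> F" if "i < card F" for i using h(1) that by (auto simp: bij_betw_def)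
      show ?thesis
      proof (intro exI conjI)
        show "strict_mono_on {..<card F} (\<lambda>i. r (h i))" "strict_mono_on {..<card F} (\<lambda>i. s (h i))"
          using F(2,3) h(2) hF by (simp_all add: strict_mono_on_def)
        show "\<forall>i<card F. \<bar>a (h i)\<bar> \<le> \<bar>b (h i)\<bar>" using F(4) hF by auto
        show "C * norm (\<Sum>i<card F. b (h i) *\<^sub>R x (s (h i))) < norm (\<Sum>i<card F. a (h i) *\<^sub>R x (r (h i)))"
          using F(5) sum.reindex_bij_betw[OF h(1), of "\<lambda>i. b i *\<^sub>R x (s i)"]
            sum.reindex_bij_betw[OF h(1), of "\<lambda>i. a i *\<^sub>R x (r i)"] by simp
      qed
    qed
    define hump where "hump T K n a b r s \<longleftrightarrow> strict_mono_on {..<n} r \<and> strict_mono_on {..<n} s \<and>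
        (\<forall>i<n. T \<le> r i \<and> T \<le> s i) \<and> (\<forall>i<n. \<bar>a i\<bar> \<le> \<bar>b i\<bar>) \<and>
        norm (\<Sum>i<n. b i *\<^sub>R x (s i)) \<le> (1/2) ^ K \<and> 1 \<le> norm (\<Sum>i<n. a i *\<^sub>R x (r i))"
      for T K n :: nat and a b :: "nat \<Rightarrow> real" and r s
    have tail: "\<exists>n a b r s. hump T K n a b r s"
      for T K :: nat
    proof -
      \<comment> \<open>The middle summand pays for the at most \<open>T\<close> terms that are cut off, the last one leaves the gain
        \<open>2 ^ K\<close> on the remaining tail.\<close>
      define C where "C = 1 + real T * (R * (2 * M)) + 2 ^ K * (1 + M)"
      have "1 \<le> C" using R(1) M0 by (simp add: C_def)
      from bad[OF this] obtain n and a b :: "nat \<Rightarrow> real" and r s where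
        r: "strict_mono_on {..<n} r" and s: "strict_mono_on {..<n} s" and
        ab: "\<And>i. i < n \<Longrightarrow> \<bar>a i\<bar> \<le> \<bar>b i\<bar>" and
        big: "C * norm (\<Sum>i<n. b i *\<^sub>R x (s i)) < norm (\<Sum>i<n. a i *\<^sub>R x (r i))" by blast
      define \<nu> where "\<nu> = norm (\<Sum>i<n. b i *\<^sub>R x (s i))"
      have coeff: "\<bar>b i\<bar> * norm (x (s i)) \<le> 2 * M * \<nu>" if "i < n" for i
      proof -
        have "b i *\<^sub>R x (s i) = (\<Sum>i<Suc i. b i *\<^sub>R x (s i)) - (\<Sum>i<i. b i *\<^sub>R x (s i))" by simp
        also have "norm \<dots> \<le> M * \<nu> + M * \<nu>" unfolding \<nu>_def
          using that by (intro order_trans[OF norm_triangle_ineq4] add_mono partial[OF _ s]) auto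
        finally show ?thesis by simp
      qed
      define t where "t = min T n"
      have split: "(\<Sum>i<n. f i) = (\<Sum>i<t. f i) + (\<Sum>i<n - t. f (i + t))" for f :: "nat \<Rightarrow> 'a"
      proof -
        have "(\<Sum>i<n. f i) = (\<Sum>i<t. f i) + (\<Sum>i=t..<n. f i)"
          using sum.atLeastLessThan_concat[of 0 t n f] by (simp add: t_def atLeast0LessThan)
        also have "(\<Sum>i=t..<n. f i) = (\<Sum>i<n - t. f (i + t))"
          using sum.shift_bounds_nat_ivl[of f 0 t "n - t"] by (simp add: t_def atLeast0LessThan)
        finally show ?thesis .
      qed
      define A where "A = norm (\<Sum>i<n - t. a (i + t) *\<^sub>R x (r (i + t)))"
      have "norm (\<Sum>i<t. a i *\<^sub>R x (r i)) \<le> real (card {..<t}) * (R * (2 * M * \<nu>))"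
      proof (rule sum_norm_bound)
        fix i assume "i \<in> {..<t}"
        then have i: "i < n" by (simp add: t_def)
        have "norm (a i *\<^sub>R x (r i)) \<le> \<bar>b i\<bar> * (R * norm (x (s i)))"
          using ab[OF i] R by (simp add: mult_mono)
        also have "\<dots> = R * (\<bar>b i\<bar> * norm (x (s i)))" by simp
        also have "\<dots> \<le> R * (2 * M * \<nu>)" using coeff[OF i] R by (intro mult_left_mono)
        finally show "norm (a i *\<^sub>R x (r i)) \<le> R * (2 * M * \<nu>)" .
      qed
      also have "\<dots> \<le> real T * (R * (2 * M * \<nu>))"
        using R M0 by (intro mult_right_mono) (auto simp: t_def \<nu>_def)
      finally have "C * \<nu> - real T * (R * (2 * M * \<nu>)) < A"
        using big norm_triangle_ineq[of "\<Sum>i<t. a i *\<^sub>R x (r i)" "\<Sum>i<n - t. a (i + t) *\<^sub>R x (r (i + t))"]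
        unfolding A_def \<nu>_def[symmetric] split[of "\<lambda>i. a i *\<^sub>R x (r i)"] by linarith
      then have A: "\<nu> + 2 ^ K * ((1 + M) * \<nu>) < A" by (simp add: C_def algebra_simps)
      have "0 \<le> \<nu> + 2 ^ K * ((1 + M) * \<nu>)" using M0 by (simp add: \<nu>_def)
      with A have A0: "0 < A" by linarith
      have btail: "norm (\<Sum>i<n - t. b (i + t) *\<^sub>R x (s (i + t))) \<le> (1 + M) * \<nu>"
      proof -
        have "(\<Sum>i<n - t. b (i + t) *\<^sub>R x (s (i + t))) = (\<Sum>i<n. b i *\<^sub>R x (s i)) - (\<Sum>i<t. b i *\<^sub>R x (s i))"
          using split[of "\<lambda>i. b i *\<^sub>R x (s i)"] by simp
        also have "norm \<dots> \<le> \<nu> + M * \<nu>" unfolding \<nu>_def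
          by (intro order_trans[OF norm_triangle_ineq4] add_mono partial[OF _ s]) (auto simp: t_def)
        finally show ?thesis by (simp add: distrib_right)
      qed
      have ge: "i \<le> f i" if "strict_mono_on {..<n} f" "i < n" for f :: "nat \<Rightarrow> nat" and i
        using that(2)
      proof (induction i)
        case (Suc i)
        then have "f i < f (Suc i)" by (intro strict_mono_onD[OF that(1)]) auto
        with Suc show ?case by simp
      qed simp
      have geT: "T \<le> f (i + t)" if "strict_mono_on {..<n} f" "i < n - t" for f :: "nat \<Rightarrow> nat" and i
      proof -
        have "i + t < n" "t = T" using that(2) by (auto simp: t_def min_def split: if_splits)
        with ge[OF that(1), of "i + t"] show ?thesis by simp
      qed
      have mono: "strict_mono_on {..<n - t} (\<lambda>i. f (i + t))" if "strict_mono_on {..<n} f" for f :: "nat \<Rightarrow> nat"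
        by (intro strict_mono_onI strict_mono_onD[OF that]) auto
      show ?thesis
        unfolding hump_def
      proof (intro exI conjI)
        show "strict_mono_on {..<n - t} (\<lambda>i. r (i + t))" "strict_mono_on {..<n - t} (\<lambda>i. s (i + t))"
          using mono r s by auto
        show "\<forall>i<n - t. T \<le> r (i + t) \<and> T \<le> s (i + t)" using geT r s by auto
        show "\<forall>i<n - t. \<bar>a (i + t) / A\<bar> \<le> \<bar>b (i + t) / A\<bar>"
          using ab A0 by (auto intro!: divide_right_mono)
        have "(\<Sum>i<n - t. (b (i + t) / A) *\<^sub>R x (s (i + t))) = (1 / A) *\<^sub>R (\<Sum>i<n - t. b (i + t) *\<^sub>R x (s (i + t)))"
          by (simp add: scaleR_sum_right)
        then have "norm (\<Sum>i<n - t. (b (i + t) / A) *\<^sub>R x (s (i + t)))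
            = norm (\<Sum>i<n - t. b (i + t) *\<^sub>R x (s (i + t))) / A" using A0 by simp
        also have "\<dots> \<le> ((1 + M) * \<nu>) / A" using btail A0 by (intro divide_right_mono) auto
        also have "\<dots> \<le> (1/2) ^ K"
        proof -
          have "0 \<le> \<nu>" by (simp add: \<nu>_def)
          with A have "2 ^ K * ((1 + M) * \<nu>) \<le> A" by linarith
          then show ?thesis using A0 by (simp add: power_one_over field_simps)
        qed
        finally show "norm (\<Sum>i<n - t. (b (i + t) / A) *\<^sub>R x (s (i + t))) \<le> (1/2) ^ K" .
        have "(\<Sum>i<n - t. (a (i + t) / A) *\<^sub>R x (r (i + t))) = (1 / A) *\<^sub>R (\<Sum>i<n - t. a (i + t) *\<^sub>R x (r (i + t)))"
          by (simp add: scaleR_sum_right)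
        then show "1 \<le> norm (\<Sum>i<n - t. (a (i + t) / A) *\<^sub>R x (r (i + t)))" using A0 by (simp add: A_def)
      qed
    qed
    then obtain nf af bf rf sf where
      "\<And>T K. hump T K (nf T K) (af T K) (bf T K) (rf T K) (sf T K)" by metis
    then have f: "\<And>T K. strict_mono_on {..<nf T K} (rf T K)" "\<And>T K. strict_mono_on {..<nf T K} (sf T K)"
      "\<And>T K i. i < nf T K \<Longrightarrow> T \<le> rf T K i \<and> T \<le> sf T K i"
      "\<And>T K i. i < nf T K \<Longrightarrow> \<bar>af T K i\<bar> \<le> \<bar>bf T K i\<bar>"
      "\<And>T K. norm (\<Sum>i<nf T K. bf T K i *\<^sub>R x (sf T K i)) \<le> (1/2) ^ K"
      "\<And>T K. 1 \<le> norm (\<Sum>i<nf T K. af T K i *\<^sub>R x (rf T K i))"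
      unfolding hump_def by blast+
    \<comment> \<open>Each failure starts beyond all positions that the previous one uses.\<close>
    define T where "T = rec_nat 0 (\<lambda>k T. Suc (\<Sum>i<nf T k. rf T k i + sf T k i))"
    define n where "n k = nf (T k) k" for k
    define a where "a k = af (T k) k" for k
    define b where "b k = bf (T k) k" for k
    define r where "r k = rf (T k) k" for k
    define s where "s k = sf (T k) k" for k
    have T_Suc: "T (Suc k) = Suc (\<Sum>i<n k. r k i + s k i)" for k
      by (simp add: T_def n_def r_def s_def)
    have lt: "r k i < T (Suc k)" "s k i < T (Suc k)" if "i < n k" for k i
    proof -
      have "r k i + s k i \<le> (\<Sum>i<n k. r k i + s k i)" using that by (intro member_le_sum) auto
      then show "r k i < T (Suc k)" "s k i < T (Suc k)" by (simp_all add: T_Suc)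
    qed
    have n_pos: "0 < n k" for k
      using f(6)[of "T k" k] by (cases "n k") (auto simp: n_def)
    define N where "N k = (\<Sum>j<k. n j)" for k
    have N: "strict_mono N" and N0: "N 0 = 0" and N_Suc: "N (Suc k) - N k = n k" for k
      using n_pos by (simp_all add: N_def strict_mono_Suc_iff)
    obtain a' where a': "\<And>k p. N k \<le> p \<Longrightarrow> p < N (Suc k) \<Longrightarrow> a' p = a k (p - N k)"
      using glue_blocks[OF N, where f = "\<lambda>k p. a k (p - N k)"] by blast
    obtain b' where b': "\<And>k p. N k \<le> p \<Longrightarrow> p < N (Suc k) \<Longrightarrow> b' p = b k (p - N k)"
      using glue_blocks[OF N, where f = "\<lambda>k p. b k (p - N k)"] by blast
    obtain r' where r': "\<And>k p. N k \<le> p \<Longrightarrow> p < N (Suc k) \<Longrightarrow> r' p = r k (p - N k)"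
      using glue_blocks[OF N, where f = "\<lambda>k p. r k (p - N k)"] by blast
    obtain s' where s': "\<And>k p. N k \<le> p \<Longrightarrow> p < N (Suc k) \<Longrightarrow> s' p = s k (p - N k)"
      using glue_blocks[OF N, where f = "\<lambda>k p. s k (p - N k)"] by blast
    have r'_mono: "strict_mono r'"
      by (rule glue_strict_mono[where N = N and T = T and g = r])
        (use N N0 r' f(1,3) lt in \<open>auto simp: N_Suc n_def r_def\<close>)
    have s'_mono: "strict_mono s'"
      by (rule glue_strict_mono[where N = N and T = T and g = s])
        (use N N0 s' f(2,3) lt in \<open>auto simp: N_Suc n_def s_def\<close>)
    have ab': "\<bar>a' p\<bar> \<le> \<bar>b' p\<bar>" for p
    proof -
      obtain k where k: "N k \<le> p" "p < N (Suc k)" using strict_mono_block_exists[OF N N0] .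
      then have "p - N k < n k" using N_Suc[of k] by linarith
      then show ?thesis using f(4)[of "p - N k" "T k" k] k by (simp add: a' b' a_def b_def n_def)
    qed
    have block: "(\<Sum>p=N k..<j. c' p *\<^sub>R x (q' p)) = (\<Sum>i<j - N k. c i *\<^sub>R x (q i))"
      if "\<And>p. N k \<le> p \<Longrightarrow> p < N (Suc k) \<Longrightarrow> c' p = c (p - N k)"
        "\<And>p. N k \<le> p \<Longrightarrow> p < N (Suc k) \<Longrightarrow> q' p = q (p - N k)" "N k \<le> j" "j \<le> N (Suc k)"
      for k j c q and c' :: "nat \<Rightarrow> real" and q'
    proof -
      have "(\<Sum>p=N k..<j. c' p *\<^sub>R x (q' p)) = (\<Sum>p=0+N k..<(j - N k) + N k. c (p - N k) *\<^sub>R x (q (p - N k)))"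
        using that by (intro sum.cong) auto
      also have "\<dots> = (\<Sum>i<j - N k. c i *\<^sub>R x (q i))"
        by (subst sum.shift_bounds_nat_ivl) (simp add: atLeast0LessThan)
      finally show ?thesis .
    qed
    have "summable (\<lambda>p. b' p *\<^sub>R x (s' p))"
    proof (rule summable_blocks[OF N])
      fix k j assume j: "N k \<le> j" "j \<le> N (Suc k)"
      have "(\<Sum>p=N k..<j. b' p *\<^sub>R x (s' p)) = (\<Sum>i<j - N k. b k i *\<^sub>R x (s k i))"
        using b' s' j by (intro block) auto
      also have "norm \<dots> \<le> M * norm (\<Sum>i<n k. b k i *\<^sub>R x (s k i))"
        using f(2)[of "T k" k] j N_Suc[of k] by (intro partial) (auto simp: n_def s_def)
      also have "\<dots> \<le> M * (1/2) ^ k"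
        using f(5)[of "T k" k] M0 by (intro mult_left_mono) (auto simp: n_def b_def s_def)
      finally show "norm (\<Sum>p=N k..<j. b' p *\<^sub>R x (s' p)) \<le> M * (1/2) ^ k" .
    qed (intro summable_mult summable_geometric, simp)
    then have "summable (\<lambda>p. b' p *\<^sub>R x p)" using eqv[OF s'_mono] by (simp add: equivalent_seq_def)
    then have "summable (\<lambda>p. a' p *\<^sub>R x p)" by (rule unconditional_dominated_summable[OF unc]) (rule ab')
    then have "summable (\<lambda>p. a' p *\<^sub>R x (r' p))" using eqv[OF r'_mono] by (simp add: equivalent_seq_def)
    then obtain k where k: "\<And>m n. m \<ge> k \<Longrightarrow> norm (\<Sum>p=m..<n. a' p *\<^sub>R x (r' p)) < 1"
      unfolding summable_Cauchy by (meson zero_less_one)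
    have "(\<Sum>p=N k..<N (Suc k). a' p *\<^sub>R x (r' p)) = (\<Sum>i<N (Suc k) - N k. a k i *\<^sub>R x (r k i))"
      using a' r' strict_mono_less_eq[OF N, of k "Suc k"] by (intro block) auto
    with f(6)[of "T k" k] k[of "N k" "N (Suc k)"] strict_mono_imp_increasing[OF N, of k]
    show False unfolding N_Suc by (simp add: a_def r_def n_def)
  qed
qed

section \<open>Biorthogonal functionals\<close>

lemma biorthogonal_eq_coefficient:
  assumes bi: "biorthogonal x f" and a: "(\<lambda>n. a n *\<^sub>R x n) sums v"
  shows "blinfun_apply (f i) v = a i"
proof -
  have "(\<lambda>n. blinfun_apply (f i) (a n *\<^sub>R x n)) sums blinfun_apply (f i) v"
    by (rule bounded_linear.sums[OF blinfun.bounded_linear_right a])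
  also have "(\<lambda>n. blinfun_apply (f i) (a n *\<^sub>R x n)) = (\<lambda>n. if n = i then a n else 0)"
    using bi by (auto simp: biorthogonal_def blinfun.scaleR_right)
  finally show ?thesis using sums_single[of i a] sums_unique2 by blast
qed

text \<open>Evaluating the left-hand combination of functionals at a vector $v$ equals evaluating the
right-hand one at the vector $u$ obtained from the expansion of $v$ by moving coordinates from
$r(i)$ to $s(i)$ and multiplying them by the quotients $a_i/b_i$, which have modulus at most one;
and $u$ is dominated by $v$.\<close>

lemma biorthogonal_unif_subsym:
  fixes x :: "nat \<Rightarrow> 'a::real_normed_vector" and f :: "nat \<Rightarrow> 'a \<Rightarrow>\<^sub>L real"
  assumes basis: "schauder_basis_of UNIV x" and U: "uniformly_subsymmetric C x"
    and bi: "biorthogonal x f"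
  shows "uniformly_subsymmetric (C\<^sup>2) f"
  unfolding uniformly_subsymmetric_def
proof (intro conjI allI impI)
  show "1 \<le> C\<^sup>2" using unif_subsym_ge_1[OF U] by simp
  have "blinfun_apply (f 0) (x 0) = 1" using bi by (simp add: biorthogonal_def)
  then show "f 0 \<noteq> 0" by auto
next
  fix F and a b :: "nat \<Rightarrow> real" and r s :: "nat \<Rightarrow> nat"
  assume F: "finite F" and r: "strict_mono_on F r" and s: "strict_mono_on F s"
    and ab: "\<forall>i\<in>F. \<bar>a i\<bar> \<le> \<bar>b i\<bar>"
  define g where "g = (\<Sum>i\<in>F. b i *\<^sub>R f (s i))"
  have inj: "inj_on r F" "inj_on s F" using r s by (auto intro: strict_mono_on_imp_inj_on)
  show "norm (\<Sum>i\<in>F. a i *\<^sub>R f (r i)) \<le> C\<^sup>2 * norm (\<Sum>i\<in>F. b i *\<^sub>R f (s i))"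
    unfolding g_def[symmetric]
  proof (rule norm_blinfun_bound)
    show "0 \<le> C\<^sup>2 * norm g" using unif_subsym_ge_1[OF U] by simp
    fix v
    obtain d where d: "(\<lambda>n. d n *\<^sub>R x n) sums v"
      using basis unfolding schauder_basis_of_def by (meson UNIV_I ex1_implies_ex)
    define t where "t i = (if b i = 0 then 0 else a i / b i)" for i
    have t: "\<bar>t i\<bar> \<le> 1" "b i * t i = a i" if "i \<in> F" for i
      using ab that by (auto simp: t_def divide_le_eq_1)
    define u where "u = (\<Sum>i\<in>F. (t i * d (r i)) *\<^sub>R x (s i))"
    have fu: "blinfun_apply (f (s i)) u = t i * d (r i)" if "i \<in> F" for i
    proof -
      have "blinfun_apply (f (s i)) u = (\<Sum>j\<in>F. if j = i then t j * d (r j) else 0)"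
        unfolding u_def blinfun.sum_right blinfun.scaleR_right
        using bi inj(2) that by (intro sum.cong) (auto simp: biorthogonal_def inj_on_eq_iff)
      then show ?thesis using F that by simp
    qed
    have "blinfun_apply (\<Sum>i\<in>F. a i *\<^sub>R f (r i)) v = (\<Sum>i\<in>F. a i * d (r i))"
      by (simp add: blinfun.sum_left blinfun.scaleR_left biorthogonal_eq_coefficient[OF bi d])
    also have "\<dots> = (\<Sum>i\<in>F. b i * (t i * d (r i)))"
      using t by (intro sum.cong) (simp_all flip: mult.assoc)
    also have "\<dots> = blinfun_apply g u"
      by (simp add: g_def blinfun.sum_left blinfun.scaleR_left fu)
    also have "norm \<dots> \<le> norm g * norm u" by (rule norm_blinfun)
    also have "\<dots> \<le> norm g * (C\<^sup>2 * norm v)"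
    proof (intro mult_left_mono)
      have "norm u \<le> C * norm (\<Sum>i\<in>F. d (r i) *\<^sub>R x (r i))"
        unfolding u_def
      proof (rule unif_subsym_dominated[OF U F inj(1)])
        fix i j assume "i \<in> F" "j \<in> F" "r i < r j"
        then show "s i < s j"
          by (metis linorder_neqE_nat not_less_iff_gr_or_eq r s strict_mono_onD)
      next
        fix i assume "i \<in> F"
        with t(1) show "\<bar>t i * d (r i)\<bar> \<le> \<bar>d (r i)\<bar>" by (simp add: abs_mult mult_left_le_one_le)
      qed
      also have "(\<Sum>i\<in>F. d (r i) *\<^sub>R x (r i)) = (\<Sum>k\<in>r ` F. d k *\<^sub>R x k)"
        using inj(1) by (simp add: sum.reindex)
      also have "C * norm \<dots> \<le> C * (C * norm v)"
      proof (intro mult_left_mono)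
        obtain m where m: "r ` F \<subseteq> {..<m}" using F by (meson finite_imageI finite_nat_bounded)
        show "norm (\<Sum>k\<in>r ` F. d k *\<^sub>R x k) \<le> C * norm v"
        proof (rule tendsto_lowerbound)
          show "(\<lambda>n. C * norm (\<Sum>k<n. d k *\<^sub>R x k)) \<longlonglongrightarrow> C * norm v"
            using d unfolding sums_def by (intro tendsto_intros)
          show "\<forall>\<^sub>F n in sequentially. norm (\<Sum>k\<in>r ` F. d k *\<^sub>R x k) \<le> C * norm (\<Sum>k<n. d k *\<^sub>R x k)"
            using eventually_ge_at_top[of m]
          proof eventually_elim
            case (elim n)
            then show ?case using m by (intro unif_subsym_restrict[OF U]) auto
          qed
        qed simp
      qed (use unif_subsym_ge_1[OF U] in simp)
      finally show "norm u \<le> C\<^sup>2 * norm v" by (simp add: power2_eq_square mult_ac)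
    qed simp
    finally show "norm (blinfun_apply (\<Sum>i\<in>F. a i *\<^sub>R f (r i)) v) \<le> C\<^sup>2 * norm g * norm v"
      by (simp add: mult_ac)
  qed
qed

text \<open>A gliding hump again, now with invariance under spreading: coefficient vectors that
violate domination can be placed on consecutive blocks of indices without changing the norms by
more than a constant.\<close>

lemma summable_transfer_imp_dominated:
  fixes y :: "nat \<Rightarrow> 'a::banach" and z :: "nat \<Rightarrow> 'b::banach"
  assumes y: "uniformly_subsymmetric C y" and z: "uniformly_subsymmetric D z"
    and transfer: "\<And>a :: nat \<Rightarrow> real. summable (\<lambda>i. a i *\<^sub>R z i) \<Longrightarrow> summable (\<lambda>i. a i *\<^sub>R y i)"
  shows "\<exists>K. \<forall>n (a :: nat \<Rightarrow> real). norm (\<Sum>i<n. a i *\<^sub>R y i) \<le> K * norm (\<Sum>i<n. a i *\<^sub>R z i)"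
proof (rule ccontr)
  assume neg: "\<not> ?thesis"
  have "\<exists>n a. norm (\<Sum>i<n. a i *\<^sub>R y i) = 1 \<and> norm (\<Sum>i<n. a i *\<^sub>R z i) \<le> (1/2) ^ k"
    for k :: nat
  proof -
    obtain n and a :: "nat \<Rightarrow> real" where
      big: "2 ^ k * norm (\<Sum>i<n. a i *\<^sub>R z i) < norm (\<Sum>i<n. a i *\<^sub>R y i)"
      using neg by (meson not_le)
    define A where "A = norm (\<Sum>i<n. a i *\<^sub>R y i)"
    have "0 \<le> 2 ^ k * norm (\<Sum>i<n. a i *\<^sub>R z i)" by simp
    with big have A: "0 < A" unfolding A_def by linarith
    have scale: "(\<Sum>i<n. (a i / A) *\<^sub>R w i) = (1 / A) *\<^sub>R (\<Sum>i<n. a i *\<^sub>R w i)"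
      for w :: "nat \<Rightarrow> 'c::real_vector"
      by (simp add: scaleR_sum_right)
    have "norm (\<Sum>i<n. (a i / A) *\<^sub>R y i) = 1" using A unfolding scale by (simp add: A_def)
    moreover have "norm (\<Sum>i<n. (a i / A) *\<^sub>R z i) \<le> (1/2) ^ k"
      using A big unfolding scale A_def[symmetric] by (simp add: power_one_over field_simps)
    ultimately show ?thesis by (intro exI conjI)
  qed
  then obtain n a where a: "\<And>k. norm (\<Sum>i<n k. a k i *\<^sub>R y i) = 1"
      "\<And>k. norm (\<Sum>i<n k. a k i *\<^sub>R z i) \<le> (1/2) ^ k" by metis
  have n: "0 < n k" for k using a(1)[of k] by (cases "n k") auto
  define N where "N k = (\<Sum>j<k. n j)" for k
  have N: "strict_mono N" and N0: "N 0 = 0" and N_Suc: "N (Suc k) = N k + n k" for k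
    using n by (simp_all add: N_def strict_mono_Suc_iff)
  \<comment> \<open>All the violating coefficient vectors, one after the other.\<close>
  obtain d where d: "\<And>k p. N k \<le> p \<Longrightarrow> p < N (Suc k) \<Longrightarrow> d p = a k (p - N k)"
    using glue_blocks[OF N, where f = "\<lambda>k p. a k (p - N k)"] by blast
  have block: "(\<Sum>p=N k..<j. d p *\<^sub>R w p) = (\<Sum>i<j - N k. a k i *\<^sub>R w (N k + i))"
    if "N k \<le> j" "j \<le> N (Suc k)" for k j and w :: "nat \<Rightarrow> 'c::real_vector"
  proof -
    have "(\<Sum>p=N k..<j. d p *\<^sub>R w p) = (\<Sum>p=0+N k..<(j - N k) + N k. a k (p - N k) *\<^sub>R w p)"
      using that d by (intro sum.cong) auto
    also have "\<dots> = (\<Sum>i<j - N k. a k i *\<^sub>R w (N k + i))"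
      by (subst sum.shift_bounds_nat_ivl) (simp add: atLeast0LessThan add.commute)
    finally show ?thesis .
  qed
  have "summable (\<lambda>p. d p *\<^sub>R z p)"
  proof (rule summable_blocks[OF N])
    fix k j assume j: "N k \<le> j" "j \<le> N (Suc k)"
    have "norm (\<Sum>p=N k..<j. d p *\<^sub>R z p) = norm (\<Sum>i<j - N k. a k i *\<^sub>R z (N k + i))"
      unfolding block[OF j] ..
    also have "\<dots> \<le> D\<^sup>2 * norm (\<Sum>i<n k. a k i *\<^sub>R z i)"
      using j N_Suc[of k] by (intro unif_subsym_dominated_restrict[OF z]) auto
    also have "\<dots> \<le> D\<^sup>2 * (1/2) ^ k" by (intro mult_left_mono a) simp
    finally show "norm (\<Sum>p=N k..<j. d p *\<^sub>R z p) \<le> D\<^sup>2 * (1/2) ^ k" .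
  qed (intro summable_mult summable_geometric, simp)
  then have "summable (\<lambda>p. d p *\<^sub>R y p)" by (rule transfer)
  moreover have "0 < 1 / C" using unif_subsym_ge_1[OF y] by simp
  ultimately obtain k where k: "\<And>m n. m \<ge> k \<Longrightarrow> norm (\<Sum>p=m..<n. d p *\<^sub>R y p) < 1 / C"
    unfolding summable_Cauchy by meson
  have "1 = norm (\<Sum>i<n k. a k i *\<^sub>R y i)" by (simp add: a)
  also have "\<dots> \<le> C * norm (\<Sum>i<n k. a k i *\<^sub>R y (N k + i))"
    by (intro unif_subsym_dominated[OF y]) auto
  also have "(\<Sum>i<n k. a k i *\<^sub>R y (N k + i)) = (\<Sum>p=N k..<N (Suc k). d p *\<^sub>R y p)"
    using block[of k "N (Suc k)" y] by (simp add: N_Suc)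
  also have "C * norm \<dots> < C * (1 / C)"
    using k[of "N k"] strict_mono_imp_increasing[OF N, of k] unif_subsym_ge_1[OF y]
    by (intro mult_strict_left_mono) auto
  finally show False using unif_subsym_ge_1[OF y] by simp
qed

section \<open>Block bases generated by a vector\<close>

definition block_start :: "(nat \<Rightarrow> nat) \<Rightarrow> nat \<Rightarrow> nat" where
  "block_start L n = (\<Sum>j<n. L j)"

text \<open>Meant for the coefficients $c$ of a convergent series and increasing $L$: longer and longer initial
pieces of one and the same vector. Infinitely many disjoint full copies of the vector would not be
a block basis; truncation changes them by summable errors only.\<close>

definition generated_blocks ::
    "(nat \<Rightarrow> real) \<Rightarrow> (nat \<Rightarrow> nat) \<Rightarrow> (nat \<Rightarrow> 'a::real_normed_vector) \<Rightarrow> nat \<Rightarrow> 'a" where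
  "generated_blocks c L x n = (\<Sum>i<L n. c i *\<^sub>R x (block_start L n + i))"

lemma block_start_less:
  assumes "n < n'" "i < L n"
  shows "block_start L n + i < block_start L n' + i'"
proof -
  have "block_start L n + i < block_start L (Suc n)" using assms(2) by (simp add: block_start_def)
  also have "\<dots> \<le> block_start L n'"
    unfolding block_start_def using assms(1) by (intro sum_mono2) auto
  finally show ?thesis by simp
qed

lemma block_start_inj:
  assumes "i < L n" "i' < L n'" "block_start L n + i = block_start L n' + i'"
  shows "n = n' \<and> i = i'"
  using assms block_start_less[of n n' i L i'] block_start_less[of n' n i' L i]
  by (cases n n' rule: linorder_cases) auto

lemma generated_blocks_ge:
  assumes U: "uniformly_subsymmetric C x" and L: "0 < L n"
  shows "\<bar>c 0\<bar> * norm (x 0) \<le> C\<^sup>2 * norm (generated_blocks c L x n)"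
  unfolding generated_blocks_def
  by (rule unif_subsym_coeff_le[OF U, of "{..<L n}" _ 0]) (use L in \<open>auto simp: inj_on_def\<close>)

lemma generated_blocks_block_basis:
  assumes U: "uniformly_subsymmetric C x" and L: "\<And>n. 0 < L n" and c: "c 0 \<noteq> 0"
  shows "block_basis x (generated_blocks c L x)"
proof -
  define p where "p = block_start L"
  have p_Suc: "p (Suc n) = p n + L n" for n by (simp add: p_def block_start_def)
  have p: "strict_mono p" using L by (simp add: strict_mono_Suc_iff p_Suc)
  obtain a where a: "\<And>n k. p n \<le> k \<Longrightarrow> k < p (Suc n) \<Longrightarrow> a k = c (k - p n)"
    using glue_blocks[OF p, where f = "\<lambda>n k. c (k - p n)"] by blast
  have "generated_blocks c L x n \<noteq> 0" for n
  proof
    assume "generated_blocks c L x n = 0"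
    with generated_blocks_ge[where L = L and n = n and c = c, OF U L] have "\<bar>c 0\<bar> * norm (x 0) \<le> 0" by simp
    with c unif_subsym_nonzero[OF U, of 0] show False by (simp add: mult_le_0_iff)
  qed
  moreover have "generated_blocks c L x n = (\<Sum>k\<in>{p n..<p (Suc n)}. a k *\<^sub>R x k)" for n
  proof -
    have "(\<Sum>k\<in>{p n..<p (Suc n)}. a k *\<^sub>R x k) = (\<Sum>k=0+p n..<L n + p n. c (k - p n) *\<^sub>R x k)"
      using a[of n] by (intro sum.cong) (auto simp: p_Suc)
    also have "\<dots> = generated_blocks c L x n"
      by (subst sum.shift_bounds_nat_ivl)
        (simp add: atLeast0LessThan generated_blocks_def p_def add.commute)
    finally show ?thesis ..
  qed
  ultimately show ?thesis unfolding block_basis_def using p by blast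
qed

lemma sum_half_powers_le:
  assumes "finite F" "inj_on s F"
  shows "(\<Sum>j\<in>F. (1/2::real) ^ s j) \<le> 2"
proof -
  have "(\<Sum>j\<in>F. (1/2::real) ^ s j) = (\<Sum>k\<in>s ` F. (1/2) ^ k)" using assms by (simp add: sum.reindex)
  also have "\<dots> \<le> (\<Sum>k. (1/2) ^ k)" using assms by (intro sum_le_suminf summable_geometric) auto
  also have "\<dots> = 2" using suminf_geometric[of "1/2::real"] by simp
  finally show ?thesis .
qed

text \<open>Two blocks agree up to translation on the shorter of their lengths, where domination is inherited
from $x$. The excess of a longer block is a tail of the generating vector and hence of norm
$O(2^{-n})$ for the $n$-th length; these errors are summable, and the coefficients in front of
them are controlled because $c_0 \<noteq> 0$.\<close>

lemma generated_blocks_unif_subsym: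
  fixes x :: "nat \<Rightarrow> 'a::real_normed_vector"
  assumes U: "uniformly_subsymmetric C x" and L: "\<And>n. 0 < L n" and c: "c 0 \<noteq> 0"
    and tail: "\<And>n m. norm (\<Sum>i=L n..<m. c i *\<^sub>R x i) \<le> K * (1/2) ^ n"
  shows "\<exists>D. uniformly_subsymmetric D (generated_blocks c L x)"
proof (intro exI)
  let ?y = "generated_blocks c L x" and ?p = "block_start L"
  have C: "1 \<le> C" by (rule unif_subsym_ge_1[OF U])
  define \<gamma> where "\<gamma> = \<bar>c 0\<bar> * norm (x 0)"
  have \<gamma>: "0 < \<gamma>" using c unif_subsym_nonzero[OF U] by (simp add: \<gamma>_def)
  have "0 \<le> norm (\<Sum>i=L 0..<0. c i *\<^sub>R x i)" by simp
  also have "\<dots> \<le> K" using tail[of 0 0] by simp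
  finally have K: "0 \<le> K" .
  define D where "D = C\<^sup>2 + C\<^sup>2 / \<gamma> * (C * K) * 2"
  show "uniformly_subsymmetric D ?y"
    unfolding uniformly_subsymmetric_def
  proof (intro conjI allI impI)
    have "1 \<le> C\<^sup>2" using C by simp
    also have "\<dots> \<le> D" using C K \<gamma> by (simp add: D_def)
    finally show "1 \<le> D" .
    show "?y 0 \<noteq> 0"
      using generated_blocks_block_basis[where L = L and c = c, OF U L c] by (auto simp: block_basis_def)
  next
    fix F and a b :: "nat \<Rightarrow> real" and r s :: "nat \<Rightarrow> nat"
    assume F: "finite F" and r: "strict_mono_on F r" and s: "strict_mono_on F s"
      and ab: "\<forall>i\<in>F. \<bar>a i\<bar> \<le> \<bar>b i\<bar>"
    define R where "R = norm (\<Sum>j\<in>F. b j *\<^sub>R ?y (s j))"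
    define G where "G = Sigma F (\<lambda>j. {..<L (s j)})"
    define h where "h = (\<lambda>(j, i). ?p (s j) + i)"
    have injs: "inj_on s F" using s by (rule strict_mono_on_imp_inj_on)
    have inj: "inj_on h G"
    proof (rule inj_onI)
      fix u v assume uv: "u \<in> G" "v \<in> G" "h u = h v"
      obtain j i j' i' where [simp]: "u = (j, i)" "v = (j', i')" by (cases u, cases v)
      have "s j = s j'" "i = i'"
        using block_start_inj[of i L "s j" i' "s j'"] uv by (auto simp: G_def h_def)
      moreover have "j = j'" using uv \<open>s j = s j'\<close> injs by (auto simp: G_def inj_on_def)
      ultimately show "u = v" by simp
    qed
    have R_eq: "R = norm (\<Sum>t\<in>G. (b (fst t) * c (snd t)) *\<^sub>R x (h t))"
      unfolding R_def G_def generated_blocks_def scaleR_sum_right h_def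
      using F by (subst sum.Sigma) (auto simp: case_prod_beta)
    have finG: "finite G" using F by (simp add: G_def)
    have b_le: "\<bar>b j\<bar> \<le> C\<^sup>2 / \<gamma> * R" if "j \<in> F" for j
    proof -
      have "\<bar>b j * c 0\<bar> * norm (x 0) \<le> C\<^sup>2 * R"
        unfolding R_eq using unif_subsym_coeff_le[OF U finG inj, of "(j, 0)" "\<lambda>t. b (fst t) * c (snd t)"] that L
        by (simp add: G_def)
      then show ?thesis using \<gamma> by (simp add: \<gamma>_def abs_mult field_simps)
    qed
    define k where "k j = min (L (s j)) (L (r j))" for j
    have common: "norm (\<Sum>j\<in>F. a j *\<^sub>R (\<Sum>i<k j. c i *\<^sub>R x (?p (r j) + i))) \<le> C\<^sup>2 * R"
    proof -
      have "(\<Sum>j\<in>F. a j *\<^sub>R (\<Sum>i<k j. c i *\<^sub>R x (?p (r j) + i))) =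
          (\<Sum>t\<in>Sigma F (\<lambda>j. {..<k j}). (a (fst t) * c (snd t)) *\<^sub>R x (?p (r (fst t)) + snd t))"
        unfolding scaleR_sum_right using F by (subst sum.Sigma) (auto simp: case_prod_beta)
      also have "norm \<dots> \<le> C\<^sup>2 * R"
        unfolding R_eq
      proof (rule unif_subsym_dominated_restrict[OF U finG _ inj])
        show "Sigma F (\<lambda>j. {..<k j}) \<subseteq> G" by (auto simp: G_def k_def)
        fix u v assume uv: "u \<in> Sigma F (\<lambda>j. {..<k j})" "v \<in> Sigma F (\<lambda>j. {..<k j})" "h u < h v"
        obtain j i j' i' where [simp]: "u = (j, i)" "v = (j', i')" by (cases u, cases v)
        have *: "j \<in> F" "j' \<in> F" "i < L (s j)" "i' < L (s j')" "i < L (r j)"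
          using uv by (auto simp: k_def)
        show "?p (r (fst u)) + snd u < ?p (r (fst v)) + snd v"
        proof (cases j j' rule: linorder_cases)
          case less
          then have "r j < r j'" using * strict_mono_onD[OF r] by blast
          with * show ?thesis by (simp add: block_start_less)
        next
          case equal
          with uv show ?thesis by (simp add: h_def)
        next
          case greater
          then have "s j' < s j" using * strict_mono_onD[OF s] by blast
          with * have "h v < h u" by (simp add: block_start_less h_def)
          with uv show ?thesis by simp
        qed
      next
        fix t assume "t \<in> Sigma F (\<lambda>j. {..<k j})"
        then show "\<bar>a (fst t) * c (snd t)\<bar> \<le> \<bar>b (fst t) * c (snd t)\<bar>"
          using ab by (auto simp: abs_mult intro!: mult_right_mono)
      qed
      finally show ?thesis .
    qed
    define rest where "rest j = (\<Sum>i=L (s j)..<L (r j). c i *\<^sub>R x (?p (r j) + i))" for j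
    have rest: "norm (rest j) \<le> C * (K * (1/2) ^ s j)" for j
    proof -
      have "norm (rest j) \<le> C * norm (\<Sum>i=L (s j)..<L (r j). c i *\<^sub>R x i)"
        unfolding rest_def by (intro unif_subsym_dominated[OF U]) auto
      also have "\<dots> \<le> C * (K * (1/2) ^ s j)" using C by (intro mult_left_mono tail) auto
      finally show ?thesis .
    qed
    have y_eq: "?y (r j) = (\<Sum>i<k j. c i *\<^sub>R x (?p (r j) + i)) + rest j" for j
    proof (cases "L (s j) \<le> L (r j)")
      case True
      then show ?thesis
        using sum.atLeastLessThan_concat[of 0 "L (s j)" "L (r j)" "\<lambda>i. c i *\<^sub>R x (?p (r j) + i)"]
        by (simp add: generated_blocks_def rest_def k_def min_def atLeast0LessThan)
    qed (simp add: generated_blocks_def rest_def k_def min_def)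
    have "norm (\<Sum>j\<in>F. a j *\<^sub>R rest j) \<le> (\<Sum>j\<in>F. C\<^sup>2 / \<gamma> * R * (C * (K * (1/2) ^ s j)))"
    proof (rule sum_norm_le)
      fix j assume j: "j \<in> F"
      have "\<bar>a j\<bar> \<le> C\<^sup>2 / \<gamma> * R" using ab j b_le[OF j] by force
      moreover have "0 \<le> C\<^sup>2 / \<gamma> * R" using \<gamma> by (simp add: R_def)
      ultimately show "norm (a j *\<^sub>R rest j) \<le> C\<^sup>2 / \<gamma> * R * (C * (K * (1/2) ^ s j))"
        unfolding norm_scaleR by (intro mult_mono rest) auto
    qed
    also have "\<dots> = C\<^sup>2 / \<gamma> * R * (C * K) * (\<Sum>j\<in>F. (1/2) ^ s j)"
      by (simp add: sum_distrib_left mult.assoc)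
    also have "\<dots> \<le> C\<^sup>2 / \<gamma> * R * (C * K) * 2"
      using C K \<gamma> by (intro mult_left_mono sum_half_powers_le F injs) (simp add: R_def)
    finally have rest_sum: "norm (\<Sum>j\<in>F. a j *\<^sub>R rest j) \<le> C\<^sup>2 / \<gamma> * R * (C * K) * 2" .
    have "norm (\<Sum>j\<in>F. a j *\<^sub>R ?y (r j)) \<le> C\<^sup>2 * R + C\<^sup>2 / \<gamma> * R * (C * K) * 2"
      unfolding y_eq scaleR_add_right sum.distrib by (rule norm_triangle_mono[OF common rest_sum])
    also have "\<dots> = D * R" by (simp add: D_def algebra_simps)
    finally show "norm (\<Sum>j\<in>F. a j *\<^sub>R ?y (r j)) \<le> D * norm (\<Sum>j\<in>F. b j *\<^sub>R ?y (s j))"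
      by (simp add: R_def)
  qed
qed

section \<open>Unbounded tensor products yield a continuum of block bases\<close>

text \<open>The finite vector with coefficients $b_j a_i$ in lexicographic order: $b$ applied to consecutive
copies of the vector with coefficients $a$.\<close>

definition tensor_sum :: "(nat \<Rightarrow> 'a::real_normed_vector) \<Rightarrow> nat \<Rightarrow> (nat \<Rightarrow> real) \<Rightarrow> nat \<Rightarrow> (nat \<Rightarrow> real) \<Rightarrow> 'a" where
  "tensor_sum x m b n a = (\<Sum>j<m. \<Sum>i<n. (b j * a i) *\<^sub>R x (j * n + i))"

definition tensor_bounded :: "(nat \<Rightarrow> 'a::real_normed_vector) \<Rightarrow> bool" where
  "tensor_bounded x \<longleftrightarrow> (\<exists>B. \<forall>m b n a.
     norm (tensor_sum x m b n a) \<le> B * (norm (\<Sum>j<m. b j *\<^sub>R x j) * norm (\<Sum>i<n. a i *\<^sub>R x i)))"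

lemma unif_subsym_sum_eq_0:
  assumes U: "uniformly_subsymmetric C x" and "(\<Sum>i<n. a i *\<^sub>R x i) = 0" and "i < n"
  shows "a i = 0"
  using unif_subsym_coeff_le[OF U, of "{..<n}" "\<lambda>i. i" i a] unif_subsym_nonzero[OF U, of 0] assms(2,3)
  by (simp add: mult_le_0_iff)

lemma not_tensor_bounded_normalized:
  assumes U: "uniformly_subsymmetric C x" and unbounded: "\<not> tensor_bounded x"
  shows "\<exists>m b n a. norm (\<Sum>j<m. b j *\<^sub>R x j) = 1 \<and> norm (\<Sum>i<n. a i *\<^sub>R x i) = 1 \<and>
           B < norm (tensor_sum x m b n a)"
proof -
  have "\<not> (\<forall>m b n a. norm (tensor_sum x m b n a) \<le>
      max B 0 * (norm (\<Sum>j<m. b j *\<^sub>R x j) * norm (\<Sum>i<n. a i *\<^sub>R x i)))"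
    using unbounded unfolding tensor_bounded_def by blast
  then obtain m b n a where big: "max B 0 * (norm (\<Sum>j<m. b j *\<^sub>R x j) * norm (\<Sum>i<n. a i *\<^sub>R x i))
      < norm (tensor_sum x m b n a)" by (auto simp: not_le)
  define \<beta> where "\<beta> = norm (\<Sum>j<m. b j *\<^sub>R x j)"
  define \<alpha> where "\<alpha> = norm (\<Sum>i<n. a i *\<^sub>R x i)"
  have "0 \<le> max B 0 * (norm (\<Sum>j<m. b j *\<^sub>R x j) * norm (\<Sum>i<n. a i *\<^sub>R x i))" by simp
  with big have "0 < norm (tensor_sum x m b n a)" by (rule le_less_trans[rotated])
  then have nz: "tensor_sum x m b n a \<noteq> 0" by simp
  have "\<beta> \<noteq> 0"
  proof
    assume "\<beta> = 0"
    then have "b j = 0" if "j < m" for j using unif_subsym_sum_eq_0[OF U _ that] by (simp add: \<beta>_def)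
    with nz show False by (simp add: tensor_sum_def)
  qed
  moreover have "\<alpha> \<noteq> 0"
  proof
    assume "\<alpha> = 0"
    then have "a i = 0" if "i < n" for i using unif_subsym_sum_eq_0[OF U _ that] by (simp add: \<alpha>_def)
    with nz show False by (simp add: tensor_sum_def)
  qed
  ultimately have pos: "0 < \<beta>" "0 < \<alpha>" by (simp_all add: \<alpha>_def \<beta>_def)
  have scale: "(\<Sum>i<k. (d i / t) *\<^sub>R x i) = (1 / t) *\<^sub>R (\<Sum>i<k. d i *\<^sub>R x i)" for k d t
    by (simp add: scaleR_sum_right)
  have tensor: "tensor_sum x m (\<lambda>j. b j / \<beta>) n (\<lambda>i. a i / \<alpha>) = (1 / (\<beta> * \<alpha>)) *\<^sub>R tensor_sum x m b n a"
    by (simp add: tensor_sum_def scaleR_sum_right)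
  show ?thesis
  proof (intro exI conjI)
    show "norm (\<Sum>j<m. (b j / \<beta>) *\<^sub>R x j) = 1" using pos unfolding scale by (simp add: \<beta>_def)
    show "norm (\<Sum>i<n. (a i / \<alpha>) *\<^sub>R x i) = 1" using pos unfolding scale by (simp add: \<alpha>_def)
    have "B * (\<beta> * \<alpha>) \<le> max B 0 * (\<beta> * \<alpha>)" using pos by (intro mult_right_mono) auto
    also have "\<dots> < norm (tensor_sum x m b n a)" using big by (simp add: \<beta>_def \<alpha>_def)
    finally show "B < norm (tensor_sum x m (\<lambda>j. b j / \<beta>) n (\<lambda>i. a i / \<alpha>))"
      using pos unfolding tensor by (simp add: field_simps)
  qed
qed

text \<open>The weights $c_l$ have to be small compared with the earlier $\<beta>_k$, and the tensor products
large compared with $1/c_l$ and the earlier $\<alpha>_k$. The accumulated size $\<sigma>_l$ of the earlier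
choices dominates all these requirements, which makes the choice a recursion on one real number.\<close>

lemma sparse_tensor_witnesses:
  assumes U: "uniformly_subsymmetric C x" and unbounded: "\<not> tensor_bounded x"
  obtains \<beta> :: "nat \<Rightarrow> nat \<Rightarrow> real" and m :: "nat \<Rightarrow> nat" and \<alpha> :: "nat \<Rightarrow> nat \<Rightarrow> real" and n :: "nat \<Rightarrow> nat"
    and c \<sigma> :: "nat \<Rightarrow> real" where
    "\<And>l. norm (\<Sum>j<m l. \<beta> l j *\<^sub>R x j) = 1" "\<And>l. norm (\<Sum>i<n l. \<alpha> l i *\<^sub>R x i) = 1"
    "\<And>l. 0 < c l" "\<And>l. c l \<le> (1/2) ^ l" "\<And>l. 1 \<le> \<sigma> l"
    "\<And>l. 4 ^ l * \<sigma> l < c l * norm (tensor_sum x (m l) (\<beta> l) (n l) (\<alpha> l))"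
    "\<And>l. (\<Sum>k<l. \<Sum>i<n k. \<bar>\<alpha> k i\<bar>) \<le> \<sigma> l"
    "\<And>l k. l < k \<Longrightarrow> c k * (\<Sum>j<m l. \<bar>\<beta> l j\<bar>) \<le> (1/2) ^ k"
proof -
  define wit where "wit B m b n a \<longleftrightarrow> norm (\<Sum>j<m. b j *\<^sub>R x j) = 1 \<and> norm (\<Sum>i<n. a i *\<^sub>R x i) = 1 \<and>
           B < norm (tensor_sum x m b n a)" for B m b n a
  have "\<forall>B. \<exists>m b n a. wit B m b n a"
    unfolding wit_def using not_tensor_bounded_normalized[OF U unbounded] by blast
  then obtain mf bf nf af where wit: "\<And>B. wit B (mf B) (bf B) (nf B) (af B)" by metis
  define P where "P B = (\<Sum>i<nf B. \<bar>af B i\<bar>)" for B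
  define Q where "Q B = (\<Sum>j<mf B. \<bar>bf B j\<bar>)" for B
  have PQ: "0 \<le> P B" "0 \<le> Q B" for B by (simp_all add: P_def Q_def sum_nonneg)
  \<comment> \<open>The \<open>l\<close>-th tensor product has norm above \<open>8 ^ l * (\<sigma> l)\<^sup>2\<close>; the factor \<open>2 ^ l * \<sigma> l\<close> compensates \<open>c l\<close>.\<close>
  define \<sigma> where "\<sigma> = rec_nat 1 (\<lambda>l s. s + P (8 ^ l * s\<^sup>2) + Q (8 ^ l * s\<^sup>2))"
  define B where "B l = 8 ^ l * (\<sigma> l)\<^sup>2" for l
  have \<sigma>_Suc: "\<sigma> (Suc l) = \<sigma> l + P (B l) + Q (B l)" for l by (simp add: \<sigma>_def B_def)
  have \<sigma>_eq: "\<sigma> l = 1 + (\<Sum>k<l. P (B k)) + (\<Sum>k<l. Q (B k))" for l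
    by (induction l) (simp_all add: \<sigma>_Suc, simp add: \<sigma>_def)
  have sums0: "0 \<le> (\<Sum>k<l. P (B k))" "0 \<le> (\<Sum>k<l. Q (B k))" for l by (simp_all add: PQ sum_nonneg)
  have \<sigma>1: "1 \<le> \<sigma> l" for l using sums0[of l] unfolding \<sigma>_eq by linarith
  define c where "c l = (1/2) ^ l / \<sigma> l" for l
  show ?thesis
  proof (rule that[where m = "\<lambda>l. mf (B l)" and \<beta> = "\<lambda>l. bf (B l)" and n = "\<lambda>l. nf (B l)"
        and \<alpha> = "\<lambda>l. af (B l)" and c = c and \<sigma> = \<sigma>])
    fix l
    show "norm (\<Sum>j<mf (B l). bf (B l) j *\<^sub>R x j) = 1" "norm (\<Sum>i<nf (B l). af (B l) i *\<^sub>R x i) = 1"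
      using wit[of "B l"] by (simp_all add: wit_def)
    show pos: "0 < c l" using \<sigma>1[of l] by (simp add: c_def)
    show "c l \<le> (1/2) ^ l" using \<sigma>1[of l] by (simp add: c_def divide_le_eq mult_left_le)
    show "1 \<le> \<sigma> l" by (rule \<sigma>1)
    have "4 ^ l * \<sigma> l = c l * B l"
    proof -
      have "(1/2::real) ^ l * 8 ^ l = 4 ^ l" by (simp flip: power_mult_distrib)
      then show ?thesis using \<sigma>1[of l] by (simp add: c_def B_def power2_eq_square)
    qed
    also have "\<dots> < c l * norm (tensor_sum x (mf (B l)) (bf (B l)) (nf (B l)) (af (B l)))"
      using pos wit[of "B l"] by (simp add: wit_def)
    finally show "4 ^ l * \<sigma> l < c l * norm (tensor_sum x (mf (B l)) (bf (B l)) (nf (B l)) (af (B l)))" .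
    show "(\<Sum>k<l. \<Sum>i<nf (B k). \<bar>af (B k) i\<bar>) \<le> \<sigma> l"
      using sums0(2)[of l] unfolding \<sigma>_eq P_def by linarith
    fix k assume "l < k"
    then have "Q (B l) \<le> (\<Sum>k<k. Q (B k))" by (intro member_le_sum) (auto simp: PQ)
    also have "\<dots> \<le> \<sigma> k" using sums0(1)[of k] unfolding \<sigma>_eq by linarith
    finally have "(1/2) ^ k / \<sigma> k * Q (B l) \<le> (1/2) ^ k / \<sigma> k * \<sigma> k"
      using \<sigma>1[of k] by (intro mult_left_mono) auto
    then show "c k * (\<Sum>j<mf (B l). \<bar>bf (B l) j\<bar>) \<le> (1/2) ^ k"
      using \<sigma>1[of k] by (simp add: c_def Q_def)
  qed
qed

lemma strict_mono_block_start: "(\<And>n. 0 < L n) \<Longrightarrow> strict_mono (block_start L)"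
  by (simp add: strict_mono_Suc_iff block_start_def)

lemma sum_blocks_from_1:
  fixes f :: "nat \<Rightarrow> 'a::comm_monoid_add"
  assumes N: "strict_mono N" "N 0 = (1::nat)"
  shows "(\<Sum>i<N j. f i) = f 0 + (\<Sum>k<j. \<Sum>i=N k..<N (Suc k). f i)"
proof (induction j)
  case (Suc j)
  have "(\<Sum>i<N (Suc j). f i) = (\<Sum>i<N j. f i) + (\<Sum>i=N j..<N (Suc j). f i)"
    using sum.atLeastLessThan_concat[of 0 "N j" "N (Suc j)" f] strict_mono_less_eq[OF N(1), of j "Suc j"]
    by (simp add: atLeast0LessThan)
  with Suc show ?case by (simp add: add.assoc)
qed (simp add: N)

lemma sum_nested_swap:
  fixes f :: "nat \<Rightarrow> nat \<Rightarrow> 'a::comm_monoid_add"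
  shows "(\<Sum>j<m. \<Sum>k<j. f j k) = (\<Sum>k<m. \<Sum>j=Suc k..<m. f j k)"
  by (induction m) (simp_all add: sum.distrib)

text \<open>Each element of $S$ is given infinitely many copies of its own.\<close>

lemma infinite_differences_family:
  obtains \<phi> :: "nat set \<Rightarrow> nat set" where
    "\<And>S S'. S \<noteq> S' \<Longrightarrow> infinite (\<phi> S - \<phi> S') \<or> infinite (\<phi> S' - \<phi> S)"
proof
  let ?\<phi> = "\<lambda>S. {k. fst (prod_decode k) \<in> S}"
  fix S S' :: "nat set"
  have *: "infinite (?\<phi> S - ?\<phi> S')" if "s \<in> S" "s \<notin> S'" for s S S'
  proof
    assume "finite (?\<phi> S - ?\<phi> S')"
    moreover have "range (\<lambda>t. prod_encode (s, t)) \<subseteq> ?\<phi> S - ?\<phi> S'" using that by auto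
    ultimately have "finite (range (\<lambda>t. prod_encode (s, t)))" by (rule rev_finite_subset)
    moreover have "inj (\<lambda>t. prod_encode (s, t))" by (auto intro!: injI)
    ultimately show False using finite_imageD infinite_UNIV_nat by blast
  qed
  assume "S \<noteq> S'"
  then show "infinite (?\<phi> S - ?\<phi> S') \<or> infinite (?\<phi> S' - ?\<phi> S)" using * by blast
qed

text \<open>For a set $A$ of natural numbers let $y^A$ be generated by $x_0 + \<Sum>_{l\<in>A} c_l \<alpha>_l$, the
$\<alpha>_l$ being placed on consecutive blocks. If $l \<in> A$, then $\<beta>_l$ applied to $y^A$ contains
the huge vector $c_l\<beta>_l\<otimes>\<alpha>_l$. If $l \<notin> A$, then apart from a copy of $\<beta>_l$ itself only
its products with $\<alpha>_k$, $k \<noteq> l$, occur, and these are small: for $k < l$ because the sum of the moduli of the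
coefficients of $\<alpha>_k$ was taken into account in the choice of step $l$, and for $k > l$ because
$c_k$ is small compared with that of $\<beta>_l$. So $y^A$ is not dominated by $y^B$ when $A - B$ is
infinite.\<close>

theorem not_tensor_bounded_imp_continuum:
  fixes x :: "nat \<Rightarrow> 'a::banach"
  assumes U: "uniformly_subsymmetric C x" and unbounded: "\<not> tensor_bounded x"
  shows "admits_continuum_of_subsymmetric_blocks x"
proof (rule sparse_tensor_witnesses[OF U unbounded])
  have C: "1 \<le> C" by (rule unif_subsym_ge_1[OF U])
  fix \<beta> :: "nat \<Rightarrow> nat \<Rightarrow> real" and m :: "nat \<Rightarrow> nat" and \<alpha> :: "nat \<Rightarrow> nat \<Rightarrow> real" and n :: "nat \<Rightarrow> nat"
    and c \<sigma> :: "nat \<Rightarrow> real"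
  assume \<beta>: "\<And>l. norm (\<Sum>j<m l. \<beta> l j *\<^sub>R x j) = 1" and
    \<alpha>: "\<And>l. norm (\<Sum>i<n l. \<alpha> l i *\<^sub>R x i) = 1" and
    c_pos: "\<And>l. 0 < c l" and c_le: "\<And>l. c l \<le> (1/2) ^ l" and \<sigma>: "\<And>l. 1 \<le> \<sigma> l" and
    big: "\<And>l. 4 ^ l * \<sigma> l < c l * norm (tensor_sum x (m l) (\<beta> l) (n l) (\<alpha> l))" and
    earlier: "\<And>l. (\<Sum>k<l. \<Sum>i<n k. \<bar>\<alpha> k i\<bar>) \<le> \<sigma> l" and
    later: "\<And>l k. l < k \<Longrightarrow> c k * (\<Sum>j<m l. \<bar>\<beta> l j\<bar>) \<le> (1/2) ^ k"
  have n_pos: "0 < n l" for l using \<alpha>[of l] by (cases "n l") auto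
  define N where "N l = 1 + (\<Sum>k<l. n k)" for l
  have N: "strict_mono N" and N0: "N 0 = 1" and N_Suc: "N (Suc l) = N l + n l" for l
    using n_pos by (simp_all add: N_def strict_mono_Suc_iff)
  have N_pos: "0 < N l" for l by (simp add: N_def)
  obtain d where d: "\<And>k p. N k \<le> p \<Longrightarrow> p < N (Suc k) \<Longrightarrow> d p = c k * \<alpha> k (p - N k)"
    using glue_blocks[OF N, where f = "\<lambda>k p. c k * \<alpha> k (p - N k)"] by blast
  obtain idx where idx: "\<And>k p. N k \<le> p \<Longrightarrow> p < N (Suc k) \<Longrightarrow> idx p = k"
    using glue_blocks[OF N, where f = "\<lambda>k p. k"] by blast
  define a where "a A p = (if p = 0 then 1 else if idx p \<in> A then d p else 0)" for A p
  have a_block: "(\<Sum>i=N k..<j. a A i *\<^sub>R w i) =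
      (if k \<in> A then c k *\<^sub>R (\<Sum>i<j - N k. \<alpha> k i *\<^sub>R w (N k + i)) else 0)"
    if "N k \<le> j" "j \<le> N (Suc k)" for A k j and w :: "nat \<Rightarrow> 'a"
  proof -
    have "(\<Sum>i=N k..<j. a A i *\<^sub>R w i) =
        (\<Sum>i=0 + N k..<(j - N k) + N k. (if k \<in> A then c k * \<alpha> k (i - N k) else 0) *\<^sub>R w i)"
      using that d idx N_pos[of k] by (intro sum.cong) (auto simp: a_def)
    also have "\<dots> = (\<Sum>i<j - N k. (if k \<in> A then c k * \<alpha> k i else 0) *\<^sub>R w (N k + i))"
      by (subst sum.shift_bounds_nat_ivl) (simp add: atLeast0LessThan add.commute cong: if_cong)
    also have "\<dots> = (if k \<in> A then c k *\<^sub>R (\<Sum>i<j - N k. \<alpha> k i *\<^sub>R w (N k + i)) else 0)"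
      by (simp add: scaleR_sum_right)
    finally show ?thesis .
  qed
  have part: "norm (\<Sum>i=N k..<j. a A i *\<^sub>R x i) \<le> C\<^sup>2 * (1/2) ^ k"
    if "N k \<le> j" "j \<le> N (Suc k)" for A k j
  proof -
    have "norm (\<Sum>i<j - N k. \<alpha> k i *\<^sub>R x (N k + i)) \<le> C\<^sup>2 * norm (\<Sum>i<n k. \<alpha> k i *\<^sub>R x i)"
      using that N_Suc[of k] by (intro unif_subsym_dominated_restrict[OF U]) auto
    then have "c k * norm (\<Sum>i<j - N k. \<alpha> k i *\<^sub>R x (N k + i)) \<le> (1/2) ^ k * C\<^sup>2"
      unfolding \<alpha> by (intro mult_mono c_le) auto
    then show ?thesis using c_pos[of k] unfolding a_block[OF that] by (simp add: mult.commute)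
  qed
  have tail: "norm (\<Sum>i=N k..<j. a A i *\<^sub>R x i) \<le> (2 * C\<^sup>2) * (1/2) ^ k" for A k j
  proof -
    have "j \<le> N (k + j)" using strict_mono_imp_increasing[OF N, of "k + j"] by simp
    then have "norm (\<Sum>i=N k..<j. a A i *\<^sub>R x i) \<le> (\<Sum>l=k..<k + j. C\<^sup>2 * (1/2) ^ l)"
      using part by (intro norm_sum_blocks_le[OF N])
    also have "\<dots> = C\<^sup>2 * (1/2) ^ k * (\<Sum>l<j. (1/2) ^ l)"
      using sum.shift_bounds_nat_ivl[of "\<lambda>l. C\<^sup>2 * (1/2::real) ^ l" 0 k j]
      by (simp add: sum_distrib_left power_add mult_ac atLeast0LessThan add.commute)
    also have "\<dots> \<le> C\<^sup>2 * (1/2) ^ k * 2"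
      using sum_half_powers_le[of "{..<j}" "\<lambda>l. l"] by (intro mult_left_mono) auto
    finally show ?thesis by (simp add: mult_ac)
  qed
  define y where "y A = generated_blocks (a A) N x" for A
  let ?p = "block_start N"
  have p: "strict_mono ?p" by (rule strict_mono_block_start) (rule N_pos)
  have a0: "a A 0 \<noteq> 0" for A by (simp add: a_def)
  have y_block: "block_basis x (y A)" for A
    unfolding y_def using N_pos a0 by (rule generated_blocks_block_basis[OF U])
  have "\<exists>D. uniformly_subsymmetric D (y A)" for A
    unfolding y_def using N_pos a0 tail by (rule generated_blocks_unif_subsym[OF U])
  then obtain D where D: "\<And>A. uniformly_subsymmetric (D A) (y A)" by metis
  \<comment> \<open>The shift by \<open>Suc l\<close> makes all blocks involved long enough to contain the \<open>l\<close>-th piece.\<close>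
  have lower: "4 ^ l * \<sigma> l \<le> C\<^sup>2 * norm (\<Sum>j<m l. \<beta> l j *\<^sub>R y A (Suc l + j))" if "l \<in> A" for A l
  proof -
    define G where "G = Sigma {..<m l} (\<lambda>j. {..<N (Suc l + j)})"
    define F where "F = {..<m l} \<times> {N l..<N (Suc l)}"
    define h where "h = (\<lambda>(j, i). ?p (Suc l + j) + i)"
    define g where "g = (\<lambda>(j, i). j * n l + (i - N l))"
    have inj: "inj_on h G"
    proof (rule inj_onI)
      fix u v assume uv: "u \<in> G" "v \<in> G" "h u = h v"
      obtain j i j' i' where [simp]: "u = (j, i)" "v = (j', i')" by (cases u, cases v)
      show "u = v"
        using block_start_inj[of i N "Suc l + j" i' "Suc l + j'"] uv by (auto simp: G_def h_def)
    qed
    have FG: "F \<subseteq> G" using strict_mono_less_eq[OF N] by (auto simp: F_def G_def intro: less_le_trans)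
    have "c l *\<^sub>R tensor_sum x (m l) (\<beta> l) (n l) (\<alpha> l) =
        (\<Sum>j<m l. \<beta> l j *\<^sub>R (\<Sum>i=N l..<N (Suc l). a A i *\<^sub>R x (j * n l + (i - N l))))"
      using that a_block[of l "N (Suc l)"]
      by (simp add: N_Suc tensor_sum_def scaleR_sum_right mult_ac)
    also have "\<dots> = (\<Sum>t\<in>F. (\<beta> l (fst t) * a A (snd t)) *\<^sub>R x (g t))"
      unfolding F_def g_def scaleR_sum_right sum.cartesian_product by (simp add: case_prod_beta)
    also have "norm \<dots> \<le> C\<^sup>2 * norm (\<Sum>t\<in>G. (\<beta> l (fst t) * a A (snd t)) *\<^sub>R x (h t))"
    proof (rule unif_subsym_dominated_restrict[OF U _ FG inj])
      show "finite G" by (simp add: G_def)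
      fix u v assume uv: "u \<in> F" "v \<in> F" "h u < h v"
      obtain j i j' i' where [simp]: "u = (j, i)" "v = (j', i')" by (cases u, cases v)
      have i: "N l \<le> i" "i < N l + n l" "N l \<le> i'" "i' < N l + n l" using uv by (auto simp: F_def N_Suc)
      show "g u < g v"
      proof (cases j j' rule: linorder_cases)
        case less
        then have "Suc j * n l \<le> j' * n l" by (intro mult_right_mono) auto
        then show ?thesis using i by (simp add: g_def)
      next
        case equal
        with uv i show ?thesis by (simp add: h_def g_def)
      next
        case greater
        have "v \<in> G" using uv FG by auto
        with greater have "h v < h u" unfolding h_def by (auto simp: G_def intro!: block_start_less)
        with uv show ?thesis by simp
      qed
    qed auto
    also have "(\<Sum>t\<in>G. (\<beta> l (fst t) * a A (snd t)) *\<^sub>R x (h t)) = (\<Sum>j<m l. \<beta> l j *\<^sub>R y A (Suc l + j))"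
      unfolding y_def generated_blocks_def scaleR_sum_right G_def h_def
      by (subst sum.Sigma) (auto simp: case_prod_beta)
    finally show ?thesis using big[of l] c_pos[of l] by simp
  qed
  have upper: "norm (\<Sum>j<m l. \<beta> l j *\<^sub>R y A j) \<le> 4 * C\<^sup>2 * \<sigma> l" if l_notin: "l \<notin> A" for A l
  proof -
    \<comment> \<open>The contribution of the \<open>k\<close>-th piece, which is present in the blocks with index above \<open>k\<close>.\<close>
    define V where "V k = (\<Sum>j\<in>{Suc k..<m l}. \<beta> l j *\<^sub>R (\<Sum>i=N k..<N (Suc k). a A i *\<^sub>R x (?p j + i)))" for k
    have split: "(\<Sum>j<m l. \<beta> l j *\<^sub>R y A j) = (\<Sum>j<m l. \<beta> l j *\<^sub>R x (?p j)) + (\<Sum>k<m l. V k)"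
    proof -
      have "y A j = x (?p j) + (\<Sum>k<j. \<Sum>i=N k..<N (Suc k). a A i *\<^sub>R x (?p j + i))" for j
        unfolding y_def generated_blocks_def sum_blocks_from_1[OF N N0] by (simp add: a_def)
      then have "(\<Sum>j<m l. \<beta> l j *\<^sub>R y A j) = (\<Sum>j<m l. \<beta> l j *\<^sub>R x (?p j)) +
          (\<Sum>j<m l. \<Sum>k<j. \<beta> l j *\<^sub>R (\<Sum>i=N k..<N (Suc k). a A i *\<^sub>R x (?p j + i)))"
        by (simp add: scaleR_add_right sum.distrib scaleR_sum_right)
      also have "(\<Sum>j<m l. \<Sum>k<j. \<beta> l j *\<^sub>R (\<Sum>i=N k..<N (Suc k). a A i *\<^sub>R x (?p j + i))) = (\<Sum>k<m l. V k)"
        unfolding V_def by (rule sum_nested_swap)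
      finally show ?thesis .
    qed
    have V_le: "norm (V k) \<le> C\<^sup>2 * ((if k < l then \<Sum>i<n k. \<bar>\<alpha> k i\<bar> else 0) + (1/2) ^ k)" for k
    proof (cases "k \<in> A")
      case False
      have "V k = 0"
        unfolding V_def using False a_block[of k "N (Suc k)"] by (simp add: N_Suc)
      then show ?thesis by (simp add: sum_nonneg)
    next
      case True
      have V_eq: "V k = (\<Sum>j=Suc k..<m l. \<beta> l j *\<^sub>R c k *\<^sub>R (\<Sum>i<n k. \<alpha> k i *\<^sub>R x (?p j + (N k + i))))"
        unfolding V_def using True a_block[of k "N (Suc k)"] by (simp add: N_Suc)
      consider "k < l" | "l < k" using True l_notin by (cases k l rule: linorder_cases) auto
      then show ?thesis
      proof cases
        case 1
        have "V k = (\<Sum>i<n k. (c k * \<alpha> k i) *\<^sub>R (\<Sum>j=Suc k..<m l. \<beta> l j *\<^sub>R x (?p j + (N k + i))))"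
          unfolding V_eq scaleR_sum_right by (subst sum.swap) (simp add: mult_ac)
        also have "norm \<dots> \<le> (\<Sum>i<n k. \<bar>\<alpha> k i\<bar> * C\<^sup>2)"
        proof (rule sum_norm_le)
          fix i
          have "norm (\<Sum>j=Suc k..<m l. \<beta> l j *\<^sub>R x (?p j + (N k + i))) \<le>
              C\<^sup>2 * norm (\<Sum>j<m l. \<beta> l j *\<^sub>R x j)"
            using p by (intro unif_subsym_dominated_restrict[OF U]) (auto simp: strict_mono_less)
          then have "norm (\<Sum>j=Suc k..<m l. \<beta> l j *\<^sub>R x (?p j + (N k + i))) \<le> C\<^sup>2"
            unfolding \<beta> by simp
          moreover have "c k \<le> 1" using c_le[of k] by (rule order_trans) (simp add: power_le_one)
          then have "\<bar>c k * \<alpha> k i\<bar> \<le> \<bar>\<alpha> k i\<bar>"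
            using c_pos[of k] by (simp add: abs_mult mult_left_le_one_le)
          ultimately show "norm ((c k * \<alpha> k i) *\<^sub>R (\<Sum>j=Suc k..<m l. \<beta> l j *\<^sub>R x (?p j + (N k + i))))
              \<le> \<bar>\<alpha> k i\<bar> * C\<^sup>2"
            unfolding norm_scaleR by (intro mult_mono) auto
        qed
        also have "\<dots> = C\<^sup>2 * (\<Sum>i<n k. \<bar>\<alpha> k i\<bar>)" by (simp add: sum_distrib_left mult.commute)
        also have "\<dots> \<le> C\<^sup>2 * ((\<Sum>i<n k. \<bar>\<alpha> k i\<bar>) + (1/2) ^ k)" by (intro mult_left_mono) auto
        finally show ?thesis using 1 by simp
      next
        case 2
        have "norm (V k) \<le> (\<Sum>j=Suc k..<m l. \<bar>\<beta> l j\<bar> * (c k * C))"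
          unfolding V_eq
        proof (rule sum_norm_le)
          fix j
          have "norm (\<Sum>i<n k. \<alpha> k i *\<^sub>R x (?p j + (N k + i))) \<le> C * norm (\<Sum>i<n k. \<alpha> k i *\<^sub>R x i)"
            by (intro unif_subsym_dominated[OF U]) auto
          then show "norm (\<beta> l j *\<^sub>R c k *\<^sub>R (\<Sum>i<n k. \<alpha> k i *\<^sub>R x (?p j + (N k + i)))) \<le> \<bar>\<beta> l j\<bar> * (c k * C)"
            using c_pos[of k] unfolding \<alpha> norm_scaleR by (intro mult_left_mono) auto
        qed
        also have "\<dots> \<le> (\<Sum>j<m l. \<bar>\<beta> l j\<bar> * (c k * C))"
          using c_pos[of k] C by (intro sum_mono2) auto
        also have "\<dots> = C * (c k * (\<Sum>j<m l. \<bar>\<beta> l j\<bar>))" by (simp add: sum_distrib_left mult_ac)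
        also have "\<dots> \<le> C * (1/2) ^ k" using later[OF 2] C by (intro mult_left_mono) auto
        also have "\<dots> \<le> C\<^sup>2 * (1/2) ^ k" using C by (intro mult_right_mono) (auto simp: power2_eq_square)
        finally show ?thesis using 2 by simp
      qed
    qed
    have "norm (\<Sum>k<m l. V k) \<le> (\<Sum>k<m l. C\<^sup>2 * ((if k < l then \<Sum>i<n k. \<bar>\<alpha> k i\<bar> else 0) + (1/2) ^ k))"
      by (rule sum_norm_le) (rule V_le)
    also have "\<dots> = C\<^sup>2 * ((\<Sum>k<m l. if k < l then \<Sum>i<n k. \<bar>\<alpha> k i\<bar> else 0) + (\<Sum>k<m l. (1/2) ^ k))"
      by (simp add: sum_distrib_left sum.distrib distrib_left)
    also have "\<dots> \<le> C\<^sup>2 * (\<sigma> l + 2)"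
    proof (intro mult_left_mono add_mono)
      have "(\<Sum>k<m l. if k < l then \<Sum>i<n k. \<bar>\<alpha> k i\<bar> else 0) = (\<Sum>k\<in>{..<m l} \<inter> {..<l}. \<Sum>i<n k. \<bar>\<alpha> k i\<bar>)"
        by (simp add: sum.inter_restrict)
      also have "\<dots> \<le> (\<Sum>k<l. \<Sum>i<n k. \<bar>\<alpha> k i\<bar>)" by (intro sum_mono2) (auto intro: sum_nonneg)
      also have "\<dots> \<le> \<sigma> l" by (rule earlier)
      finally show "(\<Sum>k<m l. if k < l then \<Sum>i<n k. \<bar>\<alpha> k i\<bar> else 0) \<le> \<sigma> l" .
      show "(\<Sum>k<m l. (1/2::real) ^ k) \<le> 2" using sum_half_powers_le[of "{..<m l}" "\<lambda>k. k"] by simp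
    qed simp
    finally have V_sum: "norm (\<Sum>k<m l. V k) \<le> C\<^sup>2 * (\<sigma> l + 2)" .
    have first: "norm (\<Sum>j<m l. \<beta> l j *\<^sub>R x (?p j)) \<le> C\<^sup>2"
    proof -
      have "norm (\<Sum>j<m l. \<beta> l j *\<^sub>R x (?p j)) \<le> C\<^sup>2 * norm (\<Sum>j<m l. \<beta> l j *\<^sub>R x j)"
        using p by (intro unif_subsym_dominated_restrict[OF U]) (auto simp: strict_mono_less)
      then show ?thesis unfolding \<beta> by simp
    qed
    have "norm (\<Sum>j<m l. \<beta> l j *\<^sub>R y A j) \<le> C\<^sup>2 + C\<^sup>2 * (\<sigma> l + 2)"
      unfolding split by (rule norm_triangle_mono[OF first V_sum])
    also have "\<dots> = C\<^sup>2 * (\<sigma> l + 3)" by (simp add: distrib_left)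
    also have "\<dots> \<le> C\<^sup>2 * (4 * \<sigma> l)" using \<sigma>[of l] by (intro mult_left_mono) auto
    finally show ?thesis by simp
  qed
  have nonequiv: "\<not> equivalent_seq (y A) (y B)" if inf: "infinite (A - B)" for A B
  proof
    assume "equivalent_seq (y A) (y B)"
    then have "\<exists>K. \<forall>n (a :: nat \<Rightarrow> real). norm (\<Sum>i<n. a i *\<^sub>R y A i) \<le> K * norm (\<Sum>i<n. a i *\<^sub>R y B i)"
      by (intro summable_transfer_imp_dominated[OF D D]) (auto simp: equivalent_seq_def)
    then obtain K where K: "\<And>n (a :: nat \<Rightarrow> real). norm (\<Sum>i<n. a i *\<^sub>R y A i) \<le> K * norm (\<Sum>i<n. a i *\<^sub>R y B i)"
      by blast
    define R where "R = C\<^sup>2 * (D A * (\<bar>K\<bar> * (4 * C\<^sup>2)))"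
    have le_R: "(4::real) ^ l \<le> R" if l: "l \<in> A" "l \<notin> B" for l
    proof -
      have DA: "1 \<le> D A" by (rule unif_subsym_ge_1[OF D])
      have "4 ^ l * \<sigma> l \<le> C\<^sup>2 * norm (\<Sum>j<m l. \<beta> l j *\<^sub>R y A (Suc l + j))" by (rule lower[OF l(1)])
      also have "\<dots> \<le> C\<^sup>2 * (D A * norm (\<Sum>j<m l. \<beta> l j *\<^sub>R y A j))"
        by (intro mult_left_mono unif_subsym_dominated[OF D]) auto
      also have "\<dots> \<le> C\<^sup>2 * (D A * (K * norm (\<Sum>j<m l. \<beta> l j *\<^sub>R y B j)))"
        using DA by (intro mult_left_mono K) auto
      also have "\<dots> \<le> C\<^sup>2 * (D A * (\<bar>K\<bar> * (4 * C\<^sup>2 * \<sigma> l)))"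
        using DA upper[OF l(2)] by (intro mult_left_mono mult_mono) auto
      also have "\<dots> = R * \<sigma> l" by (simp add: R_def)
      finally show ?thesis using \<sigma>[of l] by simp
    qed
    obtain l0 where "R < 4 ^ l0" using real_arch_pow[of 4 R] by auto
    moreover obtain l where l: "l \<in> A - B" "l0 \<le> l" using inf by (meson infinite_nat_iff_unbounded_le)
    from l(2) have "(4::real) ^ l0 \<le> 4 ^ l" by (intro power_increasing) auto
    moreover have "(4::real) ^ l \<le> R" using l(1) by (intro le_R) auto
    ultimately show False by linarith
  qed
  obtain \<phi> :: "nat set \<Rightarrow> nat set" where \<phi>:
    "\<And>S S'. S \<noteq> S' \<Longrightarrow> infinite (\<phi> S - \<phi> S') \<or> infinite (\<phi> S' - \<phi> S)"
    using infinite_differences_family by blast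
  have distinct: "\<not> equivalent_seq (y (\<phi> S)) (y (\<phi> S'))" if "S \<noteq> S'" for S S'
    using \<phi>[OF that] nonequiv unfolding equivalent_seq_def by metis
  have inj: "inj (\<lambda>S. y (\<phi> S))"
  proof (rule injI, rule ccontr)
    fix S S' assume "y (\<phi> S) = y (\<phi> S')" "S \<noteq> S'"
    with distinct[of S S'] show False by (simp add: equivalent_seq_def)
  qed
  show ?thesis
    unfolding admits_continuum_of_subsymmetric_blocks_def
  proof (intro exI conjI ballI impI)
    show "range (\<lambda>S. y (\<phi> S)) \<approx> (UNIV :: nat set set)"
      using inj by (rule inj_on_image_eqpoll_self)
  next
    fix z assume "z \<in> range (\<lambda>S. y (\<phi> S))"
    then show "block_basis x z" "subsymmetric z" using y_block unif_subsym_imp_subsymmetric[OF D] by auto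
  next
    fix z z' assume "z \<in> range (\<lambda>S. y (\<phi> S))" "z' \<in> range (\<lambda>S. y (\<phi> S))" "z \<noteq> z'"
    then obtain S S' where "z = y (\<phi> S)" "z' = y (\<phi> S')" "S \<noteq> S'" by auto
    then show "\<not> equivalent_seq z z'" using distinct by blast
  qed
qed

section \<open>Norming functionals and the lower tensor estimate\<close>

definition sublinear :: "('a::real_vector \<Rightarrow> real) \<Rightarrow> bool" where
  "sublinear q \<longleftrightarrow> (\<forall>u v. q (u + v) \<le> q u + q v) \<and> (\<forall>t u. 0 \<le> t \<longrightarrow> q (t *\<^sub>R u) = t * q u)"

lemma sublinear_neg_ge:
  assumes "sublinear q"
  shows "- q (- u) \<le> q u"
proof -
  have "q 0 = 0" using assms unfolding sublinear_def by (metis mult_zero_left order_refl scaleR_zero_left)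
  moreover have "q (u + - u) \<le> q u + q (- u)" using assms unfolding sublinear_def by blast
  ultimately show ?thesis by simp
qed

text \<open>One step towards a linear functional below a given sublinear one, as in the proof of
the Hahn-Banach theorem that goes through minimal sublinear functionals: the new functional is the
largest sublinear one below $q$ that is linear on the line through $v$ and agrees with $q$ at $v$.\<close>

lemma sublinear_make_linear_at:
  fixes q :: "'a::real_vector \<Rightarrow> real"
  assumes q: "sublinear q"
  obtains q' where "sublinear q'" "\<And>u. q' u \<le> q u" "q' (- v) = - q' v" "q' v = q v"
proof -
  have add: "q (u + w) \<le> q u + q w" and hom: "0 \<le> t \<Longrightarrow> q (t *\<^sub>R u) = t * q u" for u w t
    using q by (auto simp: sublinear_def)
  have q0: "q 0 = 0" using hom[of 0 0] by simp
  define q' where "q' u = (INF t\<in>{0..}. q (u + t *\<^sub>R v) - t * q v)" for u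
  have bdd: "bdd_below ((\<lambda>t. q (u + t *\<^sub>R v) - t * q v) ` {0..})" for u
  proof (rule bdd_belowI2)
    fix t :: real assume "t \<in> {0..}"
    then have "t * q v = q (t *\<^sub>R v)" using hom[of t v] by simp
    also have "\<dots> \<le> q (u + t *\<^sub>R v) + q (- u)" using add[of "u + t *\<^sub>R v" "- u"] by simp
    finally show "- q (- u) \<le> q (u + t *\<^sub>R v) - t * q v" by simp
  qed
  have le: "q' u \<le> q (u + t *\<^sub>R v) - t * q v" if "0 \<le> t" for u t
    unfolding q'_def using that by (intro cINF_lower bdd) auto
  have ge: "z \<le> q' u" if "\<And>t. 0 \<le> t \<Longrightarrow> z \<le> q (u + t *\<^sub>R v) - t * q v" for z u
    unfolding q'_def using that by (intro cINF_greatest) auto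
  have le_q: "q' u \<le> q u" for u using le[of 0 u] by simp
  have q'v: "q' v = q v"
  proof (rule antisym)
    show "q v \<le> q' v"
    proof (rule ge)
      fix t :: real assume "0 \<le> t"
      then have "q (v + t *\<^sub>R v) = (1 + t) * q v" using hom[of "1 + t" v] by (simp add: scaleR_add_left)
      then show "q v \<le> q (v + t *\<^sub>R v) - t * q v" by (simp add: algebra_simps)
    qed
  qed (rule le_q)
  have sub: "q' (u + w) \<le> q' u + q' w" for u w
  proof -
    have "q' (u + w) - (q (w + s *\<^sub>R v) - s * q v) \<le> q' u" if "0 \<le> s" for s
    proof (rule ge)
      fix t :: real assume "0 \<le> t"
      then have "q' (u + w) \<le> q ((u + w) + (t + s) *\<^sub>R v) - (t + s) * q v" using that by (intro le) simp
      also have "q ((u + w) + (t + s) *\<^sub>R v) \<le> q (u + t *\<^sub>R v) + q (w + s *\<^sub>R v)"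
        using add[of "u + t *\<^sub>R v" "w + s *\<^sub>R v"] by (simp add: algebra_simps)
      finally show "q' (u + w) - (q (w + s *\<^sub>R v) - s * q v) \<le> q (u + t *\<^sub>R v) - t * q v"
        by (simp add: algebra_simps)
    qed
    then have "q' (u + w) - q' u \<le> q' w" by (intro ge) (simp add: algebra_simps)
    then show ?thesis by simp
  qed
  have hom_le: "q' (s *\<^sub>R u) \<le> s * q' u" if s: "0 < s" for s u
  proof -
    have "q' (s *\<^sub>R u) / s \<le> q' u"
    proof (rule ge)
      fix t :: real assume "0 \<le> t"
      then have "q' (s *\<^sub>R u) \<le> q (s *\<^sub>R u + (s * t) *\<^sub>R v) - (s * t) * q v" using s by (intro le) simp
      also have "q (s *\<^sub>R u + (s * t) *\<^sub>R v) = s * q (u + t *\<^sub>R v)"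
        using hom[of s "u + t *\<^sub>R v"] s by (simp add: scaleR_add_right)
      finally show "q' (s *\<^sub>R u) / s \<le> q (u + t *\<^sub>R v) - t * q v" using s by (simp add: field_simps)
    qed
    then show ?thesis using s by (simp add: field_simps)
  qed
  have q'0: "q' 0 = 0"
  proof (rule antisym)
    show "q' 0 \<le> 0" using le_q[of 0] q0 by simp
    show "0 \<le> q' 0" by (rule ge) (simp add: hom)
  qed
  have hom': "q' (s *\<^sub>R u) = s * q' u" if "0 \<le> s" for s u
  proof (cases "s = 0")
    case False
    with that have s: "0 < s" by simp
    have "q' u \<le> (1 / s) * q' (s *\<^sub>R u)" using hom_le[of "1 / s" "s *\<^sub>R u"] s by simp
    then have "s * q' u \<le> q' (s *\<^sub>R u)" using s by (simp add: field_simps)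
    with hom_le[OF s] show ?thesis by (rule antisym)
  qed (simp add: q'0)
  have q': "sublinear q'" using sub hom' by (simp add: sublinear_def)
  have "q' (- v) \<le> - q' v" using le[of 1 "- v"] q0 q'v by simp
  moreover have "- q' v \<le> q' (- v)" using sublinear_neg_ge[OF q', of "- v"] by simp
  ultimately show ?thesis using that q' le_q q'v by force
qed

text \<open>The Hahn-Banach theorem on the span of finitely many vectors. Starting from the norm, the
functional is made linear first in the direction of the vector to be normed and then in the
directions of all $x_i$; linearity, once achieved, survives passing to smaller functionals.\<close>

lemma norming_coefficients:
  fixes x :: "nat \<Rightarrow> 'a::real_normed_vector" and a :: "nat \<Rightarrow> real"
  obtains f :: "nat \<Rightarrow> real" where "(\<Sum>i<n. f i * a i) = norm (\<Sum>i<n. a i *\<^sub>R x i)"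
    "\<And>b. \<bar>\<Sum>i<n. f i * b i\<bar> \<le> norm (\<Sum>i<n. b i *\<^sub>R x i)"
proof -
  define w where "w = (\<Sum>i<n. a i *\<^sub>R x i)"
  have "\<exists>q. sublinear q \<and> (\<forall>u. q u \<le> norm u) \<and> q (- w) \<le> - norm w \<and> (\<forall>i<k. q (- x i) = - q (x i))" for k
  proof (induction k)
    case 0
    have "sublinear (norm :: 'a \<Rightarrow> real)" by (simp add: sublinear_def norm_triangle_ineq)
    then obtain q where "sublinear q" "\<And>u. q u \<le> norm u" "q (- w) = - q w" "q w = norm w"
      using sublinear_make_linear_at[of norm w] by blast
    then show ?case by (intro exI[of _ q]) auto
  next
    case (Suc k)
    then obtain q where q: "sublinear q" "\<And>u. q u \<le> norm u" "q (- w) \<le> - norm w"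
        "\<And>i. i < k \<Longrightarrow> q (- x i) = - q (x i)" by blast
    obtain q' where q': "sublinear q'" "\<And>u. q' u \<le> q u" "q' (- x k) = - q' (x k)"
      using sublinear_make_linear_at[OF q(1), of "x k"] by blast
    have "q' (- x i) = - q' (x i)" if "i < Suc k" for i
    proof (cases "i = k")
      case False
      then have "q' (- x i) \<le> - q (x i)" using q(4)[of i] q'(2)[of "- x i"] that by simp
      also have "\<dots> \<le> - q' (x i)" using q'(2)[of "x i"] by simp
      finally show ?thesis using sublinear_neg_ge[OF q'(1), of "- x i"] by simp
    qed (simp add: q')
    then show ?case
      using q' q by (intro exI[of _ q']) (auto intro: order_trans)
  qed
  then obtain q where q: "sublinear q" "\<And>u. q u \<le> norm u" "q (- w) \<le> - norm w"
      "\<And>i. i < n \<Longrightarrow> q (- x i) = - q (x i)" by blast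
  have add: "q (u + v) \<le> q u + q v" and hom: "0 \<le> t \<Longrightarrow> q (t *\<^sub>R u) = t * q u" for u v t
    using q(1) by (auto simp: sublinear_def)
  define f where "f i = q (x i)" for i
  have single: "q (t *\<^sub>R x i) = t * f i" if "i < n" for t i
  proof (cases "0 \<le> t")
    case False
    then have "q ((- t) *\<^sub>R (- x i)) = (- t) * q (- x i)" by (intro hom) simp
    then show ?thesis using q(4)[OF that] by (simp add: f_def)
  qed (simp add: hom f_def)
  have upper: "q (\<Sum>i<k. b i *\<^sub>R x i) \<le> (\<Sum>i<k. f i * b i)" if "k \<le> n" for b k
    using that
  proof (induction k)
    case 0
    show ?case using hom[of 0 0] by simp
  next
    case (Suc k)
    then show ?case
      using add[of "\<Sum>i<k. b i *\<^sub>R x i" "b k *\<^sub>R x k"] single[of k "b k"] by (simp add: mult.commute)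
  qed
  have le: "(\<Sum>i<n. f i * b i) \<le> norm (\<Sum>i<n. b i *\<^sub>R x i)" for b
  proof -
    have "q (- (\<Sum>i<n. b i *\<^sub>R x i)) \<le> - (\<Sum>i<n. f i * b i)"
      using upper[of n "\<lambda>i. - b i"] by (simp add: sum_negf)
    then show ?thesis
      using sublinear_neg_ge[OF q(1), of "\<Sum>i<n. b i *\<^sub>R x i"] q(2)[of "\<Sum>i<n. b i *\<^sub>R x i"] by linarith
  qed
  show ?thesis
  proof (rule that)
    have "norm w \<le> q w" using sublinear_neg_ge[OF q(1), of w] q(3) by linarith
    also have "\<dots> \<le> (\<Sum>i<n. f i * a i)" unfolding w_def by (rule upper) simp
    finally show "(\<Sum>i<n. f i * a i) = norm (\<Sum>i<n. a i *\<^sub>R x i)" using le[of a] by (simp add: w_def)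
    show "\<bar>\<Sum>i<n. f i * b i\<bar> \<le> norm (\<Sum>i<n. b i *\<^sub>R x i)" for b
      using le[of b] le[of "\<lambda>i. - b i"] by (simp add: sum_negf abs_le_iff)
  qed
qed

lemma biorthogonal_combination_norm_le:
  fixes x :: "nat \<Rightarrow> 'a::real_normed_vector" and f :: "nat \<Rightarrow> 'a \<Rightarrow>\<^sub>L real" and g :: "nat \<Rightarrow> real"
  assumes basis: "schauder_basis_of UNIV x" and U: "uniformly_subsymmetric C x"
    and bi: "biorthogonal x f"
    and g: "\<And>b. \<bar>\<Sum>i<n. g i * b i\<bar> \<le> norm (\<Sum>i<n. b i *\<^sub>R x i)"
  shows "norm (\<Sum>i<n. g i *\<^sub>R f i) \<le> C"
proof (rule norm_blinfun_bound)
  show C: "0 \<le> C" using unif_subsym_ge_1[OF U] by simp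
  fix v
  obtain d where d: "(\<lambda>n. d n *\<^sub>R x n) sums v"
    using basis unfolding schauder_basis_of_def by (meson UNIV_I ex1_implies_ex)
  have "norm (blinfun_apply (\<Sum>i<n. g i *\<^sub>R f i) v) = \<bar>\<Sum>i<n. g i * d i\<bar>"
    by (simp add: blinfun.sum_left blinfun.scaleR_left biorthogonal_eq_coefficient[OF bi d])
  also have "\<dots> \<le> norm (\<Sum>i<n. d i *\<^sub>R x i)" by (rule g)
  also have "\<dots> \<le> C * norm v"
  proof (rule tendsto_lowerbound)
    show "(\<lambda>m. C * norm (\<Sum>k<m. d k *\<^sub>R x k)) \<longlonglongrightarrow> C * norm v"
      using d unfolding sums_def by (intro tendsto_intros)
    show "\<forall>\<^sub>F m in sequentially. norm (\<Sum>i<n. d i *\<^sub>R x i) \<le> C * norm (\<Sum>k<m. d k *\<^sub>R x k)"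
      using eventually_ge_at_top[of n] by eventually_elim (rule unif_subsym_partial[OF U])
  qed simp
  finally show "norm (blinfun_apply (\<Sum>i<n. g i *\<^sub>R f i) v) \<le> C * norm v" .
qed

lemma tensor_index_eq_iff:
  fixes i i' j j' n :: nat
  assumes "i < n" "i' < n"
  shows "j * n + i = j' * n + i' \<longleftrightarrow> j = j' \<and> i = i'"
proof
  assume eq: "j * n + i = j' * n + i'"
  have "(j * n + i) div n = j" "(j' * n + i') div n = j'" using assms by simp_all
  with eq show "j = j' \<and> i = i'" by simp
qed simp

text \<open>If $g$ and $h$ norm the two factors, then the tensor product of $g$ and $h$ takes the product of the
norms as its value at the tensor product, and its own norm is bounded by assumption.\<close>

lemma dual_tensor_bounded_imp_tensor_ge:
  fixes x :: "nat \<Rightarrow> 'a::real_normed_vector" and f :: "nat \<Rightarrow> 'a \<Rightarrow>\<^sub>L real"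
  assumes basis: "schauder_basis_of UNIV x" and U: "uniformly_subsymmetric C x"
    and bi: "biorthogonal x f" and dual: "tensor_bounded f"
  shows "\<exists>B. \<forall>m b n a. norm (\<Sum>j<m. b j *\<^sub>R x j) * norm (\<Sum>i<n. a i *\<^sub>R x i)
           \<le> B * norm (tensor_sum x m b n a)"
proof -
  obtain B where B: "\<And>m b n a. norm (tensor_sum f m b n a) \<le>
      B * (norm (\<Sum>j<m. b j *\<^sub>R f j) * norm (\<Sum>i<n. a i *\<^sub>R f i))"
    using dual unfolding tensor_bounded_def by blast
  have C: "1 \<le> C" by (rule unif_subsym_ge_1[OF U])
  have "norm (\<Sum>j<m. b j *\<^sub>R x j) * norm (\<Sum>i<n. a i *\<^sub>R x i)
           \<le> (\<bar>B\<bar> * (C * C)) * norm (tensor_sum x m b n a)" for m b n a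
  proof -
    obtain g where g: "(\<Sum>j<m. g j * b j) = norm (\<Sum>j<m. b j *\<^sub>R x j)"
        "\<And>b. \<bar>\<Sum>j<m. g j * b j\<bar> \<le> norm (\<Sum>j<m. b j *\<^sub>R x j)"
      using norming_coefficients[where x = x and a = b and n = m] by blast
    obtain h where h: "(\<Sum>i<n. h i * a i) = norm (\<Sum>i<n. a i *\<^sub>R x i)"
        "\<And>b. \<bar>\<Sum>i<n. h i * b i\<bar> \<le> norm (\<Sum>i<n. b i *\<^sub>R x i)"
      using norming_coefficients[where x = x and a = a and n = n] by blast
    let ?w = "tensor_sum x m b n a"
    have coeff: "blinfun_apply (f (j * n + i)) ?w = b j * a i" if "j < m" "i < n" for j i
    proof -
      have "blinfun_apply (f (j * n + i)) ?w =
          (\<Sum>j'<m. \<Sum>i'<n. if j' = j then (if i' = i then b j' * a i' else 0) else 0)"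
        unfolding tensor_sum_def blinfun.sum_right blinfun.scaleR_right
        using bi that by (intro sum.cong refl) (auto simp: biorthogonal_def tensor_index_eq_iff)
      also have "\<dots> = (\<Sum>j'<m. if j' = j then (\<Sum>i'<n. if i' = i then b j' * a i' else 0) else 0)"
        by (intro sum.cong refl) auto
      also have "\<dots> = b j * a i" using that by simp
      finally show ?thesis .
    qed
    have "norm (\<Sum>j<m. b j *\<^sub>R x j) * norm (\<Sum>i<n. a i *\<^sub>R x i) = (\<Sum>j<m. g j * b j) * (\<Sum>i<n. h i * a i)"
      by (simp add: g h)
    also have "\<dots> = (\<Sum>j<m. \<Sum>i<n. (g j * h i) * (b j * a i))"
      unfolding sum_product by (intro sum.cong refl) (simp add: mult_ac)
    also have "\<dots> = blinfun_apply (tensor_sum f m g n h) ?w"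
      unfolding tensor_sum_def[of f] blinfun.sum_left blinfun.scaleR_left
      by (intro sum.cong refl) (simp add: coeff)
    also have "\<dots> \<le> norm (tensor_sum f m g n h) * norm ?w"
      using norm_blinfun[of "tensor_sum f m g n h" ?w] by simp
    also have "norm (tensor_sum f m g n h) \<le> \<bar>B\<bar> * (C * C)"
    proof -
      have "norm (tensor_sum f m g n h) \<le>
          B * (norm (\<Sum>j<m. g j *\<^sub>R f j) * norm (\<Sum>i<n. h i *\<^sub>R f i))" by (rule B)
      also have "\<dots> \<le> \<bar>B\<bar> * (C * C)"
        using C biorthogonal_combination_norm_le[OF basis U bi g(2)]
          biorthogonal_combination_norm_le[OF basis U bi h(2)]
        by (intro mult_mono) auto
      finally show ?thesis .
    qed
    finally show ?thesis by (simp add: mult_right_mono)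
  qed
  then show ?thesis by blast
qed

section \<open>Multiplicativity up to a constant forces a power\<close>

text \<open>The slope separates the quotients $(h(k)-b)/k$ from the quotients $(h(j)+b)/j$: both
are compared at the common multiple $jk$.\<close>

lemma quasi_additive_near_linear:
  fixes h :: "nat \<Rightarrow> real"
  assumes qa: "\<And>j k. \<bar>h (j + k) - h j - h k\<bar> \<le> b"
  obtains s where "\<And>k. \<bar>h k - s * real k\<bar> \<le> b"
proof -
  have mult: "\<bar>h (Suc m * k) - real (Suc m) * h k\<bar> \<le> real m * b" for m k
  proof (induction m)
    case (Suc m)
    have "h (Suc (Suc m) * k) - real (Suc (Suc m)) * h k =
        (h (k + Suc m * k) - h k - h (Suc m * k)) + (h (Suc m * k) - real (Suc m) * h k)"
      by (simp add: algebra_simps)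
    also have "\<bar>\<dots>\<bar> \<le> b + real m * b" by (intro order_trans[OF abs_triangle_ineq] add_mono qa Suc)
    finally show ?case by (simp add: algebra_simps)
  qed simp
  have le: "(h k - b) / real k \<le> (h j + b) / real j" if jk: "0 < j" "0 < k" for j k
  proof -
    obtain j' k' where [simp]: "j = Suc j'" "k = Suc k'" using jk by (metis gr0_implies_Suc)
    have "\<bar>h (j * k) - real j * h k\<bar> \<le> real j' * b" "\<bar>h (j * k) - real k * h j\<bar> \<le> real k' * b"
      using mult[of j' k] mult[of k' j] by (simp_all add: mult.commute)
    moreover have "0 \<le> b" using qa[of 0 0] by linarith
    ultimately have "real j * (h k - b) \<le> real k * (h j + b)"
      unfolding \<open>j = Suc j'\<close> \<open>k = Suc k'\<close> of_nat_Suc by (auto simp: algebra_simps abs_le_iff)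
    then show ?thesis using jk by (simp add: field_simps)
  qed
  define s where "s = (SUP k\<in>{0<..}. (h k - b) / real k)"
  have upper: "s \<le> (h j + b) / real j" if "0 < j" for j
    unfolding s_def using le[OF that] by (intro cSUP_least) auto
  have lower: "(h k - b) / real k \<le> s" if "0 < k" for k
    unfolding s_def
  proof (rule cSUP_upper)
    show "bdd_above ((\<lambda>k. (h k - b) / real k) ` {0<..})"
      using le[of 1] by (intro bdd_aboveI2[of _ _ "(h 1 + b) / real 1"]) auto
  qed (use that in simp)
  have "\<bar>h k - s * real k\<bar> \<le> b" for k
  proof (cases "k = 0")
    case True
    then show ?thesis using qa[of 0 0] by simp
  next
    case False
    then have "s * real k \<le> h k + b" "h k - b \<le> s * real k"
      using upper[of k] lower[of k] by (simp_all add: field_simps)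
    then show ?thesis by linarith
  qed
  then show ?thesis using that by blast
qed

definition fundamental :: "(nat \<Rightarrow> 'a::real_normed_vector) \<Rightarrow> nat \<Rightarrow> real" where
  "fundamental x n = norm (\<Sum>i<n. x i)"

lemma unif_subsym_fundamental_card:
  assumes U: "uniformly_subsymmetric C x" and F: "finite F"
  shows "norm (\<Sum>i\<in>F. x i) \<le> C * fundamental x (card F)"
    and "fundamental x (card F) \<le> C * norm (\<Sum>i\<in>F. x i)"
proof -
  obtain h where h: "bij_betw h {..<card F} F" "strict_mono_on {..<card F} h"
    using ex_bij_betw_strict_mono_card[OF F] by blast
  have eq: "(\<Sum>i\<in>F. x i) = (\<Sum>i<card F. 1 *\<^sub>R x (h i))"
    using sum.reindex_bij_betw[OF h(1), of x] by simp
  have less: "h i < h j \<longleftrightarrow> i < j" if "i < card F" "j < card F" for i j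
    using h(2) that by (metis lessThan_iff strict_mono_on_less)
  show "norm (\<Sum>i\<in>F. x i) \<le> C * fundamental x (card F)"
    unfolding eq fundamental_def
    using unif_subsym_dominated[OF U, of "{..<card F}" "\<lambda>i. i" h "\<lambda>_. 1" "\<lambda>_. 1"] less by simp
  show "fundamental x (card F) \<le> C * norm (\<Sum>i\<in>F. x i)"
    unfolding eq fundamental_def
    using unif_subsym_dominated[OF U, of "{..<card F}" h "\<lambda>i. i" "\<lambda>_. 1" "\<lambda>_. 1"] less
      strict_mono_on_imp_inj_on[OF h(2)] by simp
qed

lemma sum_div_mod:
  fixes f :: "nat \<Rightarrow> nat \<Rightarrow> 'a::comm_monoid_add"
  shows "(\<Sum>t<m * n. f (t div n) (t mod n)) = (\<Sum>j<m. \<Sum>i<n. f j i)"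
proof -
  have "(\<Sum>t<m * n. f (t div n) (t mod n)) = (\<Sum>j<m. \<Sum>t=j * n..<j * n + n. f (t div n) (t mod n))"
    by (rule sum.nat_group[symmetric])
  also have "\<dots> = (\<Sum>j<m. \<Sum>i<n. f j i)"
  proof (rule sum.cong[OF refl])
    fix j
    have "(\<Sum>t=j * n..<j * n + n. f (t div n) (t mod n)) =
        (\<Sum>t=0 + j * n..<n + j * n. f (t div n) (t mod n))" by (simp add: add.commute)
    also have "\<dots> = (\<Sum>i<n. f ((i + j * n) div n) ((i + j * n) mod n))"
      by (subst sum.shift_bounds_nat_ivl) (simp add: atLeast0LessThan)
    also have "\<dots> = (\<Sum>i<n. f j i)" by (intro sum.cong refl) simp
    finally show "(\<Sum>t=j * n..<j * n + n. f (t div n) (t mod n)) = (\<Sum>i<n. f j i)" .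
  qed
  finally show ?thesis .
qed

lemma tensor_sum_div_mod:
  "tensor_sum x m b n a = (\<Sum>t<m * n. (b (t div n) * a (t mod n)) *\<^sub>R x t)"
proof -
  have "(\<Sum>t<m * n. (b (t div n) * a (t mod n)) *\<^sub>R x t) =
      (\<Sum>t<m * n. (b (t div n) * a (t mod n)) *\<^sub>R x (t div n * n + t mod n))" by simp
  also have "\<dots> = tensor_sum x m b n a"
    unfolding tensor_sum_def by (rule sum_div_mod[of "\<lambda>j i. (b j * a i) *\<^sub>R x (j * n + i)"])
  finally show ?thesis ..
qed

lemma polynomial_over_geometric_tendsto_0:
  fixes q :: real
  assumes q: "1 < q"
  shows "(\<lambda>k. real (k + 1) ^ n / q ^ k) \<longlonglongrightarrow> 0"
proof (cases "n = 0")
  case True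
  have "(\<lambda>k. (1 / q) ^ k) \<longlonglongrightarrow> 0" using q by (intro LIMSEQ_abs_realpow_zero2) simp
  then show ?thesis using True by (simp add: power_one_over)
next
  case False
  define r where "r = root n q"
  have r: "1 < r" "r ^ n = q" using q False by (simp_all add: r_def)
  have "(\<lambda>k. real k * (1 / r) ^ k) \<longlonglongrightarrow> 0"
    using r by (intro powser_times_n_limit_0) simp
  moreover have "(\<lambda>k. (1 / r) ^ k) \<longlonglongrightarrow> 0" using r by (intro LIMSEQ_abs_realpow_zero2) simp
  ultimately have "(\<lambda>k. real k * (1 / r) ^ k + (1 / r) ^ k) \<longlonglongrightarrow> 0 + 0" by (rule tendsto_add)
  then have "(\<lambda>k. (real k * (1 / r) ^ k + (1 / r) ^ k) ^ n) \<longlonglongrightarrow> (0 + 0) ^ n" by (rule tendsto_power)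
  moreover have "(real k * (1 / r) ^ k + (1 / r) ^ k) ^ n = real (k + 1) ^ n / q ^ k" for k
  proof -
    have "real k * (1 / r) ^ k + (1 / r) ^ k = real (k + 1) / r ^ k"
      using r by (simp add: power_one_over field_simps)
    then show ?thesis by (simp add: power_divide r(2)[symmetric] mult.commute flip: power_mult)
  qed
  ultimately show ?thesis using False by (simp add: zero_power)
qed

text \<open>Exponential growth beats polynomial growth, so polynomial factors and fixed constants disappear when
$k$-th roots are taken.\<close>

lemma le_of_powers_le_polynomial:
  fixes A E D :: real
  assumes AE: "0 \<le> A" "0 \<le> E" and le: "\<And>k. A ^ k \<le> D * real (k + 1) ^ n * E ^ k"
  shows "A \<le> E"
proof (cases "E = 0")
  case True
  then show ?thesis using le[of 1] by simp
next
  case False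
  with AE have E: "0 < E" by simp
  show ?thesis
  proof (rule ccontr)
    assume "\<not> A \<le> E"
    then have q: "1 < A / E" using E by simp
    have "(\<lambda>k. D * (real (k + 1) ^ n / (A / E) ^ k)) \<longlonglongrightarrow> D * 0"
      by (intro tendsto_mult tendsto_const polynomial_over_geometric_tendsto_0 q)
    then have "\<forall>\<^sub>F k in sequentially. D * (real (k + 1) ^ n / (A / E) ^ k) < 1"
      by (intro order_tendstoD(2)[of _ "D * 0"]) auto
    then obtain k where k: "D * (real (k + 1) ^ n / (A / E) ^ k) < 1"
      by (auto simp: eventually_sequentially)
    have "0 < A" using q E AE by (cases "A = 0") auto
    then have "D * real (k + 1) ^ n * E ^ k < A ^ k"
      using k E by (simp add: power_divide field_simps)
    with le[of k] show False by simp
  qed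
qed

text \<open>The coefficients of the $k$-fold tensor power; digit expansion in base $n$ identifies
$k$-tuples of indices with the numbers below $n^k$.\<close>

primrec tensor_power :: "nat \<Rightarrow> (nat \<Rightarrow> real) \<Rightarrow> nat \<Rightarrow> nat \<Rightarrow> real" where
  "tensor_power n a 0 = (\<lambda>t. 1)"
| "tensor_power n a (Suc k) = (\<lambda>t. tensor_power n a k (t div n) * a (t mod n))"

text \<open>The value of a product depends only on how often each coefficient occurs in it. This makes the
number of values polynomial in $k$.\<close>

lemma tensor_power_values:
  assumes "t < n ^ k"
  shows "tensor_power n a k t \<in> (\<lambda>c. \<Prod>i<n. a i ^ c i) ` (PiE {..<n} (\<lambda>_. {..k}))"
  using assms
proof (induction k arbitrary: t)
  case 0
  show ?case
    by (rule image_eqI[of _ _ "\<lambda>i\<in>{..<n}. 0"]) (auto simp: restrict_def)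
next
  case (Suc k)
  have n: "0 < n" using Suc.prems by (cases n) auto
  have "t div n < n ^ k" using Suc.prems n by (simp add: less_mult_imp_div_less mult.commute)
  from Suc.IH[OF this] obtain c where c: "c \<in> PiE {..<n} (\<lambda>_. {..k})"
    "tensor_power n a k (t div n) = (\<Prod>i<n. a i ^ c i)" by auto
  define i0 where "i0 = t mod n"
  have i0: "i0 < n" using n by (simp add: i0_def)
  show ?case
  proof (rule image_eqI[of _ _ "c(i0 := Suc (c i0))"])
    show "c(i0 := Suc (c i0)) \<in> PiE {..<n} (\<lambda>_. {..Suc k})"
    proof (rule PiE_I)
      fix i assume "i \<in> {..<n}"
      then have "c i \<le> k" "c i0 \<le> k" using c(1) i0 by (auto simp: PiE_iff)
      then show "(c(i0 := Suc (c i0))) i \<in> {..Suc k}" by simp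
    next
      fix i assume "i \<notin> {..<n}"
      with i0 have "i \<noteq> i0" by auto
      with PiE_arb[OF c(1) \<open>i \<notin> {..<n}\<close>] show "(c(i0 := Suc (c i0))) i = undefined" by simp
    qed
    have "(\<Prod>i<n. a i ^ (c(i0 := Suc (c i0))) i) = (\<Prod>i<n. a i ^ c i * (if i = i0 then a i else 1))"
      by (intro prod.cong refl) simp
    also have "\<dots> = (\<Prod>i<n. a i ^ c i) * a i0" using i0 by (simp add: prod.distrib)
    finally show "tensor_power n a (Suc k) t = (\<Prod>i<n. a i ^ (c(i0 := Suc (c i0))) i)"
      using c(2) by (simp add: i0_def)
  qed
qed

lemma card_tensor_power_values_le:
  "card (tensor_power n a k ` {..<n ^ k}) \<le> (k + 1) ^ n"
proof -
  have fin: "finite (PiE {..<n} (\<lambda>_. {..k}))" by (intro finite_PiE) auto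
  have "card (tensor_power n a k ` {..<n ^ k}) \<le> card ((\<lambda>c. \<Prod>i<n. a i ^ c i) ` (PiE {..<n} (\<lambda>_. {..k})))"
    using fin tensor_power_values by (intro card_mono finite_imageI) blast+
  also have "\<dots> \<le> card (PiE {..<n} (\<lambda>_. {..k}))" by (rule card_image_le[OF fin])
  also have "\<dots> = (k + 1) ^ n" by (simp add: card_PiE)
  finally show ?thesis .
qed

lemma sum_tensor_power_powr:
  "(\<Sum>t<n ^ k. \<bar>tensor_power n a k t\<bar> powr p) = (\<Sum>i<n. \<bar>a i\<bar> powr p) ^ k"
proof (induction k)
  case (Suc k)
  have "(\<Sum>t<n ^ Suc k. \<bar>tensor_power n a (Suc k) t\<bar> powr p) =
      (\<Sum>t<n ^ k * n. \<bar>tensor_power n a k (t div n)\<bar> powr p * \<bar>a (t mod n)\<bar> powr p)"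
    by (simp add: abs_mult powr_mult mult.commute)
  also have "\<dots> = (\<Sum>j<n ^ k. \<Sum>i<n. \<bar>tensor_power n a k j\<bar> powr p * \<bar>a i\<bar> powr p)"
    by (rule sum_div_mod)
  also have "\<dots> = (\<Sum>t<n ^ k. \<bar>tensor_power n a k t\<bar> powr p) * (\<Sum>i<n. \<bar>a i\<bar> powr p)"
    by (simp add: sum_product)
  finally show ?case using Suc by simp
qed simp


lemma nonpos_of_multiples_bounded:
  fixes t c :: real
  assumes "\<And>k :: nat. t * real k \<le> c"
  shows "t \<le> 0"
proof (rule ccontr)
  assume "\<not> t \<le> 0"
  then obtain k :: nat where "c < real k * t" using reals_Archimedean3[of t] by auto
  with assms[of k] show False by (simp add: mult.commute)
qed

lemma fundamental_pos:
  assumes "uniformly_subsymmetric C x" "0 < n"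
  shows "0 < fundamental x n"
  using unif_subsym_sum_eq_0[OF assms(1), of "\<lambda>_. 1" n 0] assms(2) by (auto simp: fundamental_def)

lemma fundamental_mono:
  assumes U: "uniformly_subsymmetric C x" and "m \<le> n"
  shows "fundamental x m \<le> C * fundamental x n"
  using unif_subsym_partial[OF assms, of "\<lambda>_. 1"] by (simp add: fundamental_def)

text \<open>On powers of two the logarithm of the fundamental function is additive up to a constant, hence
linear up to a constant; monotonicity fills the gaps. The exponent is at most one by the triangle
inequality and nonnegative by monotonicity.\<close>

lemma fundamental_power_like:
  assumes U: "uniformly_subsymmetric C x" and B: "1 \<le> B"
    and tens_le: "\<And>m b n a. norm (tensor_sum x m b n a) \<le>
      B * (norm (\<Sum>j<m. b j *\<^sub>R x j) * norm (\<Sum>i<n. a i *\<^sub>R x i))"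
    and tens_ge: "\<And>m b n a. norm (\<Sum>j<m. b j *\<^sub>R x j) * norm (\<Sum>i<n. a i *\<^sub>R x i) \<le>
      B * norm (tensor_sum x m b n a)"
  obtains s K where "0 \<le> s" "s \<le> 1" "0 \<le> K"
    "\<And>n. 0 < n \<Longrightarrow> fundamental x n \<le> K * real n powr s"
    "\<And>n. 0 < n \<Longrightarrow> real n powr s \<le> K * fundamental x n"
proof -
  let ?L = "fundamental x"
  have C: "1 \<le> C" by (rule unif_subsym_ge_1[OF U])
  have ones: "tensor_sum x m (\<lambda>_. 1) n (\<lambda>_. 1) = (\<Sum>t<m * n. x t)" for m n
    by (simp add: tensor_sum_div_mod)
  have mult_le: "?L (m * n) \<le> B * (?L m * ?L n)" and mult_ge: "?L m * ?L n \<le> B * ?L (m * n)" for m n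
    using tens_le[where m = m and b = "\<lambda>_. 1" and n = n and a = "\<lambda>_. 1"]
      tens_ge[where m = m and b = "\<lambda>_. 1" and n = n and a = "\<lambda>_. 1"]
    by (simp_all add: ones fundamental_def)
  have pos: "0 < ?L (2 ^ k)" for k using fundamental_pos[OF U] by simp
  define h where "h k = ln (?L (2 ^ k))" for k
  have exp_h: "exp (h k) = ?L (2 ^ k)" for k using pos by (simp add: h_def)
  have "\<bar>h (j + k) - h j - h k\<bar> \<le> ln B" for j k
  proof -
    have "h (j + k) \<le> ln (B * (?L (2 ^ j) * ?L (2 ^ k)))"
      unfolding h_def power_add using mult_le[of "2 ^ j" "2 ^ k"] pos[of "j + k"]
      by (intro ln_mono) (auto simp: power_add)
    also have "\<dots> = ln B + (h j + h k)" using pos B by (simp add: h_def ln_mult_pos)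
    finally have 1: "h (j + k) \<le> ln B + (h j + h k)" .
    have "h j + h k = ln (?L (2 ^ j) * ?L (2 ^ k))" using pos by (simp add: h_def ln_mult_pos)
    also have "\<dots> \<le> ln (B * ?L (2 ^ (j + k)))"
      unfolding power_add using mult_ge[of "2 ^ j" "2 ^ k"] pos by (intro ln_mono) auto
    also have "\<dots> = ln B + h (j + k)" using pos B by (simp add: h_def ln_mult_pos)
    finally show ?thesis using 1 by (simp add: abs_le_iff)
  qed
  then obtain r where r: "\<And>k. \<bar>h k - r * real k\<bar> \<le> ln B"
    using quasi_additive_near_linear by blast
  \<comment> \<open>Rescaled so that \<open>2 ^ k\<close> raised to the power \<open>s\<close> is \<open>exp (r * k)\<close>.\<close>
  define s where "s = r / ln 2"
  have pow: "real (2 ^ k) powr s = exp (r * real k)" for k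
    by (simp add: s_def powr_def ln_realpow)
  have dyadic_le: "?L (2 ^ k) \<le> B * real (2 ^ k) powr s" for k
  proof -
    have "?L (2 ^ k) \<le> exp (ln B + r * real k)"
      using r[of k] unfolding exp_h[symmetric] by (simp add: abs_le_iff)
    then show ?thesis using B unfolding pow by (simp add: exp_add)
  qed
  have dyadic_ge: "real (2 ^ k) powr s \<le> B * ?L (2 ^ k)" for k
  proof -
    have "exp (r * real k) \<le> exp (ln B + h k)" using r[of k] by (simp add: abs_le_iff)
    then show ?thesis using B unfolding pow by (simp add: exp_add exp_h)
  qed
  have "(- r) * real k \<le> ln B - ln (?L 1 / C)" for k
  proof -
    have "?L 1 / C \<le> ?L (2 ^ k)"
      using fundamental_mono[OF U, of 1 "2 ^ k"] C by (simp add: divide_le_eq mult.commute)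
    then have "ln (?L 1 / C) \<le> h k"
      unfolding h_def using C fundamental_pos[OF U, of 1] by (intro ln_mono) auto
    then show ?thesis using r[of k] by (simp add: abs_le_iff)
  qed
  then have "- r \<le> 0" by (rule nonpos_of_multiples_bounded)
  then have s0: "0 \<le> s" by (simp add: s_def)
  have "(r - ln 2) * real k \<le> ln B + ln (C * norm (x 0))" for k
  proof -
    have nz: "0 < C * norm (x 0)" using C unif_subsym_nonzero[OF U] by (intro mult_pos_pos) auto
    have "?L (2 ^ k) \<le> (\<Sum>i<(2::nat) ^ k. C * norm (x 0))"
      unfolding fundamental_def by (rule sum_norm_le) (rule unif_subsym_norm_le[OF U])
    then have "h k \<le> ln (2 ^ k * (C * norm (x 0)))"
      unfolding h_def using pos by (intro ln_mono) auto
    also have "\<dots> = real k * ln 2 + ln (C * norm (x 0))" using nz by (simp add: ln_mult_pos ln_realpow)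
    finally show ?thesis using r[of k] by (simp add: abs_le_iff algebra_simps)
  qed
  then have "r - ln 2 \<le> 0" by (rule nonpos_of_multiples_bounded)
  then have s1: "s \<le> 1" by (simp add: s_def)
  have two: "real (2 ^ Suc k) powr s \<le> 2 * real (2 ^ k) powr s" for k
  proof -
    have "real (2 ^ Suc k) powr s = 2 powr s * real (2 ^ k) powr s" by (simp add: powr_mult)
    also have "2 powr s \<le> (2::real)" using powr_mono[of s 1 "2::real"] s1 by simp
    finally show ?thesis by (simp add: mult_right_mono)
  qed
  show ?thesis
  proof (rule that[OF s0 s1])
    show "0 \<le> 2 * B * C" using B C by simp
    fix n :: nat assume n: "0 < n"
    obtain k where k: "2 ^ k \<le> n" "n < 2 ^ (k + 1)" using ex_power_ivl1[of 2 n] n by auto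
    have "?L n \<le> C * ?L (2 ^ Suc k)" using k by (intro fundamental_mono[OF U]) simp
    also have "\<dots> \<le> C * (B * (2 * real (2 ^ k) powr s))"
      using C B by (intro mult_left_mono order_trans[OF dyadic_le] two) auto
    also have "\<dots> \<le> C * (B * (2 * real n powr s))"
      using C B k s0 by (intro mult_left_mono powr_mono2) (auto simp flip: of_nat_le_iff)
    finally show "?L n \<le> 2 * B * C * real n powr s" by (simp add: mult_ac)
    have "real n powr s \<le> real (2 ^ Suc k) powr s"
      using k s0 by (intro powr_mono2) (auto simp del: of_nat_power)
    also have "\<dots> \<le> 2 * (B * ?L (2 ^ k))" by (intro order_trans[OF two] mult_left_mono dyadic_ge) simp
    also have "\<dots> \<le> 2 * (B * (C * ?L n))"
      using B k by (intro mult_left_mono fundamental_mono[OF U]) auto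
    finally show "real n powr s \<le> 2 * B * C * ?L n" by (simp add: mult_ac)
  qed
qed

text \<open>Splitting the indices by the value of the coefficient gives constant vectors, whose norms are known
from the fundamental function. Adding them up, or keeping only the one of largest mass, loses no
more than the number of distinct values.\<close>

lemma grouped_norm_estimate:
  fixes w :: "nat \<Rightarrow> real" and T :: nat
  assumes U: "uniformly_subsymmetric C x" and s: "0 < s" "s \<le> 1" and K: "0 \<le> K"
    and fund_le: "\<And>n. 0 < n \<Longrightarrow> fundamental x n \<le> K * real n powr s"
    and fund_ge: "\<And>n. 0 < n \<Longrightarrow> real n powr s \<le> K * fundamental x n"
  defines "tot \<equiv> \<Sum>t<T. \<bar>w t\<bar> powr (1 / s)"
  shows "norm (\<Sum>t<T. w t *\<^sub>R x t) \<le> K * C\<^sup>2 * real (card (w ` {..<T})) * tot powr s"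
    and "tot powr s \<le> K * C\<^sup>2 * real (card (w ` {..<T})) * norm (\<Sum>t<T. w t *\<^sub>R x t)"
proof -
  have C: "1 \<le> C" by (rule unif_subsym_ge_1[OF U])
  define V where "V = w ` {..<T}"
  have finV: "finite V" by (simp add: V_def)
  define F where "F v = {t. t \<in> {..<T} \<and> w t = v}" for v
  have F: "finite (F v)" "v \<in> V \<Longrightarrow> 0 < card (F v)" for v
    by (auto simp: F_def V_def card_gt_0_iff)
  define mass where "mass v = (\<Sum>t\<in>F v. \<bar>w t\<bar> powr (1 / s))" for v
  have mass_s: "mass v powr s = real (card (F v)) powr s * \<bar>v\<bar>" for v
  proof -
    have "mass v = real (card (F v)) * \<bar>v\<bar> powr (1 / s)" by (simp add: mass_def F_def)
    then show ?thesis using s by (simp add: powr_mult powr_powr)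
  qed
  define A where "A v = norm (\<Sum>t\<in>F v. w t *\<^sub>R x t)" for v
  have A_eq: "A v = \<bar>v\<bar> * norm (\<Sum>t\<in>F v. x t)" for v
  proof -
    have "(\<Sum>t\<in>F v. w t *\<^sub>R x t) = v *\<^sub>R (\<Sum>t\<in>F v. x t)"
      unfolding scaleR_sum_right by (intro sum.cong) (auto simp: F_def)
    then show ?thesis by (simp add: A_def)
  qed
  have A_le: "A v \<le> K * C * mass v powr s" if v: "v \<in> V" for v
  proof -
    have "norm (\<Sum>t\<in>F v. x t) \<le> C * (K * real (card (F v)) powr s)"
      using unif_subsym_fundamental_card(1)[OF U F(1)[of v]] fund_le[OF F(2)[OF v]] C
      by (meson mult_left_mono order_trans zero_le_one)
    then have "A v \<le> \<bar>v\<bar> * (C * (K * real (card (F v)) powr s))" unfolding A_eq by (rule mult_left_mono) simp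
    then show ?thesis unfolding mass_s by (simp add: mult_ac)
  qed
  have mass_le: "mass v powr s \<le> K * C * A v" if v: "v \<in> V" for v
  proof -
    have "real (card (F v)) powr s \<le> K * (C * norm (\<Sum>t\<in>F v. x t))"
      using fund_ge[OF F(2)[OF v]] unif_subsym_fundamental_card(2)[OF U F(1)[of v]] K
      by (meson mult_left_mono order_trans)
    then have "real (card (F v)) powr s * \<bar>v\<bar> \<le> K * (C * norm (\<Sum>t\<in>F v. x t)) * \<bar>v\<bar>" by (rule mult_right_mono) simp
    then show ?thesis unfolding mass_s A_eq by (simp add: mult_ac)
  qed
  have group: "(\<Sum>t<T. g t) = (\<Sum>v\<in>V. \<Sum>t\<in>F v. g t)" for g :: "nat \<Rightarrow> 'd::comm_monoid_add"
    unfolding V_def F_def by (rule sum.image_gen) simp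
  have tot: "tot = (\<Sum>v\<in>V. mass v)" unfolding tot_def mass_def by (rule group)
  have mass0: "0 \<le> mass v" for v by (simp add: mass_def sum_nonneg)
  have "norm (\<Sum>t<T. w t *\<^sub>R x t) \<le> (\<Sum>v\<in>V. A v)"
    unfolding group[of "\<lambda>t. w t *\<^sub>R x t"] A_def by (rule norm_sum)
  also have "\<dots> \<le> real (card V) * (K * C * tot powr s)"
  proof (rule sum_bounded_above)
    fix v assume v: "v \<in> V"
    have "mass v \<le> tot" unfolding tot by (rule member_le_sum[OF v _ finV]) (rule mass0)
    then have "mass v powr s \<le> tot powr s" using s mass0 by (intro powr_mono2) auto
    then have "K * C * mass v powr s \<le> K * C * tot powr s" using K C by (intro mult_left_mono) auto
    with A_le[OF v] show "A v \<le> K * C * tot powr s" by linarith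
  qed
  also have "\<dots> \<le> real (card V) * (K * C\<^sup>2 * tot powr s)"
    using K C by (intro mult_left_mono mult_right_mono) (auto simp: power2_eq_square)
  finally show "norm (\<Sum>t<T. w t *\<^sub>R x t) \<le> K * C\<^sup>2 * real (card (w ` {..<T})) * tot powr s"
    by (simp add: V_def mult_ac)
  show "tot powr s \<le> K * C\<^sup>2 * real (card (w ` {..<T})) * norm (\<Sum>t<T. w t *\<^sub>R x t)"
    unfolding V_def[symmetric]
  proof (cases "V = {}")
    case True
    then show "tot powr s \<le> K * C\<^sup>2 * real (card V) * norm (\<Sum>t<T. w t *\<^sub>R x t)" by (simp add: tot)
  next
    case False
    have "Max (mass ` V) \<in> mass ` V" using False finV by (intro Max_in) auto
    then obtain v where v: "v \<in> V" "mass v = Max (mass ` V)" by auto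
    have "tot \<le> real (card V) * mass v"
      unfolding tot by (rule sum_bounded_above) (use finV v in auto)
    then have "tot powr s \<le> (real (card V) * mass v) powr s"
      using s mass0 by (intro powr_mono2) (auto simp: tot sum_nonneg)
    also have "\<dots> = real (card V) powr s * mass v powr s" using mass0 by (simp add: powr_mult)
    also have "\<dots> \<le> real (card V) * (K * C * (C * norm (\<Sum>t<T. w t *\<^sub>R x t)))"
    proof (intro mult_mono)
      have "1 \<le> real (card V)" using False finV by (simp add: Suc_le_eq card_gt_0_iff)
      then show "real (card V) powr s \<le> real (card V)" using powr_mono[OF s(2), of "real (card V)"] by simp
      have "A v \<le> C * norm (\<Sum>t<T. w t *\<^sub>R x t)"
        unfolding A_def by (rule unif_subsym_restrict[OF U]) (auto simp: F_def)
      then have "K * C * A v \<le> K * C * (C * norm (\<Sum>t<T. w t *\<^sub>R x t))" using K C by (intro mult_left_mono) auto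
      with mass_le[OF v(1)] show "mass v powr s \<le> K * C * (C * norm (\<Sum>t<T. w t *\<^sub>R x t))" by linarith
    qed auto
    finally show "tot powr s \<le> K * C\<^sup>2 * real (card V) * norm (\<Sum>t<T. w t *\<^sub>R x t)"
      by (simp add: power2_eq_square mult_ac)
  qed
qed

text \<open>For the $k$-th tensor power both the norm (up to $B^k$) and the $\<ell>_p$ norm (exactly) are $k$-th
powers, and by grouping equal coefficients they agree up to a factor polynomial in $k$. Taking
$k$-th roots leaves only the constant $B$. Here $p = 1/s$.\<close>

lemma multiplicative_norm_imp_lp_norm:
  assumes U: "uniformly_subsymmetric C x" and B: "1 \<le> B"
    and tens_le: "\<And>m b n a. norm (tensor_sum x m b n a) \<le>
      B * (norm (\<Sum>j<m. b j *\<^sub>R x j) * norm (\<Sum>i<n. a i *\<^sub>R x i))"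
    and tens_ge: "\<And>m b n a. norm (\<Sum>j<m. b j *\<^sub>R x j) * norm (\<Sum>i<n. a i *\<^sub>R x i) \<le>
      B * norm (tensor_sum x m b n a)"
    and s: "0 < s" "s \<le> 1" and K: "0 \<le> K"
    and fund_le: "\<And>n. 0 < n \<Longrightarrow> fundamental x n \<le> K * real n powr s"
    and fund_ge: "\<And>n. 0 < n \<Longrightarrow> real n powr s \<le> K * fundamental x n"
  shows "norm (\<Sum>i<n. a i *\<^sub>R x i) \<le> B * (\<Sum>i<n. \<bar>a i\<bar> powr (1 / s)) powr s"
    and "(\<Sum>i<n. \<bar>a i\<bar> powr (1 / s)) powr s \<le> B * norm (\<Sum>i<n. a i *\<^sub>R x i)"
proof -
  define \<alpha> where "\<alpha> = norm (\<Sum>i<n. a i *\<^sub>R x i)"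
  define S where "S = (\<Sum>i<n. \<bar>a i\<bar> powr (1 / s))"
  define \<nu> where "\<nu> k = norm (\<Sum>t<n ^ k. tensor_power n a k t *\<^sub>R x t)" for k
  define D where "D = K * C\<^sup>2"
  have D: "0 \<le> D" using K by (simp add: D_def)
  have x0: "0 < norm (x 0)" using unif_subsym_nonzero[OF U] by simp
  have \<nu>_Suc: "\<nu> (Suc k) = norm (tensor_sum x (n ^ k) (tensor_power n a k) n a)" for k
    by (simp add: \<nu>_def tensor_sum_div_mod mult.commute)
  have \<nu>_le: "\<nu> k \<le> (B * \<alpha>) ^ k * norm (x 0)" for k
  proof (induction k)
    case (Suc k)
    have "\<nu> (Suc k) \<le> B * (\<nu> k * \<alpha>)" unfolding \<nu>_Suc unfolding \<nu>_def \<alpha>_def by (rule tens_le)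
    also have "\<dots> \<le> B * (((B * \<alpha>) ^ k * norm (x 0)) * \<alpha>)"
      using B by (intro mult_left_mono mult_right_mono Suc) (auto simp: \<alpha>_def)
    finally show ?case by (simp add: mult_ac)
  qed (simp add: \<nu>_def)
  have \<nu>_ge: "\<alpha> ^ k * norm (x 0) \<le> B ^ k * \<nu> k" for k
  proof (induction k)
    case (Suc k)
    have "\<alpha> ^ Suc k * norm (x 0) = (\<alpha> ^ k * norm (x 0)) * \<alpha>" by simp
    also have "\<dots> \<le> B ^ k * \<nu> k * \<alpha>" by (intro mult_right_mono Suc) (simp add: \<alpha>_def)
    also have "\<dots> = B ^ k * (\<nu> k * \<alpha>)" by simp
    also have "\<dots> \<le> B ^ k * (B * \<nu> (Suc k))"
      unfolding \<nu>_Suc using B by (intro mult_left_mono) (auto simp: \<nu>_def \<alpha>_def tens_ge)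
    finally show ?case by (simp add: mult_ac)
  qed (simp add: \<nu>_def)
  have S_power: "(S ^ k) powr s = (S powr s) ^ k" for k
    by (induction k) (simp_all add: powr_mult S_def sum_nonneg)
  have tot: "(\<Sum>t<n ^ k. \<bar>tensor_power n a k t\<bar> powr (1 / s)) powr s = (S powr s) ^ k" for k
    unfolding sum_tensor_power_powr S_def[symmetric] by (rule S_power)
  have card: "real (card (tensor_power n a k ` {..<n ^ k})) \<le> real (k + 1) ^ n" for k
    using card_tensor_power_values_le[of n a k] by (metis of_nat_le_iff of_nat_power)
  note est = grouped_norm_estimate[OF U s K fund_le fund_ge]
  have "\<alpha> \<le> B * S powr s"
  proof (rule le_of_powers_le_polynomial)
    fix k
    have "\<nu> k \<le> D * real (card (tensor_power n a k ` {..<n ^ k})) * (S powr s) ^ k"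
      using est(1)[where w = "tensor_power n a k" and T = "n ^ k"] unfolding tot D_def \<nu>_def .
    also have "\<dots> \<le> D * real (k + 1) ^ n * (S powr s) ^ k"
      using D by (intro mult_left_mono mult_right_mono card) auto
    finally have "B ^ k * \<nu> k \<le> B ^ k * (D * real (k + 1) ^ n * (S powr s) ^ k)"
      using B by (intro mult_left_mono) auto
    with \<nu>_ge[of k] have "\<alpha> ^ k * norm (x 0) \<le> D * real (k + 1) ^ n * (B * S powr s) ^ k"
      by (simp add: power_mult_distrib mult_ac)
    then show "\<alpha> ^ k \<le> D / norm (x 0) * real (k + 1) ^ n * (B * S powr s) ^ k"
      using x0 by (simp add: field_simps)
  qed (use B in \<open>auto simp: \<alpha>_def\<close>)
  then show "norm (\<Sum>i<n. a i *\<^sub>R x i) \<le> B * (\<Sum>i<n. \<bar>a i\<bar> powr (1 / s)) powr s"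
    by (simp add: \<alpha>_def S_def)
  have "S powr s \<le> B * \<alpha>"
  proof (rule le_of_powers_le_polynomial)
    fix k
    have "(S powr s) ^ k \<le> D * real (card (tensor_power n a k ` {..<n ^ k})) * \<nu> k"
      using est(2)[where w = "tensor_power n a k" and T = "n ^ k"] unfolding tot D_def \<nu>_def .
    also have "\<dots> \<le> D * real (k + 1) ^ n * ((B * \<alpha>) ^ k * norm (x 0))"
      using D by (intro mult_mono \<nu>_le mult_left_mono card) (auto simp: \<nu>_def)
    finally show "(S powr s) ^ k \<le> D * norm (x 0) * real (k + 1) ^ n * (B * \<alpha>) ^ k"
      by (simp add: mult_ac)
  qed (use B in \<open>auto simp: \<alpha>_def\<close>)
  then show "(\<Sum>i<n. \<bar>a i\<bar> powr (1 / s)) powr s \<le> B * norm (\<Sum>i<n. a i *\<^sub>R x i)"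
    by (simp add: \<alpha>_def S_def)
qed


section \<open>Equivalence to the unit vector bases\<close>

lemma sum_unit_seq: "(\<Sum>j<n. a j * unit_seq j i) = (if i < n then a i else 0)"
proof -
  have "(\<Sum>j<n. a j * unit_seq j i) = (\<Sum>j<n. if j = i then a j else 0)"
    by (intro sum.cong refl) (auto simp: unit_seq_def)
  then show ?thesis by simp
qed

text \<open>A limit of the partial sums in a norm that dominates the coordinates can only be the sequence of
coefficients itself.\<close>

lemma eq_of_truncations_converge:
  fixes a s :: "nat \<Rightarrow> real"
  assumes lim: "(\<lambda>n. N (\<lambda>i. (\<Sum>j<n. a j * unit_seq j i) - s i)) \<longlonglongrightarrow> 0"
    and le: "\<And>n i. \<bar>(if i < n then a i else 0) - s i\<bar> \<le> N (\<lambda>i. (if i < n then a i else 0) - s i)"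
  shows "a = s"
proof
  fix i
  have "\<bar>a i - s i\<bar> \<le> 0"
  proof (rule tendsto_lowerbound[OF lim])
    show "\<forall>\<^sub>F n in sequentially. \<bar>a i - s i\<bar> \<le> N (\<lambda>i. (\<Sum>j<n. a j * unit_seq j i) - s i)"
      using eventually_gt_at_top[of i]
    proof eventually_elim
      case (elim n)
      then show ?case using le[of i n] by (simp add: sum_unit_seq)
    qed
  qed simp
  then show "a i = s i" by simp
qed

lemma summable_in_lp_iff:
  assumes p: "0 < p"
  shows "summable_in (lp_space p) (lp_norm p) (\<lambda>j i. a j * unit_seq j i) \<longleftrightarrow>
    summable (\<lambda>i. \<bar>a i\<bar> powr p)"
proof
  assume sm: "summable (\<lambda>i. \<bar>a i\<bar> powr p)"
  have "lp_norm p (\<lambda>i. (\<Sum>j<n. a j * unit_seq j i) - a i) = (\<Sum>k. \<bar>a (k + n)\<bar> powr p) powr (1 / p)" for n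
  proof -
    let ?f = "\<lambda>i. \<bar>(if i < n then a i else 0) - a i\<bar> powr p"
    have eq: "?f (k + n) = \<bar>a (k + n)\<bar> powr p" for k by simp
    have "summable (\<lambda>k. ?f (k + n))" unfolding eq using sm by (rule summable_ignore_initial_segment)
    then have "summable ?f" by (rule summable_iff_shift[of ?f n, THEN iffD1])
    from suminf_split_initial_segment[OF this, of n]
    have "suminf ?f = (\<Sum>k. \<bar>a (k + n)\<bar> powr p)" unfolding eq by simp
    then show ?thesis by (simp add: lp_norm_def sum_unit_seq)
  qed
  moreover have "(\<lambda>n. (\<Sum>k. \<bar>a (k + n)\<bar> powr p) powr (1 / p)) \<longlonglongrightarrow> 0"
  proof (rule tendsto_zero_powrI[where b = "1 / p"])
    show "(\<lambda>n. \<Sum>k. \<bar>a (k + n)\<bar> powr p) \<longlonglongrightarrow> 0" using sm by (rule suminf_exist_split2)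
    show "\<forall>\<^sub>F n in sequentially. 0 \<le> (\<Sum>k. \<bar>a (k + n)\<bar> powr p)"
      using sm by (intro always_eventually allI suminf_nonneg summable_ignore_initial_segment) auto
  qed (use p in auto)
  ultimately show "summable_in (lp_space p) (lp_norm p) (\<lambda>j i. a j * unit_seq j i)"
    unfolding summable_in_def using sm by (intro bexI[of _ a]) (simp_all add: lp_space_def)
next
  assume "summable_in (lp_space p) (lp_norm p) (\<lambda>j i. a j * unit_seq j i)"
  then obtain s where s: "summable (\<lambda>i. \<bar>s i\<bar> powr p)"
      "(\<lambda>n. lp_norm p (\<lambda>i. (\<Sum>j<n. a j * unit_seq j i) - s i)) \<longlonglongrightarrow> 0"
    by (auto simp: summable_in_def lp_space_def)
  have "a = s"
  proof (rule eq_of_truncations_converge[OF s(2)])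
    fix n i
    let ?f = "\<lambda>i. \<bar>(if i < n then a i else 0) - s i\<bar> powr p"
    have "summable ?f \<longleftrightarrow> summable (\<lambda>i. \<bar>s i\<bar> powr p)"
      by (rule summable_cong) (use eventually_ge_at_top[of n] in eventually_elim, simp)
    with s(1) have "summable ?f" by simp
    then have "sum ?f {i} \<le> suminf ?f" by (intro sum_le_suminf) auto
    then have "?f i powr (1 / p) \<le> suminf ?f powr (1 / p)" using p by (intro powr_mono2) auto
    then show "\<bar>(if i < n then a i else 0) - s i\<bar> \<le> lp_norm p (\<lambda>i. (if i < n then a i else 0) - s i)"
      using p by (simp add: lp_norm_def powr_powr)
  qed
  with s show "summable (\<lambda>i. \<bar>a i\<bar> powr p)" by simp
qed

lemma summable_in_c0_iff:
  "summable_in c0_space c0_norm (\<lambda>j i. a j * unit_seq j i) \<longleftrightarrow> a \<longlonglongrightarrow> 0"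
proof
  assume a: "a \<longlonglongrightarrow> 0"
  have "(\<lambda>n. c0_norm (\<lambda>i. (\<Sum>j<n. a j * unit_seq j i) - a i)) \<longlonglongrightarrow> 0"
  proof (rule LIMSEQ_I)
    fix e :: real assume e: "0 < e"
    then have "0 < e / 2" by simp
    from LIMSEQ_D[OF a this] obtain N where N: "\<And>i. i \<ge> N \<Longrightarrow> \<bar>a i\<bar> < e / 2" by auto
    have "norm (c0_norm (\<lambda>i. (\<Sum>j<n. a j * unit_seq j i) - a i) - 0) < e" if "n \<ge> N" for n
    proof -
      let ?f = "\<lambda>i. \<bar>(\<Sum>j<n. a j * unit_seq j i) - a i\<bar>"
      have le: "?f i \<le> e / 2" for i
      proof (cases "i < n")
        case False
        then have "\<bar>a i\<bar> < e / 2" using that by (intro N) simp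
        then show ?thesis using False by (simp add: sum_unit_seq)
      qed (use e in \<open>simp add: sum_unit_seq\<close>)
      then have "(SUP i. ?f i) \<le> e / 2" by (intro cSUP_least) auto
      moreover have "?f 0 \<le> (SUP i. ?f i)" using le by (intro cSUP_upper bdd_aboveI2[of _ _ "e / 2"]) auto
      ultimately show ?thesis using e by (simp add: c0_norm_def)
    qed
    then show "\<exists>N. \<forall>n\<ge>N. norm (c0_norm (\<lambda>i. (\<Sum>j<n. a j * unit_seq j i) - a i) - 0) < e" by blast
  qed
  with a show "summable_in c0_space c0_norm (\<lambda>j i. a j * unit_seq j i)"
    unfolding summable_in_def c0_space_def by (intro bexI[of _ a]) auto
next
  assume "summable_in c0_space c0_norm (\<lambda>j i. a j * unit_seq j i)"
  then obtain s where s: "s \<longlonglongrightarrow> 0"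
      "(\<lambda>n. c0_norm (\<lambda>i. (\<Sum>j<n. a j * unit_seq j i) - s i)) \<longlonglongrightarrow> 0"
    by (auto simp: summable_in_def c0_space_def)
  have "a = s"
  proof (rule eq_of_truncations_converge[OF s(2)])
    fix n i
    have "(\<lambda>i. (if i < n then a i else 0) - s i) \<longlonglongrightarrow> 0"
    proof (rule Lim_transform_eventually)
      show "(\<lambda>i. - s i) \<longlonglongrightarrow> 0" using s(1) tendsto_minus[of s 0] by simp
      show "\<forall>\<^sub>F i in sequentially. - s i = (if i < n then a i else 0) - s i"
        using eventually_ge_at_top[of n] by eventually_elim simp
    qed
    then have "Bseq (\<lambda>i. (if i < n then a i else 0) - s i)"
      by (intro convergent_imp_Bseq) (auto simp: convergent_def)
    then obtain M where M: "\<And>i. \<bar>(if i < n then a i else 0) - s i\<bar> \<le> M" by (auto simp: Bseq_def)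
    show "\<bar>(if i < n then a i else 0) - s i\<bar> \<le> c0_norm (\<lambda>i. (if i < n then a i else 0) - s i)"
      unfolding c0_norm_def by (intro cSUP_upper bdd_aboveI2[of _ _ M] M) simp
  qed
  with s show "a \<longlonglongrightarrow> 0" by simp
qed

lemma unif_subsym_bounded_fundamental_imp_c0:
  fixes x :: "nat \<Rightarrow> 'a::banach"
  assumes U: "uniformly_subsymmetric C x" and K: "\<And>n. fundamental x n \<le> K"
  shows "equivalent_to_unit_basis c0_space c0_norm x"
  unfolding equivalent_to_unit_basis_def summable_in_c0_iff
proof (intro allI iffI)
  have C: "1 \<le> C" by (rule unif_subsym_ge_1[OF U])
  fix a :: "nat \<Rightarrow> real"
  have x0: "0 < norm (x 0)" using unif_subsym_nonzero[OF U] by simp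
  {
    assume "summable (\<lambda>j. a j *\<^sub>R x j)"
    then have "(\<lambda>j. a j *\<^sub>R x j) \<longlonglongrightarrow> 0" by (rule summable_LIMSEQ_zero)
    then have lim: "(\<lambda>j. norm (a j *\<^sub>R x j) * (C / norm (x 0))) \<longlonglongrightarrow> 0"
      by (intro tendsto_mult_left_zero tendsto_norm_zero)
    have le: "\<bar>a j\<bar> \<le> norm (a j *\<^sub>R x j) * (C / norm (x 0))" for j
    proof -
      have "\<bar>a j\<bar> * norm (x 0) \<le> \<bar>a j\<bar> * (C * norm (x j))" by (intro mult_left_mono unif_subsym_norm_le[OF U]) simp
      then show ?thesis using x0 by (simp add: field_simps)
    qed
    show "a \<longlonglongrightarrow> 0" using le by (intro Lim_null_comparison[OF always_eventually lim]) simp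
  }
  assume a: "a \<longlonglongrightarrow> 0"
  have "0 < fundamental x 1" using fundamental_pos[OF U] by simp
  with K[of 1] have K0: "0 < K" by linarith
  show "summable (\<lambda>j. a j *\<^sub>R x j)"
    unfolding summable_Cauchy
  proof (intro allI impI)
    fix e :: real assume e: "0 < e"
    define \<delta> where "\<delta> = e / (2 * (C * (C * K)))"
    have "0 < \<delta>" using e C K0 by (simp add: \<delta>_def)
    with a obtain N where N: "\<And>i. i \<ge> N \<Longrightarrow> \<bar>a i\<bar> < \<delta>" unfolding LIMSEQ_iff by auto
    have "norm (\<Sum>i=m..<n. a i *\<^sub>R x i) < e" if "m \<ge> N" for m n
    proof -
      have "norm (\<Sum>i=m..<n. a i *\<^sub>R x i) \<le> C * norm (\<Sum>i=m..<n. \<delta> *\<^sub>R x i)"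
        using N that \<open>0 < \<delta>\<close> by (intro unif_subsym_dominated[OF U]) (auto intro: less_imp_le)
      also have "norm (\<Sum>i=m..<n. \<delta> *\<^sub>R x i) = \<delta> * norm (\<Sum>i=m..<n. x i)"
        using \<open>0 < \<delta>\<close> by (simp flip: scaleR_sum_right)
      also have "C * (\<delta> * norm (\<Sum>i=m..<n. x i)) \<le> C * (\<delta> * (C * K))"
        using C \<open>0 < \<delta>\<close> unif_subsym_fundamental_card(1)[OF U, of "{m..<n}"] K[of "card {m..<n}"]
        by (intro mult_left_mono) (auto intro: order_trans mult_left_mono)
      also have "\<dots> = e / 2" using C K0 by (simp add: \<delta>_def)
      also have "\<dots> < e" using e by simp
      finally show ?thesis .
    qed
    then show "\<exists>N. \<forall>m\<ge>N. \<forall>n. norm (\<Sum>i=m..<n. a i *\<^sub>R x i) < e" by blast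
  qed
qed

lemma lp_norm_estimate_imp_lp:
  fixes x :: "nat \<Rightarrow> 'a::banach"
  assumes s: "0 < s" and B: "0 < B"
    and le: "\<And>n a. norm (\<Sum>i<n. a i *\<^sub>R x i) \<le> B * (\<Sum>i<n. \<bar>a i\<bar> powr (1 / s)) powr s"
    and ge: "\<And>n a. (\<Sum>i<n. \<bar>a i\<bar> powr (1 / s)) powr s \<le> B * norm (\<Sum>i<n. a i *\<^sub>R x i)"
  shows "equivalent_to_unit_basis (lp_space (1 / s)) (lp_norm (1 / s)) x"
proof -
  have "summable (\<lambda>j. a j *\<^sub>R x j) \<longleftrightarrow> summable (\<lambda>i. \<bar>a i\<bar> powr (1 / s))" for a :: "nat \<Rightarrow> real"
  proof -
    let ?\<sigma> = "\<lambda>m n. \<Sum>i=m..<n. \<bar>a i\<bar> powr (1 / s)"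
    have from_m: "(\<Sum>i<n. if m \<le> i then f i else 0) = (\<Sum>i=m..<n. f i)" for m n and f :: "nat \<Rightarrow> 'd::comm_monoid_add"
      by (intro sum.mono_neutral_cong_right) auto
    have eqs: "(\<Sum>i<n. (if m \<le> i then a i else 0) *\<^sub>R x i) = (\<Sum>i=m..<n. a i *\<^sub>R x i)"
      "(\<Sum>i<n. \<bar>if m \<le> i then a i else 0\<bar> powr (1 / s)) = ?\<sigma> m n" for m n
      unfolding from_m[symmetric] by (intro sum.cong refl; simp)+
    have tail_le: "norm (\<Sum>i=m..<n. a i *\<^sub>R x i) \<le> B * ?\<sigma> m n powr s"
      and tail_ge: "?\<sigma> m n powr s \<le> B * norm (\<Sum>i=m..<n. a i *\<^sub>R x i)" for m n
      using le[where n = n and a = "\<lambda>i. if m \<le> i then a i else 0"]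
        ge[where n = n and a = "\<lambda>i. if m \<le> i then a i else 0"] unfolding eqs by auto
    have \<sigma>0: "0 \<le> ?\<sigma> m n" for m n by (intro sum_nonneg) simp
    show ?thesis
    proof
      assume sm: "summable (\<lambda>j. a j *\<^sub>R x j)"
      show "summable (\<lambda>i. \<bar>a i\<bar> powr (1 / s))"
        unfolding summable_Cauchy
      proof (intro allI impI)
        fix e :: real assume e: "0 < e"
        then have "0 < e powr s / B" using B by simp
        with sm obtain N where N: "\<And>m n. m \<ge> N \<Longrightarrow> norm (\<Sum>i=m..<n. a i *\<^sub>R x i) < e powr s / B"
          unfolding summable_Cauchy by meson
        have "norm (?\<sigma> m n) < e" if "m \<ge> N" for m n
        proof (rule ccontr)
          assume "\<not> norm (?\<sigma> m n) < e"
          then have "e \<le> ?\<sigma> m n" using \<sigma>0[of m n] by simp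
          then have "e powr s \<le> ?\<sigma> m n powr s" using e s by (intro powr_mono2) auto
          also have "\<dots> \<le> B * norm (\<Sum>i=m..<n. a i *\<^sub>R x i)" by (rule tail_ge)
          also have "\<dots> < B * (e powr s / B)" using N[OF that] B by (rule mult_strict_left_mono)
          finally show False using B by simp
        qed
        then show "\<exists>N. \<forall>m\<ge>N. \<forall>n. norm (?\<sigma> m n) < e" by blast
      qed
    next
      assume sm: "summable (\<lambda>i. \<bar>a i\<bar> powr (1 / s))"
      show "summable (\<lambda>j. a j *\<^sub>R x j)"
        unfolding summable_Cauchy
      proof (intro allI impI)
        fix e :: real assume e: "0 < e"
        then have "0 < (e / B) powr (1 / s)" using B by simp
        with sm obtain N where N: "\<And>m n. m \<ge> N \<Longrightarrow> norm (?\<sigma> m n) < (e / B) powr (1 / s)"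
          unfolding summable_Cauchy by meson
        have "norm (\<Sum>i=m..<n. a i *\<^sub>R x i) < e" if "m \<ge> N" for m n
        proof -
          have "?\<sigma> m n < (e / B) powr (1 / s)" using N[OF that, of n] \<sigma>0[of m n] by simp
          then have "?\<sigma> m n powr s < ((e / B) powr (1 / s)) powr s"
            using s \<sigma>0 by (intro powr_less_mono2) auto
          also have "\<dots> = e / B" using s e B by (simp add: powr_powr)
          finally have "B * ?\<sigma> m n powr s < B * (e / B)" using B by (rule mult_strict_left_mono)
          with tail_le[of m n] show ?thesis using B by simp
        qed
        then show "\<exists>N. \<forall>m\<ge>N. \<forall>n. norm (\<Sum>i=m..<n. a i *\<^sub>R x i) < e" by blast
      qed
    qed
  qed
  then show ?thesis
    unfolding equivalent_to_unit_basis_def using s by (simp add: summable_in_lp_iff)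
qed

section \<open>The dichotomy\<close>

theorem theorem21:
  fixes e :: "nat \<Rightarrow> 'a::banach"
    and estar :: "nat \<Rightarrow> 'a \<Rightarrow>\<^sub>L real"
  assumes "schauder_basis_of UNIV e"
    and "subsymmetric e"
    and "\<And>p. 1 \<le> p \<Longrightarrow> \<not> equivalent_to_unit_basis (lp_space p) (lp_norm p) e"
    and "\<not> equivalent_to_unit_basis c0_space c0_norm e"
    and "biorthogonal e estar"
  shows "admits_continuum_of_subsymmetric_blocks e \<or>
         admits_continuum_of_subsymmetric_blocks estar"
proof (rule ccontr)
  assume no_continuum: "\<not> ?thesis"
  obtain C where U: "uniformly_subsymmetric C e"
    using subsymmetric_basis_imp_unif_subsym[OF assms(1,2)] by blast
  have "uniformly_subsymmetric (C\<^sup>2) estar" by (rule biorthogonal_unif_subsym[OF assms(1) U assms(5)])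
  then have bounded: "tensor_bounded e" "tensor_bounded estar"
    using no_continuum not_tensor_bounded_imp_continuum U by blast+
  obtain B1 where B1: "\<And>m b n a. norm (tensor_sum e m b n a) \<le>
      B1 * (norm (\<Sum>j<m. b j *\<^sub>R e j) * norm (\<Sum>i<n. a i *\<^sub>R e i))"
    using bounded(1) unfolding tensor_bounded_def by blast
  obtain B2 where B2: "\<And>m b n a. norm (\<Sum>j<m. b j *\<^sub>R e j) * norm (\<Sum>i<n. a i *\<^sub>R e i)
      \<le> B2 * norm (tensor_sum e m b n a)"
    using dual_tensor_bounded_imp_tensor_ge[OF assms(1) U assms(5) bounded(2)] by blast
  define B where "B = max 1 (max B1 B2)"
  have B: "1 \<le> B" by (simp add: B_def)
  have tens_le: "norm (tensor_sum e m b n a) \<le>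
      B * (norm (\<Sum>j<m. b j *\<^sub>R e j) * norm (\<Sum>i<n. a i *\<^sub>R e i))" for m b n a
    by (rule order_trans[OF B1 mult_right_mono]) (auto simp: B_def)
  have tens_ge: "norm (\<Sum>j<m. b j *\<^sub>R e j) * norm (\<Sum>i<n. a i *\<^sub>R e i)
      \<le> B * norm (tensor_sum e m b n a)" for m b n a
    by (rule order_trans[OF B2 mult_right_mono]) (auto simp: B_def)
  obtain s K where s: "0 \<le> s" "s \<le> 1" and K: "0 \<le> K"
    and fund: "\<And>n. 0 < n \<Longrightarrow> fundamental e n \<le> K * real n powr s"
      "\<And>n. 0 < n \<Longrightarrow> real n powr s \<le> K * fundamental e n"
    using fundamental_power_like[OF U B tens_le tens_ge] by blast
  show False
  proof (cases "s = 0")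
    case True
    have "fundamental e n \<le> K" for n
      using fund(1)[of n] K True by (cases "n = 0") (auto simp: fundamental_def)
    then show False using unif_subsym_bounded_fundamental_imp_c0[OF U] assms(4) by blast
  next
    case False
    with s have s_pos: "0 < s" by simp
    note est = multiplicative_norm_imp_lp_norm[OF U B tens_le tens_ge s_pos s(2) K fund]
    have "equivalent_to_unit_basis (lp_space (1 / s)) (lp_norm (1 / s)) e"
      using s_pos B by (intro lp_norm_estimate_imp_lp[where B = B] est) auto
    moreover have "1 \<le> 1 / s" using s s_pos by simp
    ultimately show False using assms(3) by blast
  qed
qed

end
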